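(* Let $(k_n)_{n\in\mathbb{N}}$ be a sequence of positive numbers with $k_n\to\infty$ as $n\to\infty$, let $\psi:\mathbb{R}\to\mathbb{R}$ be admissible, and let $P_n=[e^{ik_n\psi}H^2(\mathbb{R})]$ for $n\in\mathbb{N}$. Then $P_n\to[L^2(B_-)]$ in the strong operator topology as $n\to\infty$, where $B_-=(\psi')^{-1}\big((-\infty,0)\big)$.
   Context: $H^2(\mathbb{R})\subseteq L^2(\mathbb{R})$ is the Hardy space of the upper half plane (boundary values on the real line). For a closed subspace $K$ of $L^2(\mathbb{R})$, $[K]$ denotes the orthogonal projection of $L^2(\mathbb{R})$ onto $K$. For measurable $E\subseteq\mathbb{R}$, $L^2(E)$ is the subspace of functions in $L^2(\mathbb{R})$ supported on $E$. A function $\psi:\mathbb{R}\to\mathbb{R}$ is admissible if the following subsets of $\mathbb{R}$ are discrete, meaning that they have no accumulation points: (1) the set $\Gamma(\psi)$ of points at which $\psi$ fails to be twice continuously differentiable; (2) $(\psi')^{-1}(0)$; (3) the set $\Lambda(\psi)$ of points at which $\operatorname{sgn}(\psi'')$ is not locally constant. *)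

theory Defs
  imports "HOL-Analysis.Analysis"
begin

text \<open>Elements of \<open>L\<^sup>2(\<real>)\<close> are represented by Borel functions; equality in \<open>L\<^sup>2(\<real>)\<close> is equality
  almost everywhere, and all subspaces below are invariant under it. The squared norm is
  extended-real valued, so it is infinite (rather than 0) on measurable functions outside
  \<open>L\<^sup>2(\<real>)\<close>.\<close>

definition L2_norm_sq :: "(real \<Rightarrow> complex) \<Rightarrow> ennreal" where
  "L2_norm_sq f = (\<integral>\<^sup>+ x. ennreal ((norm (f x))\<^sup>2) \<partial>lborel)"

definition L2 :: "(real \<Rightarrow> complex) set" where
  "L2 = {f \<in> borel_measurable lborel. L2_norm_sq f < \<infinity>}"

definition L2_inner :: "(real \<Rightarrow> complex) \<Rightarrow> (real \<Rightarrow> complex) \<Rightarrow> complex" where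
  "L2_inner f g = (LINT x|lborel. f x * cnj (g x))"

definition L2_on :: "real set \<Rightarrow> (real \<Rightarrow> complex) set" where
  "L2_on E = {f \<in> L2. AE x in lborel. x \<notin> E \<longrightarrow> f x = 0}"

text \<open>The Hardy space of the upper half plane consists of the holomorphic functions \<open>F\<close> whose
  \<open>L\<^sup>2\<close> norms on horizontal lines are uniformly bounded; \<open>H2\<close> is the space of their boundary
  values, taken as limits in \<open>L\<^sup>2(\<real>)\<close> of \<open>F(\<cdot> + i y)\<close> as \<open>y\<close> decreases to 0.\<close>

definition hardy_upper :: "(complex \<Rightarrow> complex) set" where
  "hardy_upper = {F. F holomorphic_on {z. Im z > 0} \<and>
     (\<exists>C::real. \<forall>y>0. L2_norm_sq (\<lambda>x. F (Complex x y)) \<le> ennreal C)}"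

definition H2 :: "(real \<Rightarrow> complex) set" where
  "H2 = {f \<in> L2. \<exists>F \<in> hardy_upper.
     ((\<lambda>y. L2_norm_sq (\<lambda>x. F (Complex x y) - f x)) \<longlongrightarrow> 0) (at_right 0)}"

text \<open>The orthogonal projection \<open>[K]\<close>. For a closed subspace \<open>K\<close> and \<open>f\<close> in \<open>L\<^sup>2(\<real>)\<close> the function
  chosen here exists and is unique up to equality almost everywhere.\<close>

definition orth_proj :: "(real \<Rightarrow> complex) set \<Rightarrow> (real \<Rightarrow> complex) \<Rightarrow> (real \<Rightarrow> complex)" where
  "orth_proj K f = (SOME g. g \<in> K \<and> (\<forall>h\<in>K. L2_inner (\<lambda>x. f x - g x) h = 0))"

definition sot_tendsto ::
    "(nat \<Rightarrow> (real \<Rightarrow> complex) \<Rightarrow> (real \<Rightarrow> complex)) \<Rightarrow>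
     ((real \<Rightarrow> complex) \<Rightarrow> (real \<Rightarrow> complex)) \<Rightarrow> bool" where
  "sot_tendsto T S \<longleftrightarrow>
     (\<forall>f\<in>L2. (\<lambda>n. L2_norm_sq (\<lambda>x. T n f x - S f x)) \<longlonglongrightarrow> 0)"

definition modulated_H2 :: "real \<Rightarrow> (real \<Rightarrow> real) \<Rightarrow> (real \<Rightarrow> complex) set" where
  "modulated_H2 k \<psi> = {(\<lambda>x. exp (\<i> * of_real (k * \<psi> x)) * f x) | f. f \<in> H2}"

definition no_accumulation_points :: "real set \<Rightarrow> bool" where
  "no_accumulation_points S \<longleftrightarrow> (\<forall>x. \<not> x islimpt S)"

text \<open>\<open>deriv\<close> is total, so differentiability is always demanded explicitly. In particular a point
  around which \<open>\<psi>''\<close> is not everywhere defined counts as a point where \<open>sgn \<psi>''\<close> is not locally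
  constant; such points belong to \<open>Gamma_set\<close>, so this does not affect \<open>admissible\<close>.\<close>

definition twice_differentiable_on :: "(real \<Rightarrow> real) \<Rightarrow> real set \<Rightarrow> bool" where
  "twice_differentiable_on \<psi> U \<longleftrightarrow>
     (\<forall>y\<in>U. \<psi> differentiable (at y) \<and> deriv \<psi> differentiable (at y))"

definition Gamma_set :: "(real \<Rightarrow> real) \<Rightarrow> real set" where
  "Gamma_set \<psi> = {x. \<not> (\<exists>U. open U \<and> x \<in> U \<and> twice_differentiable_on \<psi> U \<and>
     continuous_on U (deriv (deriv \<psi>)))}"

definition Lambda_set :: "(real \<Rightarrow> real) \<Rightarrow> real set" where
  "Lambda_set \<psi> = {x. \<not> (\<exists>U. open U \<and> x \<in> U \<and> twice_differentiable_on \<psi> U \<and>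
     (\<lambda>y. sgn (deriv (deriv \<psi>) y)) constant_on U)}"

definition deriv_preimage :: "(real \<Rightarrow> real) \<Rightarrow> real set \<Rightarrow> real set" where
  "deriv_preimage \<psi> A = {x. \<psi> differentiable (at x) \<and> deriv \<psi> x \<in> A}"

definition admissible :: "(real \<Rightarrow> real) \<Rightarrow> bool" where
  "admissible \<psi> \<longleftrightarrow>
     no_accumulation_points (Gamma_set \<psi>) \<and>
     no_accumulation_points (deriv_preimage \<psi> {0}) \<and>
     no_accumulation_points (Lambda_set \<psi>)"

end

theory Submission
  imports
    Defs
    "HOL-Probability.Sinc_Integral"
    "HOL-Complex_Analysis.Cauchy_Integral_Theorem"
    "HOL-Real_Asymp.Real_Asymp"
begin

text \<open>A function \<open>f\<close> in \<open>L\<^sup>2(\<real>)\<close> lies in \<open>H\<^sup>2\<close> if and only if it is orthogonal to the kernels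
  \<open>1 / (x - w)\<close> with \<open>Im w > 0\<close>, that is, if its Cauchy integral vanishes on the lower half plane. Hence
  \<open>H\<^sup>2\<close> is closed, and for the projection \<open>p\<close> of \<open>g\<close> onto \<open>H\<^sup>2\<close> the functions \<open>p\<close> and \<open>p - g\<close> are the
  boundary values of the Cauchy integral of \<open>g\<close> from above and from below. Multiplication by
  \<open>e\<^sup>i\<^sup>k\<^sup>\<psi>\<close> turns the projection onto \<open>e\<^sup>i\<^sup>k\<^sup>\<psi> H\<^sup>2\<close> into the one onto \<open>H\<^sup>2\<close>, applied to \<open>g = e\<^sup>-\<^sup>i\<^sup>k\<^sup>\<psi> f\<close>.
  By density \<open>f\<close> may be taken to be the indicator function of a compact interval on which \<open>\<psi>\<close> is twice
  continuously differentiable and \<open>\<psi>'\<close> does not vanish: the omitted points form a countable set. If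
  \<open>\<psi>' > 0\<close> there, the phase of the Fourier integral of \<open>g\<close> at a frequency \<open>l \<ge> 0\<close> has no stationary
  point, and one integration by parts bounds it by \<open>C / (k c + l)\<close>; by Plancherel the boundary value
  from above then has norm \<open>O(k\<^sup>-\<^sup>1\<^sup>/\<^sup>2)\<close>. If \<open>\<psi>' < 0\<close>, the same holds for the boundary value from below.\<close>

text \<open>For Im z > 0 the kernel 1 / (t - z) is i times the integral of e^(-i l (t - z)) over l
  \<ge> 0, so the Cauchy integral above the real line sees only nonnegative frequencies. This
  one-sidedness is what distinguishes the two signs of \<psi>': for g = e^(-i k \<psi>) f the phase
  derivative is -(k \<psi>' + l), whose two terms cannot cancel when \<psi>' > 0. For \<psi>' < 0
  the estimate applies to the conjugate of g, since conjugation exchanges the half planes. The rate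
  comes from the integral of 1 / (k c + l)^2 over l \<ge> 0, which is 1 / (k c).

  Boundary values are never taken pointwise. The Cauchy integrals at z and at its conjugate differ
  by a Poisson integral, and Poisson integrals converge in norm as the height tends to 0; hence
  bounds on horizontal lines suffice if they are uniform in the height, and of Plancherel only an
  inequality is used. The density argument works because the difference of two orthogonal
  projections maps f to a function of norm at most 2 ||f||, whatever k is.\<close>

section \<open>The norm of square integrable functions\<close>

text \<open>Unlike \<open>L2_norm_sq\<close>, this is 0 on measurable functions outside \<open>L\<^sup>2(\<real>)\<close>.\<close>

definition L2_norm :: "(real \<Rightarrow> complex) \<Rightarrow> real" where
  "L2_norm f = sqrt (LINT x|lborel. (norm (f x))\<^sup>2)"

lemma L2_iff:
  "f \<in> L2 \<longleftrightarrow> f \<in> borel_measurable borel \<and> integrable lborel (\<lambda>x. (norm (f x))\<^sup>2)"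
  by (auto simp: L2_def L2_norm_sq_def integrable_iff_bounded)

lemma L2_measurable [measurable_dest]: "f \<in> L2 \<Longrightarrow> f \<in> borel_measurable borel"
  by (simp add: L2_iff)

lemma L2_integrable_sq: "f \<in> L2 \<Longrightarrow> integrable lborel (\<lambda>x. (norm (f x))\<^sup>2)"
  by (simp add: L2_iff)

lemma L2_norm_nonneg [simp]: "0 \<le> L2_norm f"
  by (simp add: L2_norm_def)

lemma L2_norm_power2: "(L2_norm f)\<^sup>2 = (LINT x|lborel. (norm (f x))\<^sup>2)"
  by (simp add: L2_norm_def)

lemma L2_norm_sq_eq: "f \<in> L2 \<Longrightarrow> L2_norm_sq f = ennreal ((L2_norm f)\<^sup>2)"
  unfolding L2_norm_sq_def L2_norm_power2
  by (intro nn_integral_eq_integral) (auto simp: L2_iff)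

lemma L2_I_bound:
  assumes [measurable]: "f \<in> borel_measurable borel" and "L2_norm_sq f \<le> ennreal (B\<^sup>2)" "0 \<le> B"
  shows "f \<in> L2" "L2_norm f \<le> B"
proof -
  show f: "f \<in> L2" using assms by (auto simp: L2_def intro: le_less_trans)
  have "ennreal ((L2_norm f)\<^sup>2) \<le> ennreal (B\<^sup>2)"
    using assms(2) by (simp add: L2_norm_sq_eq[OF f])
  then show "L2_norm f \<le> B"
    using assms(3) by (simp add: power2_le_iff_abs_le)
qed

lemma L2_bound:
  assumes [measurable]: "f \<in> borel_measurable borel" and g: "g \<in> L2"
    and le: "AE x in lborel. norm (f x) \<le> B * norm (g x)"
  shows "f \<in> L2"
proof -
  have "integrable lborel (\<lambda>x. (norm (f x))\<^sup>2)"
  proof (rule Bochner_Integration.integrable_bound)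
    show "integrable lborel (\<lambda>x. B\<^sup>2 * (norm (g x))\<^sup>2)" using L2_integrable_sq[OF g] by simp
    show "AE x in lborel. norm ((norm (f x))\<^sup>2) \<le> norm (B\<^sup>2 * (norm (g x))\<^sup>2)"
      using le
    proof eventually_elim
      case (elim x)
      then have "(norm (f x))\<^sup>2 \<le> (B * norm (g x))\<^sup>2" by (intro power_mono) auto
      then show ?case by (simp add: power_mult_distrib abs_mult)
    qed
  qed simp
  then show ?thesis by (simp add: L2_iff)
qed

lemma L2_bounded_mult:
  assumes "f \<in> L2" "u \<in> borel_measurable borel" "\<And>x. norm (u x) \<le> B"
  shows "(\<lambda>x. u x * f x) \<in> L2"
  by (rule L2_bound[where g=f and B=B])
     (use assms in \<open>auto simp: norm_mult intro!: mult_right_mono\<close>)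

lemma L2_cmult [intro]: "f \<in> L2 \<Longrightarrow> (\<lambda>x. c * f x) \<in> L2"
  by (rule L2_bounded_mult[where B="norm c"]) auto

lemma borel_measurable_cnj [measurable (raw)]:
  "f \<in> borel_measurable M \<Longrightarrow> (\<lambda>x. cnj (f x)) \<in> borel_measurable M"
  by (rule borel_measurable_continuous_on[where f=cnj]) (auto intro: continuous_intros)

lemma L2_cnj [intro]: "f \<in> L2 \<Longrightarrow> (\<lambda>x. cnj (f x)) \<in> L2"
  by (rule L2_bound[where g=f and B=1]) auto

lemma L2_zero [simp, intro]: "(\<lambda>x. 0) \<in> L2"
  by (simp add: L2_iff)

lemma norm_add_sq_le: "(norm (a + b))\<^sup>2 \<le> 2 * (norm a)\<^sup>2 + 2 * (norm (b::'a::real_normed_vector))\<^sup>2"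
proof -
  have "(norm (a + b))\<^sup>2 \<le> (norm a + norm b)\<^sup>2"
    by (intro power_mono norm_triangle_ineq) auto
  also have "\<dots> \<le> 2 * (norm a)\<^sup>2 + 2 * (norm b)\<^sup>2"
    using sum_squares_ge_zero[of "norm a - norm b" 0] by (simp add: power2_eq_square algebra_simps)
  finally show ?thesis .
qed

lemma L2_add [intro]:
  assumes f: "f \<in> L2" and g: "g \<in> L2" shows "(\<lambda>x. f x + g x) \<in> L2"
proof -
  have [measurable]: "f \<in> borel_measurable borel" "g \<in> borel_measurable borel"
    using f g by (auto simp: L2_iff)
  have "integrable lborel (\<lambda>x. (norm (f x + g x))\<^sup>2)"
    by (rule Bochner_Integration.integrable_bound[where f="\<lambda>x. 2 * (norm (f x))\<^sup>2 + 2 * (norm (g x))\<^sup>2"])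
       (use norm_add_sq_le L2_integrable_sq[OF f] L2_integrable_sq[OF g] in auto)
  then show ?thesis by (simp add: L2_iff)
qed

lemma L2_diff [intro]: "f \<in> L2 \<Longrightarrow> g \<in> L2 \<Longrightarrow> (\<lambda>x. f x - g x) \<in> L2"
  using L2_add[of f "\<lambda>x. -1 * g x"] L2_cmult[of g "-1"] by simp

lemma L2_sum [intro]: "(\<And>i. i \<in> A \<Longrightarrow> f i \<in> L2) \<Longrightarrow> (\<lambda>x. \<Sum>i\<in>A. f i x) \<in> L2"
  by (induction A rule: infinite_finite_induct) auto

lemma L2_integrable_mult:
  assumes f: "f \<in> L2" and g: "g \<in> L2" shows "integrable lborel (\<lambda>x. f x * g x)"
proof (rule Bochner_Integration.integrable_bound)
  show "integrable lborel (\<lambda>x. (norm (f x))\<^sup>2 + (norm (g x))\<^sup>2)"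
    using f g by (simp add: L2_integrable_sq)
  have [measurable]: "f \<in> borel_measurable borel" "g \<in> borel_measurable borel"
    using f g by (auto simp: L2_iff)
  show "(\<lambda>x. f x * g x) \<in> borel_measurable lborel" by simp
  have "norm a * norm b \<le> (norm a)\<^sup>2 + (norm b)\<^sup>2" for a b :: complex
    using sum_squares_bound[of "norm a" "norm b"]
      mult_nonneg_nonneg[OF norm_ge_zero norm_ge_zero, of a b] by linarith
  then show "AE x in lborel. norm (f x * g x) \<le> norm ((norm (f x))\<^sup>2 + (norm (g x))\<^sup>2)"
    by (simp add: norm_mult)
qed

text \<open>The discriminant criterion. The degenerate case \<open>A = 0\<close> covers functions of
  norm 0. Both the Cauchy-Schwarz inequality and the orthogonality of the nearest point in a
  subspace are drawn from it.\<close>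

lemma quadratic_nonneg_imp:
  fixes A B C :: real
  assumes A: "0 \<le> A" and nn: "\<And>t. 0 \<le> A * t\<^sup>2 - 2 * C * t + B"
  shows "C\<^sup>2 \<le> A * B"
proof (cases "A = 0")
  case True
  have "C = 0"
  proof (rule ccontr)
    assume "C \<noteq> 0"
    \<comment> \<open>At this argument the expression equals -1.\<close>
    then show False using nn[of "(B + 1) / (2 * C)"] True by simp
  qed
  then show ?thesis using True by simp
next
  case False
  have "0 \<le> A * (A * (C/A)\<^sup>2 - 2 * C * (C/A) + B)"
    by (rule mult_nonneg_nonneg[OF A nn])
  also have "\<dots> = A * B - C\<^sup>2" using False by (simp add: power2_eq_square field_simps)
  finally show ?thesis by simp
qed

text \<open>The square integral of \<open>t |f| - |g|\<close> is a nonnegative real quadratic in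
  \<open>t\<close>. With the norms inside the integral this is the form that the triangle inequality
  needs.\<close>

lemma L2_Cauchy_Schwarz_abs:
  assumes f: "f \<in> L2" and g: "g \<in> L2"
  shows "(LINT x|lborel. norm (f x) * norm (g x)) \<le> L2_norm f * L2_norm g"
proof -
  have i: "integrable lborel (\<lambda>x. norm (f x) * norm (g x))"
    using integrable_norm[OF L2_integrable_mult[OF f g]] by (simp add: norm_mult)
  define C where "C = (LINT x|lborel. norm (f x) * norm (g x))"
  have C: "0 \<le> C" unfolding C_def by (rule integral_nonneg_AE) auto
  have "C\<^sup>2 \<le> (L2_norm f)\<^sup>2 * (L2_norm g)\<^sup>2"
  proof (rule quadratic_nonneg_imp)
    fix t :: real
    have "0 \<le> (LINT x|lborel. (norm (f x) * t - norm (g x))\<^sup>2)"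
      by (rule integral_nonneg_AE) auto
    also have "\<dots> = (LINT x|lborel. (norm (f x))\<^sup>2 * t\<^sup>2 - (norm (f x) * norm (g x)) * (2 * t) + (norm (g x))\<^sup>2)"
      by (intro Bochner_Integration.integral_cong) (auto simp: power2_eq_square algebra_simps)
    also have "\<dots> = (L2_norm f)\<^sup>2 * t\<^sup>2 - C * (2 * t) + (L2_norm g)\<^sup>2"
      unfolding L2_norm_power2 C_def using i L2_integrable_sq[OF f] L2_integrable_sq[OF g]
      by simp
    finally show "0 \<le> (L2_norm f)\<^sup>2 * t\<^sup>2 - 2 * C * t + (L2_norm g)\<^sup>2" by (simp add: algebra_simps)
  qed simp
  then have "C\<^sup>2 \<le> (L2_norm f * L2_norm g)\<^sup>2" by (simp add: power_mult_distrib)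
  then show ?thesis unfolding C_def[symmetric] by (rule power2_le_imp_le) simp
qed

lemma L2_Cauchy_Schwarz:
  assumes "f \<in> L2" "g \<in> L2"
  shows "norm (LINT x|lborel. f x * g x) \<le> L2_norm f * L2_norm g"
proof -
  have "norm (LINT x|lborel. f x * g x) \<le> (LINT x|lborel. norm (f x * g x))" by simp
  also have "\<dots> \<le> L2_norm f * L2_norm g"
    using L2_Cauchy_Schwarz_abs[OF assms] by (simp add: norm_mult)
  finally show ?thesis .
qed

lemma L2_norm_triangle:
  assumes f: "f \<in> L2" and g: "g \<in> L2"
  shows "L2_norm (\<lambda>x. f x + g x) \<le> L2_norm f + L2_norm g"
proof (rule power2_le_imp_le)
  have i: "integrable lborel (\<lambda>x. norm (f x) * norm (g x))"
    using integrable_norm[OF L2_integrable_mult[OF f g]] by (simp add: norm_mult)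
  note ii = i L2_integrable_sq[OF f] L2_integrable_sq[OF g] L2_integrable_sq[OF L2_add[OF f g]]
  have "(L2_norm (\<lambda>x. f x + g x))\<^sup>2
      \<le> (LINT x|lborel. (norm (f x))\<^sup>2 + 2 * (norm (f x) * norm (g x)) + (norm (g x))\<^sup>2)"
    unfolding L2_norm_power2
  proof (rule integral_mono)
    fix x
    have "(norm (f x + g x))\<^sup>2 \<le> (norm (f x) + norm (g x))\<^sup>2"
      by (intro power_mono norm_triangle_ineq) auto
    then show "(norm (f x + g x))\<^sup>2 \<le> (norm (f x))\<^sup>2 + 2 * (norm (f x) * norm (g x)) + (norm (g x))\<^sup>2"
      by (simp add: power2_eq_square algebra_simps)
  qed (use ii in auto)
  also have "\<dots> = (L2_norm f)\<^sup>2 + 2 * (LINT x|lborel. norm (f x) * norm (g x)) + (L2_norm g)\<^sup>2"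
    unfolding L2_norm_power2 using ii by simp
  also have "\<dots> \<le> (L2_norm f + L2_norm g)\<^sup>2"
    using L2_Cauchy_Schwarz_abs[OF f g] by (simp add: power2_eq_square algebra_simps)
  finally show "(L2_norm (\<lambda>x. f x + g x))\<^sup>2 \<le> (L2_norm f + L2_norm g)\<^sup>2" .
qed simp

lemma L2_norm_cmult: "L2_norm (\<lambda>x. c * f x) = norm c * L2_norm f"
  by (simp add: L2_norm_def norm_mult power_mult_distrib real_sqrt_mult)

lemma L2_norm_cong: "(\<And>x. norm (f x) = norm (g x)) \<Longrightarrow> L2_norm f = L2_norm g"
  by (simp add: L2_norm_def)

lemma L2_norm_cong_AE:
  assumes "f \<in> borel_measurable borel" "g \<in> borel_measurable borel" "AE x in lborel. f x = g x"
  shows "L2_norm f = L2_norm g"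
  unfolding L2_norm_def
  by (intro arg_cong[where f=sqrt] integral_cong_AE) (use assms in auto)

lemma L2_norm_minus_commute: "L2_norm (\<lambda>x. f x - g x) = L2_norm (\<lambda>x. g x - f x)"
  by (rule L2_norm_cong) (rule norm_minus_commute)

lemma L2_norm_triangle_diff:
  assumes "f \<in> L2" "g \<in> L2" "h \<in> L2"
  shows "L2_norm (\<lambda>x. f x - h x) \<le> L2_norm (\<lambda>x. f x - g x) + L2_norm (\<lambda>x. g x - h x)"
  using L2_norm_triangle[OF L2_diff[OF assms(1,2)] L2_diff[OF assms(2,3)]] by simp

lemma L2_norm_eq_0:
  assumes "f \<in> L2" shows "L2_norm f = 0 \<longleftrightarrow> (AE x in lborel. f x = 0)"
  unfolding L2_norm_def
  using integral_nonneg_eq_0_iff_AE[OF L2_integrable_sq[OF assms]] by simp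

text \<open>Fatou's lemma for the squared norms. A bound on the norms replaces domination, so it
  applies where the limit is not yet known to be square integrable: in the proof of completeness and
  when a damping factor is removed.\<close>

lemma L2_fatou:
  assumes s: "\<And>n. s n \<in> L2" and f [measurable]: "f \<in> borel_measurable borel"
    and lim: "AE x in lborel. (\<lambda>n. s n x) \<longlonglongrightarrow> f x"
    and bound: "eventually (\<lambda>n. L2_norm (s n) \<le> B) sequentially" and B: "0 \<le> B"
  shows "f \<in> L2" "L2_norm f \<le> B"
proof -
  have [measurable]: "s n \<in> borel_measurable borel" for n using s by (auto simp: L2_iff)
  have "L2_norm_sq f \<le> (\<integral>\<^sup>+ x. liminf (\<lambda>n. ennreal ((norm (s n x))\<^sup>2)) \<partial>lborel)"
    unfolding L2_norm_sq_def
  proof (rule nn_integral_mono_AE)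
    show "AE x in lborel. ennreal ((norm (f x))\<^sup>2) \<le> liminf (\<lambda>n. ennreal ((norm (s n x))\<^sup>2))"
      using lim
    proof eventually_elim
      case (elim x)
      have "(\<lambda>n. ennreal ((norm (s n x))\<^sup>2)) \<longlonglongrightarrow> ennreal ((norm (f x))\<^sup>2)"
        by (intro tendsto_ennrealI tendsto_power tendsto_norm elim)
      from lim_imp_Liminf[OF trivial_limit_sequentially this] show ?case by (simp only: order.refl)
    qed
  qed
  also have "\<dots> \<le> liminf (\<lambda>n. \<integral>\<^sup>+ x. ennreal ((norm (s n x))\<^sup>2) \<partial>lborel)"
    by (rule nn_integral_liminf) simp
  also have "\<dots> = liminf (\<lambda>n. L2_norm_sq (s n))" by (simp add: L2_norm_sq_def)
  also have "\<dots> \<le> liminf (\<lambda>n. ennreal (B\<^sup>2))"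
    using bound by (intro Liminf_mono)
      (auto elim!: eventually_mono simp: L2_norm_sq_eq[OF s] intro!: power_mono)
  also have "\<dots> = ennreal (B\<^sup>2)" by (simp add: Liminf_const)
  finally have "L2_norm_sq f \<le> ennreal (B\<^sup>2)" .
  with L2_I_bound[OF f this B] show "f \<in> L2" "L2_norm f \<le> B" by auto
qed

lemma L2_dominated_convergence:
  assumes s: "\<And>n. s n \<in> borel_measurable borel" and f [measurable]: "f \<in> borel_measurable borel"
    and w: "w \<in> L2"
    and lim: "AE x in lborel. (\<lambda>n. s n x) \<longlonglongrightarrow> f x"
    and bound: "\<And>n. AE x in lborel. norm (s n x) \<le> B * norm (w x)"
  shows "f \<in> L2" "(\<lambda>n. L2_norm (\<lambda>x. s n x - f x)) \<longlonglongrightarrow> 0"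
proof -
  note s [measurable]
  have [measurable]: "w \<in> borel_measurable borel" using w by (auto simp: L2_iff)
  have all: "AE x in lborel. \<forall>n. norm (s n x) \<le> B * norm (w x)"
    using bound by (simp add: AE_all_countable)
  have fb: "AE x in lborel. norm (f x) \<le> B * norm (w x)"
    using all lim
  proof eventually_elim
    case (elim x)
    then show ?case by (intro tendsto_upperbound[OF tendsto_norm[OF elim(2)]]) auto
  qed
  show "f \<in> L2" by (rule L2_bound[OF f w fb])
  have "(\<lambda>n. LINT x|lborel. (norm (s n x - f x))\<^sup>2) \<longlonglongrightarrow> (LINT x::real|lborel. (0::real))"
  proof (rule integral_dominated_convergence[where f="\<lambda>x. 0" and s="\<lambda>n x. (norm (s n x - f x))\<^sup>2" and w="\<lambda>x. 4 * (B * norm (w x))\<^sup>2"])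
    show "integrable lborel (\<lambda>x. 4 * (B * norm (w x))\<^sup>2)"
      using L2_integrable_sq[OF w] by (simp add: power_mult_distrib)
    show "AE x in lborel. (\<lambda>n. (norm (s n x - f x))\<^sup>2) \<longlonglongrightarrow> 0"
      using lim
    proof eventually_elim
      case (elim x)
      have "(\<lambda>n. (norm (s n x - f x))\<^sup>2) \<longlonglongrightarrow> (norm (f x - f x))\<^sup>2"
        by (intro tendsto_intros elim)
      then show ?case by simp
    qed
    show "AE x in lborel. norm ((norm (s n x - f x))\<^sup>2) \<le> 4 * (B * norm (w x))\<^sup>2" for n
      using all fb
    proof eventually_elim
      case (elim x)
      have "(norm (s n x - f x))\<^sup>2 \<le> (2 * (B * norm (w x)))\<^sup>2"
        using elim norm_triangle_ineq4[of "s n x" "f x"] by (intro power_mono) (auto dest: spec[of _ n])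
      then show ?case by (simp add: power_mult_distrib)
    qed
  qed auto
  then have "(\<lambda>n. sqrt (LINT x|lborel. (norm (s n x - f x))\<^sup>2)) \<longlonglongrightarrow> sqrt 0"
    by (intro tendsto_real_sqrt) simp
  then show "(\<lambda>n. L2_norm (\<lambda>x. s n x - f x)) \<longlonglongrightarrow> 0" by (simp add: L2_norm_def)
qed

lemma L2_integral_mult_tendsto:
  assumes s: "\<And>n. s n \<in> L2" and f: "f \<in> L2" and g: "g \<in> L2"
    and lim: "((\<lambda>n. L2_norm (\<lambda>x. s n x - f x)) \<longlongrightarrow> 0) F"
  shows "((\<lambda>n. LINT x|lborel. s n x * g x) \<longlongrightarrow> (LINT x|lborel. f x * g x)) F"
proof (rule LIM_zero_cancel)
  have "((\<lambda>n. L2_norm (\<lambda>x. s n x - f x) * L2_norm g) \<longlongrightarrow> 0) F"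
    using tendsto_mult_right[OF lim, of "L2_norm g"] by simp
  then show "((\<lambda>n. (LINT x|lborel. s n x * g x) - (LINT x|lborel. f x * g x)) \<longlongrightarrow> 0) F"
  proof (rule Lim_null_comparison[rotated], intro always_eventually allI)
    fix n
    have "(LINT x|lborel. s n x * g x) - (LINT x|lborel. f x * g x) = (LINT x|lborel. (s n x - f x) * g x)"
      using L2_integrable_mult[OF s g] L2_integrable_mult[OF f g] by (simp add: algebra_simps)
    then show "norm ((LINT x|lborel. s n x * g x) - (LINT x|lborel. f x * g x))
        \<le> L2_norm (\<lambda>x. s n x - f x) * L2_norm g"
      using L2_Cauchy_Schwarz[OF L2_diff[OF s f] g] by simp
  qed
qed

section \<open>Completeness and orthogonal projections\<close>

text \<open>The Riesz-Fischer argument: a subsequence with increments of norm at most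
  \<open>(1/2)^k\<close> converges almost everywhere, and Fatou's lemma shows that its pointwise
  limit is the limit in norm of the whole sequence.\<close>

lemma L2_complete:
  assumes f: "\<And>n. f n \<in> L2"
    and Cauchy: "\<And>e. e > 0 \<Longrightarrow> \<exists>N. \<forall>m\<ge>N. \<forall>n\<ge>N. L2_norm (\<lambda>x. f m x - f n x) \<le> e"
  obtains g where "g \<in> L2" "(\<lambda>n. L2_norm (\<lambda>x. f n x - g x)) \<longlonglongrightarrow> 0"
proof -
  have fm [measurable]: "f n \<in> borel_measurable borel" for n using f by (auto simp: L2_iff)
  have "\<exists>N. \<forall>m\<ge>N. \<forall>n\<ge>N. L2_norm (\<lambda>x. f m x - f n x) \<le> (1/2)^k" for k
    by (rule Cauchy) simp
  then obtain N where N: "\<And>k m n. N k \<le> m \<Longrightarrow> N k \<le> n \<Longrightarrow> L2_norm (\<lambda>x. f m x - f n x) \<le> (1/2)^k"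
    by metis
  \<comment> \<open>Adding \<open>k\<close> and all \<open>N i\<close> up to \<open>k\<close> makes
    \<open>r\<close> nondecreasing and at least both \<open>N k\<close> and
    \<open>k\<close>.\<close>
  define r where "r k = k + (\<Sum>i\<le>k. N i)" for k
  have rN: "N k \<le> r k" for k
    unfolding r_def using member_le_sum[of k "{..k}" N] by simp
  have rS: "r k \<le> r (Suc k)" for k by (simp add: r_def)
  have rk: "k \<le> r k" for k by (simp add: r_def)
  define d where "d k x = f (r (Suc k)) x - f (r k) x" for k x
  have d: "d k \<in> L2" for k unfolding d_def using f by auto
  have dm [measurable]: "d k \<in> borel_measurable borel" for k using d by (auto simp: L2_iff)
  have dn: "L2_norm (d k) \<le> (1/2)^k" for k
    unfolding d_def using rN[of k] rS[of k] by (intro N) auto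
  \<comment> \<open>The weights \<open>2^k\<close> give pointwise geometric decay of \<open>d k x\<close> from a sum of squares.\<close>
  have "(\<integral>\<^sup>+x. (\<Sum>k. ennreal (2^k * (norm (d k x))\<^sup>2)) \<partial>lborel)
      = (\<Sum>k. \<integral>\<^sup>+x. ennreal (2^k * (norm (d k x))\<^sup>2) \<partial>lborel)"
    by (rule nn_integral_suminf) simp
  also have "\<dots> \<le> (\<Sum>k. ennreal ((1/2)^k))"
  proof (rule suminf_le)
    fix k
    have "(\<integral>\<^sup>+x. ennreal (2^k * (norm (d k x))\<^sup>2) \<partial>lborel) = ennreal (2^k) * L2_norm_sq (d k)"
      unfolding L2_norm_sq_def by (subst nn_integral_cmult[symmetric]) (auto simp: ennreal_mult)
    also have "\<dots> = ennreal (2^k * (L2_norm (d k))\<^sup>2)"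
      by (simp add: L2_norm_sq_eq[OF d] ennreal_mult)
    also have "\<dots> \<le> ennreal (2^k * ((1/2)^k)\<^sup>2)"
      by (intro ennreal_leI mult_left_mono power_mono dn) auto
    also have "2^k * ((1/2)^k)\<^sup>2 = (1/2::real)^k"
      by (simp add: power2_eq_square power_one_over)
    finally show "(\<integral>\<^sup>+x. ennreal (2^k * (norm (d k x))\<^sup>2) \<partial>lborel) \<le> ennreal ((1/2)^k)" .
  qed auto
  also have "\<dots> < \<infinity>"
    by (subst suminf_ennreal2) (auto simp: summable_geometric)
  finally have "(\<integral>\<^sup>+x. (\<Sum>k. ennreal (2^k * (norm (d k x))\<^sup>2)) \<partial>lborel) \<noteq> \<infinity>" by simp
  then have "AE x in lborel. (\<Sum>k. ennreal (2^k * (norm (d k x))\<^sup>2)) \<noteq> \<infinity>"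
    by (intro nn_integral_PInf_AE) auto
  then have conv: "AE x in lborel. convergent (\<lambda>k. f (r k) x)"
  proof eventually_elim
    case (elim x)
    have "summable (\<lambda>k. 2^k * (norm (d k x))\<^sup>2)"
      by (rule summable_suminf_not_top) (use elim in auto)
    then have "(\<lambda>k. 2^k * (norm (d k x))\<^sup>2) \<longlonglongrightarrow> 0" by (rule summable_LIMSEQ_zero)
    then have "Bseq (\<lambda>k. 2^k * (norm (d k x))\<^sup>2)" by (intro convergent_imp_Bseq convergentI)
    then obtain C where C: "C > 0" "\<And>k. norm (2^k * (norm (d k x))\<^sup>2) \<le> C" by (auto elim!: BseqE)
    have "norm (d k x) \<le> sqrt C * (1 / sqrt 2)^k" for k
    proof -
      have "(norm (d k x))\<^sup>2 \<le> C * (1/2)^k" using C(2)[of k] by (simp add: field_simps power_one_over)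
      then have "norm (d k x) \<le> sqrt (C * (1/2)^k)" by (simp add: real_le_rsqrt)
      also have "\<dots> = sqrt C * (1 / sqrt 2)^k" by (simp add: real_sqrt_mult real_sqrt_power real_sqrt_divide)
      finally show ?thesis .
    qed
    moreover have "summable (\<lambda>k. sqrt C * (1 / sqrt 2)^k)" by (intro summable_mult summable_geometric) simp
    ultimately have "summable (\<lambda>k. d k x)"
      by (intro summable_comparison_test'[where N=0 and f="\<lambda>k. d k x" and g="\<lambda>k. sqrt C * (1 / sqrt 2)^k"])
    then have "convergent (\<lambda>n. \<Sum>k<n. d k x)" by (simp add: summable_iff_convergent)
    then have "convergent (\<lambda>n. f (r 0) x + (\<Sum>k<n. d k x))"
      by (intro convergent_add convergent_const)
    also have "(\<lambda>n. f (r 0) x + (\<Sum>k<n. d k x)) = (\<lambda>k. f (r k) x)"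
      by (simp add: d_def sum_lessThan_telescope[of "\<lambda>k. f (r k) x"])
    finally show ?case .
  qed
  define g where "g x = lim (\<lambda>k. f (r k) x)" for x
  have g [measurable]: "g \<in> borel_measurable borel" unfolding g_def by simp
  have lim: "AE x in lborel. (\<lambda>k. f (r k) x) \<longlonglongrightarrow> g x"
    using conv by eventually_elim (simp add: g_def convergent_LIMSEQ_iff)
  \<comment> \<open>With \<open>m\<close> fixed, Fatou's lemma along \<open>r\<close> carries the
    Cauchy estimate over to the limit. It controls \<open>g - f m\<close>; membership of
    \<open>g\<close> follows by adding \<open>f (N 0)\<close> back.\<close>
  have close: "(\<lambda>x. g x - f m x) \<in> L2 \<and> L2_norm (\<lambda>x. g x - f m x) \<le> (1/2)^k" if "N k \<le> m" for k m
  proof -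
    have 1: "\<And>n. (\<lambda>x. f (r n) x - f m x) \<in> L2" using f by auto
    have 2: "(\<lambda>x. g x - f m x) \<in> borel_measurable borel" by simp
    have 3: "AE x in lborel. (\<lambda>n. f (r n) x - f m x) \<longlonglongrightarrow> g x - f m x"
      using lim by eventually_elim (auto intro: tendsto_intros)
    have 4: "eventually (\<lambda>n. L2_norm (\<lambda>x. f (r n) x - f m x) \<le> (1/2)^k) sequentially"
      using eventually_ge_at_top[of "N k"]
      by eventually_elim (rule N[OF order_trans[OF _ rk] that])
    from L2_fatou[OF 1 2 3 4] show ?thesis by simp
  qed
  have "(\<lambda>x. (g x - f (N 0) x) + f (N 0) x) \<in> L2" using close[of 0 "N 0"] f by (intro L2_add) auto
  then have gL2: "g \<in> L2" by simp
  moreover have "(\<lambda>n. L2_norm (\<lambda>x. f n x - g x)) \<longlonglongrightarrow> 0"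
  proof (rule LIMSEQ_I)
    fix e :: real assume "0 < e"
    then obtain k where k: "(1/2)^k < e" using real_arch_pow_inv[of e "1/2"] by auto
    show "\<exists>M. \<forall>n\<ge>M. norm (L2_norm (\<lambda>x. f n x - g x) - 0) < e"
    proof (intro exI allI impI)
      fix n assume "N k \<le> n"
      then have "L2_norm (\<lambda>x. g x - f n x) \<le> (1/2)^k" using close by auto
      then show "norm (L2_norm (\<lambda>x. f n x - g x) - 0) < e"
        using k L2_norm_minus_commute[of "f n" g] by simp
    qed
  qed
  ultimately show ?thesis by (rule that)
qed

section \<open>Orthogonal projections onto closed subspaces\<close>

definition L2_subspace :: "(real \<Rightarrow> complex) set \<Rightarrow> bool" where
  "L2_subspace K \<longleftrightarrow> K \<subseteq> L2 \<and> (\<lambda>x. 0) \<in> K \<and> (\<forall>f\<in>K. \<forall>g\<in>K. (\<lambda>x. f x + g x) \<in> K) \<and>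
     (\<forall>c. \<forall>f\<in>K. (\<lambda>x. c * f x) \<in> K)"

text \<open>Constant sequences show that a set closed in this sense is also invariant, within
  \<open>L2\<close>, under equality almost everywhere.\<close>

definition L2_closed :: "(real \<Rightarrow> complex) set \<Rightarrow> bool" where
  "L2_closed K \<longleftrightarrow> (\<forall>s f. (\<forall>n. s n \<in> K) \<longrightarrow> f \<in> L2 \<longrightarrow>
     (\<lambda>n. L2_norm (\<lambda>x. s n x - f x)) \<longlonglongrightarrow> 0 \<longrightarrow> f \<in> K)"

text \<open>Projections are determined only almost everywhere. Explicit candidates are therefore
  tested with this relation and compared with the arbitrary choice made by \<open>orth_proj\<close>
  up to null sets.\<close>

definition is_orth_proj ::
    "(real \<Rightarrow> complex) set \<Rightarrow> (real \<Rightarrow> complex) \<Rightarrow> (real \<Rightarrow> complex) \<Rightarrow> bool" where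
  "is_orth_proj K f g \<longleftrightarrow> g \<in> K \<and> (\<forall>h\<in>K. L2_inner (\<lambda>x. f x - g x) h = 0)"

lemma L2_subspaceD:
  assumes "L2_subspace K"
  shows "f \<in> K \<Longrightarrow> f \<in> L2" "(\<lambda>x. 0) \<in> K" "f \<in> K \<Longrightarrow> g \<in> K \<Longrightarrow> (\<lambda>x. f x + g x) \<in> K"
    "f \<in> K \<Longrightarrow> (\<lambda>x. c * f x) \<in> K" "f \<in> K \<Longrightarrow> g \<in> K \<Longrightarrow> (\<lambda>x. f x - g x) \<in> K"
proof -
  show *: "f \<in> K \<Longrightarrow> f \<in> L2" "(\<lambda>x. 0) \<in> K" "f \<in> K \<Longrightarrow> g \<in> K \<Longrightarrow> (\<lambda>x. f x + g x) \<in> K"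
    "f \<in> K \<Longrightarrow> (\<lambda>x. c * f x) \<in> K" for f g c
    using assms by (auto simp: L2_subspace_def)
  show "f \<in> K \<Longrightarrow> g \<in> K \<Longrightarrow> (\<lambda>x. f x - g x) \<in> K"
    using *(3)[of f "\<lambda>x. -1 * g x"] *(4)[of g "-1"] by simp
qed

lemma L2_inner_add:
  assumes "f \<in> L2" "g \<in> L2" "h \<in> L2"
  shows "L2_inner (\<lambda>x. f x + g x) h = L2_inner f h + L2_inner g h"
  unfolding L2_inner_def
  using L2_integrable_mult[OF assms(1) L2_cnj[OF assms(3)]] L2_integrable_mult[OF assms(2) L2_cnj[OF assms(3)]]
  by (simp add: algebra_simps)

lemma L2_inner_diff:
  assumes "f \<in> L2" "g \<in> L2" "h \<in> L2"
  shows "L2_inner (\<lambda>x. f x - g x) h = L2_inner f h - L2_inner g h"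
  unfolding L2_inner_def
  using L2_integrable_mult[OF assms(1) L2_cnj[OF assms(3)]] L2_integrable_mult[OF assms(2) L2_cnj[OF assms(3)]]
  by (simp add: algebra_simps)

lemma L2_inner_cmult: "L2_inner (\<lambda>x. c * f x) h = c * L2_inner f h"
  by (simp add: L2_inner_def mult.assoc)

lemma L2_inner_cmult_right: "L2_inner f (\<lambda>x. c * h x) = cnj c * L2_inner f h"
  by (simp add: L2_inner_def mult.left_commute)

lemma L2_inner_commute: "L2_inner g f = cnj (L2_inner f g)"
  unfolding L2_inner_def by (subst Bochner_Integration.integral_cnj[symmetric]) (simp add: mult.commute)

lemma L2_inner_self: "f \<in> L2 \<Longrightarrow> L2_inner f f = of_real ((L2_norm f)\<^sup>2)"
  unfolding L2_inner_def L2_norm_power2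
  by (subst integral_complex_of_real[symmetric]) (simp only: complex_norm_square)

lemma L2_norm_diff_sq:
  assumes f: "f \<in> L2" and g: "g \<in> L2"
  shows "(L2_norm (\<lambda>x. f x - g x))\<^sup>2 = (L2_norm f)\<^sup>2 - 2 * Re (L2_inner f g) + (L2_norm g)\<^sup>2"
proof -
  have "complex_of_real ((L2_norm (\<lambda>x. f x - g x))\<^sup>2) = L2_inner (\<lambda>x. f x - g x) (\<lambda>x. f x - g x)"
    by (rule L2_inner_self[symmetric]) (use f g in auto)
  also have "\<dots> = L2_inner f (\<lambda>x. f x - g x) - L2_inner g (\<lambda>x. f x - g x)"
    using f g by (intro L2_inner_diff) auto
  also have "\<dots> = cnj (L2_inner (\<lambda>x. f x - g x) f) - cnj (L2_inner (\<lambda>x. f x - g x) g)"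
    by (simp only: L2_inner_commute[of _ "\<lambda>x. f x - g x"])
  also have "\<dots> = cnj (L2_inner f f - L2_inner g f) - cnj (L2_inner f g - L2_inner g g)"
    by (simp add: L2_inner_diff f g)
  also have "\<dots> = of_real ((L2_norm f)\<^sup>2) - cnj (L2_inner g f) - (cnj (L2_inner f g) - of_real ((L2_norm g)\<^sup>2))"
    by (simp add: L2_inner_self f g)
  also have "cnj (L2_inner g f) = L2_inner f g" by (simp add: L2_inner_commute[of g f])
  finally have "Re (complex_of_real ((L2_norm (\<lambda>x. f x - g x))\<^sup>2))
    = Re (of_real ((L2_norm f)\<^sup>2) - L2_inner f g - (cnj (L2_inner f g) - of_real ((L2_norm g)\<^sup>2)))"
    by (simp only:)
  then show ?thesis by simp
qed

lemma L2_parallelogram: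
  assumes f: "f \<in> L2" and g: "g \<in> L2"
  shows "(L2_norm (\<lambda>x. f x - g x))\<^sup>2 + (L2_norm (\<lambda>x. f x + g x))\<^sup>2 = 2 * (L2_norm f)\<^sup>2 + 2 * (L2_norm g)\<^sup>2"
proof -
  have "(\<lambda>x. - g x) \<in> L2" using L2_cmult[OF g, of "-1"] by simp
  moreover have "L2_inner f (\<lambda>x. - g x) = - L2_inner f g" by (simp add: L2_inner_def)
  moreover have "L2_norm (\<lambda>x. - g x) = L2_norm g" by (rule L2_norm_cong) simp
  ultimately show ?thesis
    using L2_norm_diff_sq[OF f g] L2_norm_diff_sq[OF f, of "\<lambda>x. - g x"] by simp
qed

text \<open>A sequence in \<open>K\<close> that minimizes the distance to \<open>f\<close> is Cauchy
  by the parallelogram law; its limit is a nearest point, and a nearest point has an orthogonal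
  residual.\<close>

lemma is_orth_proj_exists:
  assumes K: "L2_subspace K" and cl: "L2_closed K" and f: "f \<in> L2"
  obtains g where "is_orth_proj K f g"
proof -
  define D where "D = (\<lambda>g. (L2_norm (\<lambda>x. f x - g x))\<^sup>2) ` K"
  define \<delta> where "\<delta> = Inf D"
  have ne: "D \<noteq> {}" using L2_subspaceD(2)[OF K] by (auto simp: D_def)
  have bb: "bdd_below D" by (rule bdd_belowI[where m=0]) (auto simp: D_def)
  have low: "\<delta> \<le> (L2_norm (\<lambda>x. f x - g x))\<^sup>2" if "g \<in> K" for g
    unfolding \<delta>_def by (rule cInf_lower[OF _ bb]) (use that in \<open>auto simp: D_def\<close>)
  have "\<exists>g\<in>K. (L2_norm (\<lambda>x. f x - g x))\<^sup>2 < \<delta> + inverse (Suc n)" for n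
  proof -
    have "\<exists>d\<in>D. d < \<delta> + inverse (Suc n)"
      unfolding \<delta>_def by (rule cInf_lessD[OF ne]) simp
    then show ?thesis by (auto simp: D_def)
  qed
  then obtain s where s: "\<And>n. s n \<in> K" "\<And>n. (L2_norm (\<lambda>x. f x - s n x))\<^sup>2 < \<delta> + inverse (Suc n)"
    by metis
  have sL: "s n \<in> L2" for n using s(1) L2_subspaceD(1)[OF K] by blast
  \<comment> \<open>The midpoint of \<open>s m\<close> and \<open>s n\<close> lies in
    \<open>K\<close>, so its squared distance from \<open>f\<close> is at least \<delta>. The
    parallelogram law leaves at most 4 (\<delta> + 1/(N+1)) - 4 \<delta>.\<close>
  have diff: "(L2_norm (\<lambda>x. s m x - s n x))\<^sup>2 \<le> 4 * inverse (Suc N)" if "N \<le> m" "N \<le> n" for m n N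
  proof -
    have K2: "(\<lambda>x. (1/2) * (s m x + s n x)) \<in> K"
      by (intro L2_subspaceD(3,4)[OF K] s)
    define M where "M = L2_norm (\<lambda>x. f x - (1/2) * (s m x + s n x))"
    have "(L2_norm (\<lambda>x. (f x - s n x) - (f x - s m x)))\<^sup>2 + (L2_norm (\<lambda>x. (f x - s n x) + (f x - s m x)))\<^sup>2
        = 2 * (L2_norm (\<lambda>x. f x - s n x))\<^sup>2 + 2 * (L2_norm (\<lambda>x. f x - s m x))\<^sup>2"
      using f sL by (intro L2_parallelogram) auto
    moreover have "L2_norm (\<lambda>x. (f x - s n x) - (f x - s m x)) = L2_norm (\<lambda>x. s m x - s n x)"
      by (rule L2_norm_cong) simp
    moreover have "L2_norm (\<lambda>x. (f x - s n x) + (f x - s m x))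
        = L2_norm (\<lambda>x. 2 * (f x - (1/2) * (s m x + s n x)))"
      by (rule L2_norm_cong) (simp add: algebra_simps)
    moreover have "\<dots> = 2 * M"
      unfolding M_def by (simp only: L2_norm_cmult) simp
    ultimately have "(L2_norm (\<lambda>x. s m x - s n x))\<^sup>2 + 4 * M\<^sup>2
        = 2 * (L2_norm (\<lambda>x. f x - s n x))\<^sup>2 + 2 * (L2_norm (\<lambda>x. f x - s m x))\<^sup>2"
      by (simp add: power_mult_distrib)
    moreover have "inverse (real (Suc n)) \<le> inverse (real (Suc N))" "inverse (real (Suc m)) \<le> inverse (real (Suc N))"
      using that by (auto intro!: le_imp_inverse_le)
    moreover have "\<delta> \<le> M\<^sup>2" using low[OF K2] by (simp only: M_def)
    ultimately show ?thesis using s(2)[of n] s(2)[of m] by linarith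
  qed
  have "\<exists>N. \<forall>m\<ge>N. \<forall>n\<ge>N. L2_norm (\<lambda>x. s m x - s n x) \<le> e" if "e > 0" for e
  proof -
    obtain N where "inverse (Suc N) < e\<^sup>2 / 4"
      using reals_Archimedean[of "e\<^sup>2 / 4"] \<open>e > 0\<close> by auto
    then have *: "4 * inverse (real (Suc N)) \<le> e\<^sup>2" by linarith
    have "L2_norm (\<lambda>x. s m x - s n x) \<le> e" if "N \<le> m" "N \<le> n" for m n
      by (rule power2_le_imp_le[OF order_trans[OF diff[OF that] *]]) (use \<open>e > 0\<close> in simp)
    then show ?thesis by blast
  qed
  from L2_complete[OF sL this] obtain g where
    g: "g \<in> L2" and lim: "(\<lambda>n. L2_norm (\<lambda>x. s n x - g x)) \<longlonglongrightarrow> 0" by blast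
  have gK: "g \<in> K" using cl s(1) g lim unfolding L2_closed_def by blast
  have min: "L2_norm (\<lambda>x. f x - g x) \<le> sqrt \<delta>"
  proof (rule LIMSEQ_le_const)
    have "(\<lambda>n. sqrt (\<delta> + inverse (Suc n)) + L2_norm (\<lambda>x. s n x - g x)) \<longlonglongrightarrow> sqrt (\<delta> + 0) + 0"
      by (intro tendsto_intros lim LIMSEQ_inverse_real_of_nat)
    then show "(\<lambda>n. sqrt (\<delta> + inverse (Suc n)) + L2_norm (\<lambda>x. s n x - g x)) \<longlonglongrightarrow> sqrt \<delta>" by simp
    have "L2_norm (\<lambda>x. f x - g x) \<le> sqrt (\<delta> + inverse (Suc n)) + L2_norm (\<lambda>x. s n x - g x)" for n
      using L2_norm_triangle_diff[OF f sL[of n] g] real_le_rsqrt[OF less_imp_le[OF s(2)[of n]]] by linarith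
    then show "\<exists>N. \<forall>n\<ge>N. L2_norm (\<lambda>x. f x - g x) \<le> sqrt (\<delta> + inverse (Suc n)) + L2_norm (\<lambda>x. s n x - g x)"
      by blast
  qed
  have \<delta>0: "0 \<le> \<delta>" unfolding \<delta>_def using ne by (intro cInf_greatest) (auto simp: D_def)
  have min2: "(L2_norm (\<lambda>x. f x - g x))\<^sup>2 \<le> \<delta>"
    using power_mono[OF min, of 2] \<delta>0 by simp
  have "L2_inner (\<lambda>x. f x - g x) h = 0" if h: "h \<in> K" for h
  proof -
    have hL: "h \<in> L2" using h L2_subspaceD(1)[OF K] by blast
    define c where "c = L2_inner (\<lambda>x. f x - g x) h"
    \<comment> \<open>The minimizer \<open>g\<close> is perturbed by \<open>t c h\<close>; the
      factor \<open>c\<close> makes the cross term the real number \<open>t |c|^2\<close>.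
      Minimality yields a nonnegative quadratic in \<open>t\<close> without constant term, so the
      discriminant bound forces \<open>c = 0\<close>.\<close>
    have "((norm c)\<^sup>2)\<^sup>2 \<le> (L2_norm (\<lambda>x. c * h x))\<^sup>2 * 0"
    proof (rule quadratic_nonneg_imp)
      fix t :: real
      have "(\<lambda>x. g x + (of_real t * c) * h x) \<in> K"
        by (intro L2_subspaceD(3,4)[OF K] gK h)
      from order_trans[OF min2 low[OF this]]
      have "(L2_norm (\<lambda>x. f x - g x))\<^sup>2 \<le> (L2_norm (\<lambda>x. (f x - g x) - (of_real t * c) * h x))\<^sup>2"
        by (simp only: diff_diff_add)
      also have "\<dots> = (L2_norm (\<lambda>x. f x - g x))\<^sup>2 - 2 * Re (L2_inner (\<lambda>x. f x - g x) (\<lambda>x. (of_real t * c) * h x))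
          + (L2_norm (\<lambda>x. (of_real t * c) * h x))\<^sup>2"
        using f g hL by (intro L2_norm_diff_sq) auto
      also have "L2_inner (\<lambda>x. f x - g x) (\<lambda>x. (of_real t * c) * h x) = of_real (t * (norm c)\<^sup>2)"
      proof -
        have "L2_inner (\<lambda>x. f x - g x) (\<lambda>x. (of_real t * c) * h x) = cnj (of_real t * c) * c"
          unfolding c_def by (rule L2_inner_cmult_right)
        then show ?thesis using complex_norm_square[of c] by (simp add: mult.commute)
      qed
      also have "L2_norm (\<lambda>x. (of_real t * c) * h x) = \<bar>t\<bar> * L2_norm (\<lambda>x. c * h x)"
        by (simp only: L2_norm_cmult norm_mult norm_of_real mult.assoc)
      finally show "0 \<le> (L2_norm (\<lambda>x. c * h x))\<^sup>2 * t\<^sup>2 - 2 * (norm c)\<^sup>2 * t + 0"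
        by (simp add: power_mult_distrib algebra_simps)
    qed simp
    then show ?thesis by (simp add: c_def)
  qed
  then show ?thesis using gK by (intro that[of g]) (simp add: is_orth_proj_def)
qed

lemma is_orth_proj_L2:
  assumes "L2_subspace K" "is_orth_proj K f g" shows "g \<in> L2"
  using assms by (auto simp: is_orth_proj_def L2_subspace_def)

lemma is_orth_proj_unique:
  assumes K: "L2_subspace K" and f: "f \<in> L2" and g: "is_orth_proj K f g" and h: "is_orth_proj K f h"
  shows "AE x in lborel. g x = h x"
proof -
  have L: "g \<in> L2" "h \<in> L2" using is_orth_proj_L2[OF K] g h by auto
  have d: "(\<lambda>x. g x - h x) \<in> K" by (rule L2_subspaceD(5)[OF K]) (use g h in \<open>auto simp: is_orth_proj_def\<close>)
  have dL: "(\<lambda>x. g x - h x) \<in> L2" using L by auto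
  have "L2_inner (\<lambda>x. (f x - h x) - (f x - g x)) (\<lambda>x. g x - h x) = 0"
    using g h d L f by (subst L2_inner_diff) (auto simp: is_orth_proj_def)
  then have "L2_inner (\<lambda>x. g x - h x) (\<lambda>x. g x - h x) = 0" by simp
  then have "L2_norm (\<lambda>x. g x - h x) = 0" using L2_inner_self[OF dL] by simp
  then show ?thesis using L2_norm_eq_0[OF dL] by simp
qed

lemma is_orth_proj_norm_le:
  assumes K: "L2_subspace K" and f: "f \<in> L2" and g: "is_orth_proj K f g"
  shows "L2_norm g \<le> L2_norm f" "L2_norm (\<lambda>x. f x - g x) \<le> L2_norm f"
proof -
  have L: "g \<in> L2" using is_orth_proj_L2[OF K g] .
  have d: "L2_inner (\<lambda>x. f x - g x) g = 0" using g by (auto simp: is_orth_proj_def)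
  have m: "(\<lambda>x. - g x) \<in> L2" using L2_cmult[OF L, of "-1"] by simp
  have "L2_inner (\<lambda>x. f x - g x) (\<lambda>x. - g x) = 0" using d by (simp add: L2_inner_def)
  then have "(L2_norm f)\<^sup>2 = (L2_norm (\<lambda>x. f x - g x))\<^sup>2 + (L2_norm (\<lambda>x. - g x))\<^sup>2"
    using L2_norm_diff_sq[OF L2_diff[OF f L] m] by simp
  moreover have "L2_norm (\<lambda>x. - g x) = L2_norm g" by (rule L2_norm_cong) simp
  ultimately have "(L2_norm f)\<^sup>2 = (L2_norm (\<lambda>x. f x - g x))\<^sup>2 + (L2_norm g)\<^sup>2" by simp
  then have "(L2_norm g)\<^sup>2 \<le> (L2_norm f)\<^sup>2" "(L2_norm (\<lambda>x. f x - g x))\<^sup>2 \<le> (L2_norm f)\<^sup>2"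
    by simp_all
  then show "L2_norm g \<le> L2_norm f" "L2_norm (\<lambda>x. f x - g x) \<le> L2_norm f"
    by (simp_all only: power2_le_imp_le L2_norm_nonneg)
qed

lemma is_orth_proj_add:
  assumes K: "L2_subspace K" and f: "f \<in> L2" "f' \<in> L2" and g: "is_orth_proj K f g" "is_orth_proj K f' g'"
  shows "is_orth_proj K (\<lambda>x. f x + f' x) (\<lambda>x. g x + g' x)"
proof -
  have L: "g \<in> L2" "g' \<in> L2" using is_orth_proj_L2[OF K] g by auto
  have "L2_inner (\<lambda>x. (f x - g x) + (f' x - g' x)) h = 0" if "h \<in> K" for h
    using that L f g L2_subspaceD(1)[OF K that] by (subst L2_inner_add) (auto simp: is_orth_proj_def)
  then show ?thesis using g L2_subspaceD(3)[OF K] by (auto simp: is_orth_proj_def algebra_simps)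
qed

lemma is_orth_proj_cmult:
  assumes K: "L2_subspace K" and g: "is_orth_proj K f g"
  shows "is_orth_proj K (\<lambda>x. c * f x) (\<lambda>x. c * g x)"
proof -
  have "L2_inner (\<lambda>x. c * (f x - g x)) h = 0" if "h \<in> K" for h
    using that g by (subst L2_inner_cmult) (auto simp: is_orth_proj_def)
  then show ?thesis using g L2_subspaceD(4)[OF K] by (auto simp: is_orth_proj_def algebra_simps)
qed

lemma is_orth_proj_orth_proj: "is_orth_proj K f g \<Longrightarrow> is_orth_proj K f (orth_proj K f)"
proof -
  have "orth_proj K f = (SOME g. is_orth_proj K f g)" by (simp only: orth_proj_def is_orth_proj_def)
  then show "is_orth_proj K f g \<Longrightarrow> is_orth_proj K f (orth_proj K f)" by (metis someI)
qed

section \<open>Density of step functions\<close>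

text \<open>Density of step functions as an induction rule. Since the intervals stay inside
  \<open>U\<close>, the base case may use estimates that hold only on compact subsets of
  \<open>U\<close>, such as a lower bound for |\<psi>'|. With \<open>U = UNIV\<close> the rule gives
  the continuity of translation.\<close>

lemma L2_on_induct [consumes 3, case_names interval add cmult lim]:
  fixes P :: "(real \<Rightarrow> complex) \<Rightarrow> bool"
  assumes U: "open U" and f: "f \<in> L2" "AE x in lborel. x \<notin> U \<longrightarrow> f x = 0"
    and interval: "\<And>a b. {a..b} \<subseteq> U \<Longrightarrow> P (indicator {a..b})"
    and add: "\<And>f g. f \<in> L2 \<Longrightarrow> P f \<Longrightarrow> g \<in> L2 \<Longrightarrow> P g \<Longrightarrow> P (\<lambda>x. f x + g x)"
    and cmult: "\<And>f c. f \<in> L2 \<Longrightarrow> P f \<Longrightarrow> P (\<lambda>x. c * f x)"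
    and lim: "\<And>s f. (\<And>n. s n \<in> L2) \<Longrightarrow> (\<And>n. P (s n)) \<Longrightarrow> f \<in> L2 \<Longrightarrow>
      (\<lambda>n. L2_norm (\<lambda>x. s n x - f x)) \<longlonglongrightarrow> 0 \<Longrightarrow> P f"
  shows "P f"
proof -
  have zero: "P (\<lambda>x. 0)" 
  proof -
    \<comment> \<open>The empty interval is an admissible base case, and its indicator is the zero
      function.\<close>
    have "indicator {1..0::real} = (\<lambda>x. 0::complex)" by auto
    then show ?thesis using interval[of 1 0] by simp
  qed
  have sum: "P (\<lambda>x. \<Sum>i\<in>A. g i x)" if "finite A" "\<And>i. i \<in> A \<Longrightarrow> g i \<in> L2 \<and> P (g i)"
    for g :: "complex \<Rightarrow> _" and A
    using that by (induction A) (auto intro!: zero add L2_sum)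
  have ind_L2: "(indicator (A \<inter> {c..d}) :: real \<Rightarrow> complex) \<in> L2" if [measurable]: "A \<in> sets borel" for A and c d :: real
  proof -
    have "(\<lambda>x. (norm (indicator (A \<inter> {c..d}) x :: complex))\<^sup>2) = (indicator (A \<inter> {c..d}) :: real \<Rightarrow> real)"
      by (auto simp: indicator_def fun_eq_iff)
    moreover have "emeasure lborel (A \<inter> {c..d}) \<le> emeasure lborel {c..d}" by (rule emeasure_mono) auto
    then have "emeasure lborel (A \<inter> {c..d}) < \<infinity>" using le_less_trans emeasure_lborel_cbox_finite[of c d] by (fastforce simp: cbox_interval)
    ultimately show ?thesis by (simp add: L2_iff)
  qed
  \<comment> \<open>Dynkin's argument on the half-lines \<open>{..a}\<close>, which generate the
    Borel sets and are stable under intersection. Cutting with \<open>{c..d}\<close> keeps every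
    indicator in \<open>L2\<close>, also for complements and countable unions.\<close>
  have step1: "P (indicator (A \<inter> {c..d}))" if cd: "{c..d} \<subseteq> U" and A: "A \<in> sets borel" for A c d
  proof -
    have stable: "Int_stable (range (\<lambda>a::real. {..a}))" by (auto simp: Int_stable_def)
    have sub: "range (\<lambda>a::real. {..a}) \<subseteq> Pow UNIV" by simp
    have "A \<in> sigma_sets UNIV (range (\<lambda>a::real. {..a}))" using A by (simp add: borel_eq_atMost)
    then show ?thesis
    proof (induction A rule: sigma_sets_induct_disjoint[OF stable sub, consumes 1, case_names basic empty compl union])
      case (basic A)
      then obtain a where "A = {..a}" by auto
      then have "A \<inter> {c..d} = {c..min a d}" by auto
      then show ?case using cd interval[of c "min a d"] by auto
    next
      case empty
      then show ?case using zero by simp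
    next
      case (compl A)
      have A [measurable]: "A \<in> sets borel" using compl(1) by (simp add: borel_eq_atMost)
      have "(\<lambda>x. indicator {c..d} x + -1 * indicator (A \<inter> {c..d}) x) = (indicator ((UNIV - A) \<inter> {c..d}) :: real \<Rightarrow> complex)"
        by (auto simp: indicator_def fun_eq_iff)
      moreover have "P (\<lambda>x. indicator {c..d} x + -1 * indicator (A \<inter> {c..d}) x)"
        using ind_L2[of UNIV c d] ind_L2[OF A, of c d] compl(2) cd
        by (intro add cmult interval L2_cmult) auto
      ultimately show ?case by simp
    next
      case (union A)
      have A [measurable]: "A i \<in> sets borel" for i using union(2) by (auto simp: borel_eq_atMost)
      have fin: "P (indicator ((\<Union>i<n. A i) \<inter> {c..d}))" for n
      proof (induction n)
        case 0
        then show ?case using zero by simp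
      next
        case (Suc n)
        have "x \<notin> A n" if "x \<in> A i" "i < n" for x i
          using union(1) that unfolding disjoint_family_on_def by (metis UNIV_I disjoint_iff less_irrefl)
        then have "(indicator ((\<Union>i<Suc n. A i) \<inter> {c..d}) :: real \<Rightarrow> complex)
            = (\<lambda>x. indicator ((\<Union>i<n. A i) \<inter> {c..d}) x + indicator (A n \<inter> {c..d}) x)"
          by (fastforce simp: indicator_def fun_eq_iff lessThan_Suc)
        then show ?case using Suc union(3)[of n] by (auto intro!: add ind_L2)
      qed
      have "AE x in lborel. (\<lambda>n. indicator ((\<Union>i<n. A i) \<inter> {c..d}) x) \<longlonglongrightarrow> (indicator ((\<Union>i. A i) \<inter> {c..d}) x :: complex)"
        unfolding indicator_inter_arith by (intro AE_I2 tendsto_mult_right LIMSEQ_indicator_UN)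
      note dct = L2_dominated_convergence[OF _ _ ind_L2[of UNIV c d] this, where B=1]
      have "(\<lambda>n. L2_norm (\<lambda>x. indicator ((\<Union>i<n. A i) \<inter> {c..d}) x - indicator ((\<Union>i. A i) \<inter> {c..d}) x)) \<longlonglongrightarrow> 0"
        by (rule dct) (auto simp: indicator_def)
      then show ?case by (intro lim[OF _ fin]) (auto intro!: ind_L2)
    qed
  qed
  \<comment> \<open>Simple functions dominated by \<open>2 |g|\<close> approximate \<open>g\<close>
    pointwise, and on \<open>{c..d}\<close> each of them is a finite combination of the indicators
    from \<open>step1\<close>.\<close>
  have step2: "P (\<lambda>x. indicator {c..d} x * g x)" if cd: "{c..d} \<subseteq> U" and g: "g \<in> L2" for g c d
  proof -
    have [measurable]: "g \<in> borel_measurable borel" using g by (simp add: L2_iff)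
    then have "g \<in> borel_measurable lborel" by simp
    from borel_measurable_implies_sequence_metric[OF this, of 0] obtain s where
      s: "\<And>i. simple_function lborel (s i)" "\<And>x. (\<lambda>i. s i x) \<longlonglongrightarrow> g x"
        "\<And>i x. norm (s i x) \<le> 2 * norm (g x)" by auto
    have sm [measurable]: "s i \<in> borel_measurable borel" for i
      using borel_measurable_simple_function[OF s(1)] by simp
    have A [measurable]: "s i -` {y} \<in> sets borel" for i y
      using measurable_sets_borel[OF sm, of "{y}" i] by simp
    have P: "P (\<lambda>x. indicator {c..d} x * s i x)" for i
    proof -
      have "P (\<lambda>x. \<Sum>y\<in>range (s i). y * indicator (s i -` {y} \<inter> {c..d}) x)"
        using s(1)[of i] by (intro sum) (auto simp: simple_function_def intro!: cmult step1 cd L2_cmult ind_L2)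
      also have "(\<lambda>x. \<Sum>y\<in>range (s i). y * indicator (s i -` {y} \<inter> {c..d}) x) = (\<lambda>x. indicator {c..d} x * s i x)"
      proof
        fix x
        have "s i x = (\<Sum>y\<in>range (s i). indicator (s i -` {y}) x *\<^sub>R y)"
        proof -
          have "x \<in> space lborel" by simp
          from simple_function_indicator_representation_banach[OF s(1)[of i] this] show ?thesis
            by (simp only: space_lborel space_borel Int_UNIV_right)
        qed
        from arg_cong[OF this, of "(*) (indicator {c..d} x)"]
        have "indicator {c..d} x * s i x = (\<Sum>y\<in>range (s i). indicator {c..d} x * (indicator (s i -` {y}) x *\<^sub>R y))"
          unfolding sum_distrib_left .
        also have "\<dots> = (\<Sum>y\<in>range (s i). y * indicator (s i -` {y} \<inter> {c..d}) x)"
          by (intro sum.cong) (auto simp: indicator_def)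
        finally show "(\<Sum>y\<in>range (s i). y * indicator (s i -` {y} \<inter> {c..d}) x) = indicator {c..d} x * s i x" ..
      qed
      finally show ?thesis .
    qed
    have L: "(\<lambda>x. indicator {c..d} x * h x) \<in> L2" if "h \<in> L2" for h
      by (rule L2_bounded_mult[OF that, where B=1]) (auto simp: indicator_def)
    have sL: "s i \<in> L2" for i by (rule L2_bound[OF sm g AE_I2, where B=2]) (rule s(3))
    have "(\<lambda>n. L2_norm (\<lambda>x. indicator {c..d} x * s n x - indicator {c..d} x * g x)) \<longlonglongrightarrow> 0"
    proof (rule L2_dominated_convergence(2)[OF _ _ g, where B=2])
      show "AE x in lborel. (\<lambda>n. indicator {c..d} x * s n x) \<longlonglongrightarrow> indicator {c..d} x * g x"
        using s(2) by (intro AE_I2 tendsto_mult_left)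
    qed (use s(3) in \<open>auto simp: indicator_def\<close>)
    then show ?thesis by (rule lim[OF L[OF sL] P L[OF g]])
  qed
  obtain D where D: "countable D" "D \<subseteq> Pow U" "\<And>X. X \<in> D \<Longrightarrow> \<exists>a b. X = cbox a b" "\<Union>D = U"
    using open_countable_Union_open_cbox[OF U] by metis
  \<comment> \<open>Inserting the empty set keeps the enumerated set nonempty, as
    \<open>from_nat_into\<close> requires, even if there are no boxes.\<close>
  define J where "J n = from_nat_into (insert {} D) n" for n
  have rJ: "range J = insert {} D"
    unfolding J_def using D(1) by (intro range_from_nat_into) auto
  have J: "\<exists>a b. J n = {a..b} \<and> {a..b} \<subseteq> U" for n
  proof -
    have "J n \<in> insert {} D" using rJ by auto
    then show ?thesis
    proof
      assume "J n = {}"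
      then show ?thesis by (intro exI[of _ 1] exI[of _ 0]) auto
    next
      assume "J n \<in> D"
      then show ?thesis using D(2,3) by (metis PowD cbox_interval subsetD)
    qed
  qed
  have UJ: "(\<Union>n. J n) = U" using rJ D(4) by auto
  have [measurable]: "J n \<in> sets borel" for n using J[of n] by auto
  have L: "(\<lambda>x. indicator A x * h x) \<in> L2" if "h \<in> L2" "A \<in> sets borel" for h A
    by (rule L2_bounded_mult[OF that(1), where B=1]) (use that(2) in \<open>auto simp: indicator_def\<close>)
  have P: "P (\<lambda>x. indicator (\<Union>i<n. J i) x * f x)" for n
  proof (induction n)
    case 0
    then show ?case using zero by simp
  next
    case (Suc n)
    obtain a b where ab: "J n = {a..b}" "{a..b} \<subseteq> U" using J by blast
    \<comment> \<open>The boxes may overlap, so the new summand is \<open>f\<close> cut off on the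
      earlier boxes and restricted to \<open>J n\<close>.\<close>
    have "(\<lambda>x. indicator (\<Union>i<Suc n. J i) x * f x) =
        (\<lambda>x. indicator (\<Union>i<n. J i) x * f x + indicator {a..b} x * (indicator (- (\<Union>i<n. J i)) x * f x))"
      using ab(1) by (auto simp: indicator_def fun_eq_iff lessThan_Suc)
    moreover have "(\<Union>i<n. J i) \<in> sets borel" "- (\<Union>i<n. J i) \<in> sets borel" by measurable
    ultimately show ?case
      using add[OF L[OF f(1)] Suc L step2[OF ab(2) L[OF f(1)]]] L[OF f(1)] by simp
  qed
  have "(\<lambda>n. L2_norm (\<lambda>x. indicator (\<Union>i<n. J i) x * f x - f x)) \<longlonglongrightarrow> 0"
  proof (rule L2_dominated_convergence(2)[OF _ _ f(1), where B=1])
    show "AE x in lborel. (\<lambda>n. indicator (\<Union>i<n. J i) x * f x) \<longlonglongrightarrow> f x"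
      using f(2)
    proof eventually_elim
      case (elim x)
      have "(\<lambda>n. indicator (\<Union>i<n. J i) x * f x) \<longlonglongrightarrow> indicator (\<Union>i. J i) x * f x"
        by (intro tendsto_mult_right LIMSEQ_indicator_UN)
      moreover have "indicator (\<Union>i. J i) x * f x = f x" unfolding UJ using elim by (auto simp: indicator_def)
      ultimately show ?case by simp
    qed
  qed (use f(1) in \<open>auto simp: indicator_def L2_iff\<close>)
  from lim[OF _ P f(1) this] show ?thesis using L[OF f(1)] by simp
qed

section \<open>The Poisson integral\<close>

lemma integrable_inverse_1_plus_sq: "integrable lborel (\<lambda>x::real. inverse (1 + x\<^sup>2))"
  using integrable_inverse_1_plus_square by (simp add: set_integrable_def)

lemma integral_inverse_1_plus_sq: "(LINT x::real|lborel. inverse (1 + x\<^sup>2)) = pi"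
  using LBINT_inverse_1_plus_square
  by (simp add: interval_lebesgue_integral_def set_lebesgue_integral_def)

definition poisson :: "real \<Rightarrow> real \<Rightarrow> real" where
  "poisson y x = y / (pi * (x\<^sup>2 + y\<^sup>2))"

lemma poisson_measurable [measurable]: "poisson y \<in> borel_measurable borel"
  unfolding poisson_def by measurable

lemma poisson_nonneg: "0 \<le> y \<Longrightarrow> 0 \<le> poisson y x"
  by (simp add: poisson_def)

lemma poisson_le: assumes "0 < y" shows "poisson y x \<le> 1 / (pi * y)"
proof -
  have "poisson y x \<le> y / (pi * y\<^sup>2)"
    unfolding poisson_def using assms by (intro divide_left_mono) (auto intro!: mult_pos_pos add_nonneg_pos)
  also have "\<dots> = 1 / (pi * y)" using assms by (simp add: power2_eq_square)
  finally show ?thesis .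
qed

lemma poisson_scale: "0 < y \<Longrightarrow> poisson y (y * u) = inverse (1 + u\<^sup>2) / (pi * y)"
proof -
  assume y: "0 < y"
  have "(y * u)\<^sup>2 + y\<^sup>2 = y * (y * (1 + u\<^sup>2))" by (simp add: power2_eq_square algebra_simps)
  then show ?thesis using y by (simp add: poisson_def inverse_eq_divide)
qed

lemma
  assumes y: "0 < y"
  shows poisson_integrable: "integrable lborel (poisson y)"
    and poisson_integral: "(LINT x|lborel. poisson y x) = 1"
proof -
  show "integrable lborel (poisson y)"
    using lborel_integrable_real_affine_iff[of y "poisson y" 0] y integrable_inverse_1_plus_sq
    by (simp add: poisson_scale)
  have "(LINT x|lborel. poisson y x) = \<bar>y\<bar> *\<^sub>R (LINT u|lborel. poisson y (0 + y * u))"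
    by (rule lborel_integral_real_affine) (use y in simp)
  also have "\<dots> = 1" using y by (simp add: poisson_scale integral_inverse_1_plus_sq)
  finally show "(LINT x|lborel. poisson y x) = 1" .
qed

lemma poisson_nn_integral: "0 < y \<Longrightarrow> (\<integral>\<^sup>+ x. ennreal (poisson y x) \<partial>lborel) = 1"
  using nn_integral_eq_integral[OF poisson_integrable, of y] by (simp add: poisson_nonneg poisson_integral)

text \<open>Jensen's inequality for the probability density \<open>poisson y\<close>: writing the
  density as a product of two square roots, Cauchy-Schwarz bounds the squared average by the average
  of the squares, and Tonelli exchanges the integrals. With \<open>F\<close> depending on both
  variables it covers the Poisson integral of \<open>f\<close> as well as its distance from
  \<open>f\<close>.\<close>

lemma poisson_average_L2:
  assumes y: "0 < y" and F [measurable]: "case_prod F \<in> borel_measurable (borel \<Otimes>\<^sub>M borel)"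
    and L2: "\<And>x. (\<lambda>s. of_real (sqrt (poisson y s)) * F x s) \<in> L2"
  shows "L2_norm_sq (\<lambda>x. LINT s|lborel. of_real (poisson y s) * F x s)
     \<le> (\<integral>\<^sup>+ s. ennreal (poisson y s) * L2_norm_sq (\<lambda>x. F x s) \<partial>lborel)"
proof -
  let ?r = "\<lambda>s. complex_of_real (sqrt (poisson y s))"
  have r: "?r \<in> L2" and rn: "L2_norm ?r = 1"
    using poisson_integrable[OF y] poisson_integral[OF y] poisson_nonneg[of y] y
    by (auto simp: L2_iff L2_norm_def)
  have *: "ennreal ((norm (LINT s|lborel. of_real (poisson y s) * F x s))\<^sup>2)
      \<le> (\<integral>\<^sup>+ s. ennreal (poisson y s) * ennreal ((norm (F x s))\<^sup>2) \<partial>lborel)" for x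
  proof -
    have "(LINT s|lborel. of_real (poisson y s) * F x s) = (LINT s|lborel. ?r s * (?r s * F x s))"
      using poisson_nonneg[of y] y by (intro Bochner_Integration.integral_cong)
        (auto simp flip: mult.assoc of_real_mult)
    then have "norm (LINT s|lborel. of_real (poisson y s) * F x s) \<le> 1 * L2_norm (\<lambda>s. ?r s * F x s)"
      using L2_Cauchy_Schwarz[OF r L2[of x]] by (simp add: rn)
    then have "(norm (LINT s|lborel. of_real (poisson y s) * F x s))\<^sup>2 \<le> (L2_norm (\<lambda>s. ?r s * F x s))\<^sup>2"
      by (intro power_mono) auto
    then have "ennreal ((norm (LINT s|lborel. of_real (poisson y s) * F x s))\<^sup>2) \<le> L2_norm_sq (\<lambda>s. ?r s * F x s)"
      unfolding L2_norm_sq_eq[OF L2] by (rule ennreal_leI)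
    also have "\<dots> = (\<integral>\<^sup>+ s. ennreal (poisson y s) * ennreal ((norm (F x s))\<^sup>2) \<partial>lborel)"
      unfolding L2_norm_sq_def using poisson_nonneg[of y] y
      by (intro nn_integral_cong) (simp add: norm_mult power_mult_distrib ennreal_mult)
    finally show ?thesis .
  qed
  have "L2_norm_sq (\<lambda>x. LINT s|lborel. of_real (poisson y s) * F x s)
     \<le> (\<integral>\<^sup>+ x. \<integral>\<^sup>+ s. ennreal (poisson y s) * ennreal ((norm (F x s))\<^sup>2) \<partial>lborel \<partial>lborel)"
    unfolding L2_norm_sq_def by (intro nn_integral_mono *)
  also have "\<dots> = (\<integral>\<^sup>+ s. \<integral>\<^sup>+ x. ennreal (poisson y s) * ennreal ((norm (F x s))\<^sup>2) \<partial>lborel \<partial>lborel)"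
    by (rule lborel_pair.Fubini'[symmetric]) simp
  also have "\<dots> = (\<integral>\<^sup>+ s. ennreal (poisson y s) * L2_norm_sq (\<lambda>x. F x s) \<partial>lborel)"
    unfolding L2_norm_sq_def by (intro nn_integral_cong nn_integral_cmult) simp
  finally show ?thesis .
qed

section \<open>Reflections and translations of square integrable functions\<close>

lemma L2_reflect: "f \<in> L2 \<Longrightarrow> (\<lambda>s. f (x - s)) \<in> L2"
  using lborel_integrable_real_affine[of "\<lambda>x. (norm (f x))\<^sup>2" "-1" x] by (auto simp: L2_iff)

lemma L2_shift: "f \<in> L2 \<Longrightarrow> (\<lambda>x. f (x - s)) \<in> L2"
  using lborel_integrable_real_affine[of "\<lambda>x. (norm (f x))\<^sup>2" 1 "-s"] by (auto simp: L2_iff)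

lemma L2_norm_shift: "L2_norm (\<lambda>x. f (x - s)) = L2_norm f"
  unfolding L2_norm_def using lborel_integral_real_affine[of 1 "\<lambda>x. (norm (f x))\<^sup>2" "-s"] by simp

text \<open>Translation moves the indicator of an interval only near the two endpoints. The general
  case follows by density, because translations are isometries.\<close>

lemma L2_shift_continuous:
  assumes f: "f \<in> L2"
  shows "((\<lambda>s. L2_norm (\<lambda>x. f (x - s) - f x)) \<longlongrightarrow> 0) (nhds 0)"
proof -
  have U: "open (UNIV :: real set)" and AE: "AE x in lborel. x \<notin> UNIV \<longrightarrow> f x = 0" by auto
  from U f AE show ?thesis
  proof (induction f rule: L2_on_induct)
    case (interval a b)
    \<comment> \<open>The indicator and its translate differ only within distance \<open>|s|\<close>
      of \<open>a\<close> or \<open>b\<close>, a set of measure at most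
      \<open>4 |s|\<close>.\<close>
    have bound: "L2_norm (\<lambda>x. indicator {a..b} (x - s) - indicator {a..b} x) \<le> sqrt (4 * \<bar>s\<bar>)" for s
    proof -
      let ?i = "\<lambda>c. indicator {c - \<bar>s\<bar>..c + \<bar>s\<bar>} :: real \<Rightarrow> real"
      have "(LINT x|lborel. (norm (indicator {a..b} (x - s) - indicator {a..b} x :: complex))\<^sup>2)
          \<le> (LINT x|lborel. ?i a x + ?i b x)"
      proof (rule integral_mono_AE')
        have "integrable lborel (?i c)" for c by (simp add: emeasure_lborel_Icc_eq)
        then show "integrable lborel (\<lambda>x. ?i a x + ?i b x)" by (intro Bochner_Integration.integrable_add)
      qed (auto simp: indicator_def)
      also have "\<dots> = 4 * \<bar>s\<bar>" by simp
      finally show ?thesis by (simp add: L2_norm_def)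
    qed
    have "((\<lambda>s. sqrt (4 * \<bar>s\<bar>)) \<longlongrightarrow> sqrt (4 * \<bar>0::real\<bar>)) (nhds 0)"
      by (intro tendsto_intros filterlim_ident)
    then have "((\<lambda>s::real. sqrt (4 * \<bar>s\<bar>)) \<longlongrightarrow> 0) (nhds 0)" by simp
    then show ?case
      by (rule Lim_null_comparison[rotated]) (use bound in simp)
  next
    case (add f g)
    have bound: "L2_norm (\<lambda>x. f (x - s) + g (x - s) - (f x + g x))
      \<le> L2_norm (\<lambda>x. f (x - s) - f x) + L2_norm (\<lambda>x. g (x - s) - g x)" for s
      using L2_norm_triangle[of "\<lambda>x. f (x - s) - f x" "\<lambda>x. g (x - s) - g x"] add
      by (auto simp: algebra_simps L2_shift L2_diff)
    have "((\<lambda>s. L2_norm (\<lambda>x. f (x - s) - f x) + L2_norm (\<lambda>x. g (x - s) - g x)) \<longlongrightarrow> 0) (nhds 0)"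
      using tendsto_add[OF add.IH] by simp
    then show ?case
      by (rule Lim_null_comparison[rotated]) (use bound in simp)
  next
    case (cmult f c)
    have "L2_norm (\<lambda>x. c * f (x - s) - c * f x) = norm c * L2_norm (\<lambda>x. f (x - s) - f x)" for s
      by (subst L2_norm_cmult[symmetric]) (simp add: algebra_simps)
    then show ?case using tendsto_mult_left[OF cmult.IH, of "norm c"] by simp
  next
    case (lim g f)
    show ?case
    proof (rule tendstoI)
      fix e :: real assume e: "e > 0"
      from lim.hyps(3) have "eventually (\<lambda>n. L2_norm (\<lambda>x. g n x - f x) < e / 3) sequentially"
        using e by (intro order_tendstoD) auto
      then obtain n where n: "L2_norm (\<lambda>x. g n x - f x) < e / 3" by (auto simp: eventually_sequentially)
      have "eventually (\<lambda>s. L2_norm (\<lambda>x. g n (x - s) - g n x) < e / 3) (nhds 0)"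
        using lim.IH[of n] e by (intro order_tendstoD) auto
      then show "eventually (\<lambda>s. dist (L2_norm (\<lambda>x. f (x - s) - f x)) 0 < e) (nhds 0)"
      proof eventually_elim
        case (elim s)
        have "L2_norm (\<lambda>x. f (x - s) - f x) \<le> L2_norm (\<lambda>x. f (x - s) - g n (x - s)) + L2_norm (\<lambda>x. g n (x - s) - f x)"
          using lim.hyps(1)[of n] lim.hyps(2) by (intro L2_norm_triangle_diff L2_shift) auto
        moreover have "L2_norm (\<lambda>x. g n (x - s) - f x) \<le> L2_norm (\<lambda>x. g n (x - s) - g n x) + L2_norm (\<lambda>x. g n x - f x)"
          using lim.hyps(1)[of n] lim.hyps(2) by (intro L2_norm_triangle_diff L2_shift) auto
        moreover have "L2_norm (\<lambda>x. f (x - s) - g n (x - s)) = L2_norm (\<lambda>x. g n x - f x)"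
          using L2_norm_shift[of "\<lambda>x. f x - g n x"] L2_norm_minus_commute[of f "g n"] by simp
        ultimately show ?case using n elim by simp
      qed
    qed
  qed
qed

section \<open>Poisson integrals as an approximate identity\<close>

definition poisson_integral_fun :: "real \<Rightarrow> (real \<Rightarrow> complex) \<Rightarrow> real \<Rightarrow> complex" where
  "poisson_integral_fun y f x = (LINT s|lborel. of_real (poisson y s) * f (x - s))"

lemma sqrt_poisson_mult_L2:
  assumes y: "0 < y" and "f \<in> L2" shows "(\<lambda>s. of_real (sqrt (poisson y s)) * f s) \<in> L2"
  by (rule L2_bounded_mult[OF assms(2), where B="sqrt (1 / (pi * y))"])
     (use poisson_le[OF y] poisson_nonneg y in \<open>auto simp: less_imp_le\<close>)

lemma sqrt_poisson_L2: "0 < y \<Longrightarrow> (\<lambda>s. of_real (sqrt (poisson y s)) * c) \<in> L2"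
  using poisson_integrable[of y] poisson_nonneg[of y]
  by (auto simp: L2_iff norm_mult power_mult_distrib)

lemma poisson_integral_fun_measurable [measurable]:
  assumes [measurable]: "f \<in> borel_measurable borel"
  shows "poisson_integral_fun y f \<in> borel_measurable borel"
  unfolding poisson_integral_fun_def by measurable

lemma poisson_integral_fun_L2:
  assumes y: "0 < y" and f: "f \<in> L2"
  shows "poisson_integral_fun y f \<in> L2" "L2_norm (poisson_integral_fun y f) \<le> L2_norm f"
proof -
  have [measurable]: "f \<in> borel_measurable borel" using f by (simp add: L2_iff)
  have "L2_norm_sq (poisson_integral_fun y f)
      \<le> (\<integral>\<^sup>+ s. ennreal (poisson y s) * L2_norm_sq (\<lambda>x. f (x - s)) \<partial>lborel)"
    unfolding poisson_integral_fun_def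
    by (rule poisson_average_L2[OF y]) (use y f in \<open>auto intro!: sqrt_poisson_mult_L2 L2_reflect\<close>)
  also have "\<dots> = (\<integral>\<^sup>+ s. ennreal (poisson y s) * ennreal ((L2_norm f)\<^sup>2) \<partial>lborel)"
    by (simp add: L2_norm_sq_eq[OF L2_shift[OF f]] L2_norm_shift)
  also have "\<dots> = ennreal ((L2_norm f)\<^sup>2)"
    by (simp add: nn_integral_multc poisson_nn_integral y)
  finally have *: "L2_norm_sq (poisson_integral_fun y f) \<le> ennreal ((L2_norm f)\<^sup>2)" .
  show "poisson_integral_fun y f \<in> L2" "L2_norm (poisson_integral_fun y f) \<le> L2_norm f"
    using L2_I_bound[OF _ *] by auto
qed

lemma poisson_integral_fun_diff:
  assumes y: "0 < y" and f: "f \<in> L2"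
  shows "poisson_integral_fun y f x - f x = (LINT s|lborel. of_real (poisson y s) * (f (x - s) - f x))"
proof -
  let ?r = "\<lambda>s. complex_of_real (sqrt (poisson y s))"
  have "integrable lborel (\<lambda>s. ?r s * 1 * (?r s * f (x - s)))"
    by (intro L2_integrable_mult sqrt_poisson_L2 sqrt_poisson_mult_L2 L2_reflect y f)
  then have 1: "integrable lborel (\<lambda>s. of_real (poisson y s) * f (x - s))"
    using poisson_nonneg[of y] y by (simp flip: mult.assoc of_real_mult)
  have 2: "integrable lborel (\<lambda>s. of_real (poisson y s) * f x)"
    using poisson_integrable[OF y] by simp
  have "(LINT s|lborel. of_real (poisson y s) * f x) = f x"
    using poisson_integral[OF y] by simp
  then show ?thesis
    unfolding poisson_integral_fun_def right_diff_distrib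
    by (subst Bochner_Integration.integral_diff[OF 1 2]) simp
qed

text \<open>Away from 0 the kernel is at most y / (pi s^2), and this is y (1 + 1/s^2) times the
  kernel at height 1. The tail is thus controlled by the known mass of \<open>poisson 1\<close>,
  without a further integral.\<close>

lemma poisson_tail:
  assumes "0 < y" "y \<le> 1" "0 < d" "d \<le> \<bar>s\<bar>"
  shows "poisson y s \<le> y * (1 + 1 / d\<^sup>2) * poisson 1 s"
proof -
  have d: "d\<^sup>2 \<le> s\<^sup>2" using assms by (metis abs_le_square_iff abs_of_pos)
  have s: "0 < s\<^sup>2" using assms d by (smt (verit) zero_less_power)
  have "poisson y s \<le> y / (pi * s\<^sup>2)"
    unfolding poisson_def using assms s by (intro divide_left_mono) (auto intro!: mult_pos_pos add_pos_nonneg)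
  also have "\<dots> = y * (1 + 1 / s\<^sup>2) * poisson 1 s"
  proof -
    have "1 + 1 / s\<^sup>2 = (s\<^sup>2 + 1) / s\<^sup>2" "s\<^sup>2 + 1 \<noteq> 0" using s by (auto simp: field_simps, linarith)
    then show ?thesis by (simp add: poisson_def)
  qed
  also have "\<dots> \<le> y * (1 + 1 / d\<^sup>2) * poisson 1 s"
    using assms s d by (intro mult_right_mono mult_left_mono add_left_mono divide_left_mono poisson_nonneg) auto
  finally show ?thesis .
qed

text \<open>The squared error is at most the Poisson average of \<open>(\<tau> s)^2\<close>. Small
  shifts are harmless by the continuity of translation, and the mass of the large ones is of order
  \<open>y\<close>.\<close>

lemma poisson_integral_fun_tendsto:
  assumes f: "f \<in> L2"
  shows "((\<lambda>y. L2_norm (\<lambda>x. poisson_integral_fun y f x - f x)) \<longlongrightarrow> 0) (at_right 0)"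
proof -
  have [measurable]: "f \<in> borel_measurable borel" using f by (simp add: L2_iff)
  define \<tau> where "\<tau> s = L2_norm (\<lambda>x. f (x - s) - f x)" for s
  have \<tau>b: "\<tau> s \<le> 2 * L2_norm f" for s
    using L2_norm_triangle[OF L2_shift[OF f, of s] L2_cmult[OF f, of "-1"]] L2_norm_shift[of f s] L2_norm_cmult[of "-1" f]
    by (simp add: \<tau>_def)
  \<comment> \<open>The first term collects the shifts below \<open>d\<close>, where the kernel has
    mass at most 1; the second collects the others, with \<open>\<tau>\<close> bounded by twice the
    norm and the kernel bounded by \<open>poisson_tail\<close>.\<close>
  have key: "(L2_norm (\<lambda>x. poisson_integral_fun y f x - f x))\<^sup>2 \<le> e\<^sup>2 + (2 * L2_norm f)\<^sup>2 * (y * (1 + 1 / d\<^sup>2))"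
    if y: "0 < y" "y \<le> 1" and d: "0 < d" "\<And>s. \<bar>s\<bar> < d \<Longrightarrow> \<tau> s \<le> e" for y d e
  proof -
    have L: "(\<lambda>x. poisson_integral_fun y f x - f x) \<in> L2"
      using poisson_integral_fun_L2[OF y(1) f] f by auto
    have "ennreal ((L2_norm (\<lambda>x. poisson_integral_fun y f x - f x))\<^sup>2) = L2_norm_sq (\<lambda>x. poisson_integral_fun y f x - f x)"
      using L2_norm_sq_eq[OF L] by simp
    also have "\<dots> \<le> (\<integral>\<^sup>+ s. ennreal (poisson y s) * L2_norm_sq (\<lambda>x. f (x - s) - f x) \<partial>lborel)"
      unfolding poisson_integral_fun_diff[OF y(1) f]
    proof (rule poisson_average_L2[OF y(1)])
      fix x
      have "(\<lambda>s. of_real (sqrt (poisson y s)) * f (x - s) - of_real (sqrt (poisson y s)) * f x) \<in> L2"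
        using y f by (intro L2_diff sqrt_poisson_L2 sqrt_poisson_mult_L2 L2_reflect)
      then show "(\<lambda>s. of_real (sqrt (poisson y s)) * (f (x - s) - f x)) \<in> L2"
        by (simp add: right_diff_distrib)
    qed simp
    also have "\<dots> = (\<integral>\<^sup>+ s. ennreal (poisson y s * (\<tau> s)\<^sup>2) \<partial>lborel)"
      using y poisson_nonneg[of y]
      by (simp add: L2_norm_sq_eq[OF L2_diff[OF L2_shift[OF f] f]] \<tau>_def ennreal_mult)
    also have "\<dots> \<le> (\<integral>\<^sup>+ s. ennreal (e\<^sup>2 * poisson y s + (2 * L2_norm f)\<^sup>2 * (y * (1 + 1 / d\<^sup>2)) * poisson 1 s) \<partial>lborel)"
    proof (intro nn_integral_mono ennreal_leI)
      fix s
      show "poisson y s * (\<tau> s)\<^sup>2 \<le> e\<^sup>2 * poisson y s + (2 * L2_norm f)\<^sup>2 * (y * (1 + 1 / d\<^sup>2)) * poisson 1 s"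
      proof (cases "\<bar>s\<bar> < d")
        case True
        have "(\<tau> s)\<^sup>2 \<le> e\<^sup>2" using d(2)[OF True] by (intro power_mono) (auto simp: \<tau>_def)
        then have "poisson y s * (\<tau> s)\<^sup>2 \<le> e\<^sup>2 * poisson y s"
          using y poisson_nonneg[of y s] by (simp add: mult.commute mult_left_mono)
        moreover have "0 \<le> (2 * L2_norm f)\<^sup>2 * (y * (1 + 1 / d\<^sup>2)) * poisson 1 s"
          using y by (intro mult_nonneg_nonneg poisson_nonneg) auto
        ultimately show ?thesis by linarith
      next
        case False
        have "poisson y s * (\<tau> s)\<^sup>2 \<le> (y * (1 + 1 / d\<^sup>2) * poisson 1 s) * (2 * L2_norm f)\<^sup>2"
          using poisson_tail[of y d s] y d(1) False \<tau>b[of s] poisson_nonneg[of 1 s]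
          by (intro mult_mono power_mono mult_nonneg_nonneg) (auto simp: \<tau>_def)
        moreover have "0 \<le> e\<^sup>2 * poisson y s" using y poisson_nonneg[of y s] by simp
        ultimately show ?thesis by (simp add: algebra_simps)
      qed
    qed
    also have "\<dots> = ennreal (LINT s|lborel. e\<^sup>2 * poisson y s + (2 * L2_norm f)\<^sup>2 * (y * (1 + 1 / d\<^sup>2)) * poisson 1 s)"
      using y poisson_nonneg[of y] poisson_nonneg[of 1] poisson_integrable[of y] poisson_integrable[of 1]
      by (intro nn_integral_eq_integral) auto
    also have "(LINT s|lborel. e\<^sup>2 * poisson y s + (2 * L2_norm f)\<^sup>2 * (y * (1 + 1 / d\<^sup>2)) * poisson 1 s)
        = e\<^sup>2 + (2 * L2_norm f)\<^sup>2 * (y * (1 + 1 / d\<^sup>2))"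
      using poisson_integrable[of y] poisson_integrable[of 1] poisson_integral[of y] poisson_integral[of 1] y by simp
    finally have "ennreal ((L2_norm (\<lambda>x. poisson_integral_fun y f x - f x))\<^sup>2)
      \<le> ennreal (e\<^sup>2 + (2 * L2_norm f)\<^sup>2 * (y * (1 + 1 / d\<^sup>2)))" .
    moreover have "0 \<le> e\<^sup>2 + (2 * L2_norm f)\<^sup>2 * (y * (1 + 1 / d\<^sup>2))" using y by simp
    ultimately show ?thesis by (simp only: ennreal_le_iff)
  qed
  have "((\<lambda>y. (L2_norm (\<lambda>x. poisson_integral_fun y f x - f x))\<^sup>2) \<longlongrightarrow> 0) (at_right 0)"
  proof (rule tendstoI)
    fix E :: real assume E: "0 < E"
    define e where "e = sqrt (E / 2)"
    have e: "e > 0" "e\<^sup>2 = E / 2" using E by (auto simp: e_def)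
    have "eventually (\<lambda>s. \<tau> s < e) (nhds 0)"
      using L2_shift_continuous[OF f] e unfolding \<tau>_def by (intro order_tendstoD) auto
    then obtain d where d: "0 < d" "\<And>s. \<bar>s\<bar> < d \<Longrightarrow> \<tau> s \<le> e"
      by (auto simp: eventually_nhds_metric dist_real_def intro: less_imp_le)
    have "((\<lambda>y. (2 * L2_norm f)\<^sup>2 * (y * (1 + 1 / d\<^sup>2))) \<longlongrightarrow> (2 * L2_norm f)\<^sup>2 * (0 * (1 + 1 / d\<^sup>2))) (at_right 0)"
      by (intro tendsto_intros filterlim_ident)
    then have "eventually (\<lambda>y. (2 * L2_norm f)\<^sup>2 * (y * (1 + 1 / d\<^sup>2)) < E / 2) (at_right 0)"
      using E by (intro order_tendstoD) auto
    moreover have "eventually (\<lambda>y. 0 < y \<and> y \<le> 1) (at_right (0::real))"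
      using eventually_at_right_real[of 0 1] by (auto elim!: eventually_mono)
    ultimately show "eventually (\<lambda>y. dist ((L2_norm (\<lambda>x. poisson_integral_fun y f x - f x))\<^sup>2) 0 < E) (at_right 0)"
    proof eventually_elim
      case (elim y)
      then show ?case using key[of y d e] d e by simp
    qed
  qed
  then have "((\<lambda>y. sqrt ((L2_norm (\<lambda>x. poisson_integral_fun y f x - f x))\<^sup>2)) \<longlongrightarrow> sqrt 0) (at_right 0)"
    by (rule tendsto_real_sqrt)
  then show ?thesis by simp
qed

section \<open>Cauchy integrals and the Hardy space\<close>

text \<open>The interface between the definitions, stated with the extended-real norm, and the
  estimates, made with the real one. Membership in \<open>L2\<close> is essential: outside it
  \<open>L2_norm\<close> says nothing.\<close>

lemma L2_norm_sq_tendsto_0_iff: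
  assumes "eventually (\<lambda>n. s n \<in> L2) F"
  shows "((\<lambda>n. L2_norm_sq (s n)) \<longlongrightarrow> 0) F \<longleftrightarrow> ((\<lambda>n. L2_norm (s n)) \<longlongrightarrow> 0) F"
proof -
  have "((\<lambda>n. L2_norm_sq (s n)) \<longlongrightarrow> 0) F \<longleftrightarrow> ((\<lambda>n. ennreal ((L2_norm (s n))\<^sup>2)) \<longlongrightarrow> 0) F"
    by (rule filterlim_cong[OF refl refl]) (use assms in eventually_elim, simp add: L2_norm_sq_eq)
  also have "\<dots> \<longleftrightarrow> ((\<lambda>n. (L2_norm (s n))\<^sup>2) \<longlongrightarrow> 0) F"
    using tendsto_ennreal_iff[where F=F and f="\<lambda>n. (L2_norm (s n))\<^sup>2" and x=0] by simp
  also have "\<dots> \<longleftrightarrow> ((\<lambda>n. L2_norm (s n)) \<longlongrightarrow> 0) F"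
  proof
    assume "((\<lambda>n. (L2_norm (s n))\<^sup>2) \<longlongrightarrow> 0) F"
    from tendsto_real_sqrt[OF this] show "((\<lambda>n. L2_norm (s n)) \<longlongrightarrow> 0) F" by simp
  next
    assume "((\<lambda>n. L2_norm (s n)) \<longlongrightarrow> 0) F"
    from tendsto_power[OF this, of 2] show "((\<lambda>n. (L2_norm (s n))\<^sup>2) \<longlongrightarrow> 0) F" by simp
  qed
  finally show ?thesis .
qed

text \<open>The squared distance from \<open>t\<close> to \<open>w\<close> is
  \<open>(t - Re w)^2 + (Im w)^2\<close>, so this is a translate of the Poisson kernel up to
  scaling, and total mass 1 gives the norm of the Cauchy kernel.\<close>

lemma cauchy_kernel_norm:
  assumes "Im w \<noteq> 0"
  shows "(norm (1 / (complex_of_real t - w)))\<^sup>2 = pi / \<bar>Im w\<bar> * poisson \<bar>Im w\<bar> (t - Re w)"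
  using assms by (simp add: norm_divide power_divide cmod_power2 poisson_def)

lemma
  assumes w: "Im w \<noteq> 0"
  shows cauchy_kernel_L2: "(\<lambda>t. 1 / (complex_of_real t - w)) \<in> L2"
    and cauchy_kernel_L2_norm: "L2_norm (\<lambda>t. 1 / (complex_of_real t - w)) = sqrt (pi / \<bar>Im w\<bar>)"
proof -
  have i: "integrable lborel (\<lambda>t. poisson \<bar>Im w\<bar> (t - Re w))"
    using lborel_integrable_real_affine[OF poisson_integrable[of "\<bar>Im w\<bar>"], of 1 "- Re w"] w by simp
  show "(\<lambda>t. 1 / (complex_of_real t - w)) \<in> L2"
    unfolding L2_iff cauchy_kernel_norm[OF w] using i by simp
  have "(LINT t|lborel. poisson \<bar>Im w\<bar> (t - Re w)) = 1"
    using lborel_integral_real_affine[of 1 "poisson \<bar>Im w\<bar>" "- Re w"] poisson_integral[of "\<bar>Im w\<bar>"] w by simp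
  then show "L2_norm (\<lambda>t. 1 / (complex_of_real t - w)) = sqrt (pi / \<bar>Im w\<bar>)"
    unfolding L2_norm_def cauchy_kernel_norm[OF w] by simp
qed

lemma cauchy_integrable:
  assumes "f \<in> L2" "Im w \<noteq> 0" shows "integrable lborel (\<lambda>t. f t / (of_real t - w))"
  using L2_integrable_mult[OF assms(1) cauchy_kernel_L2[OF assms(2)]] by simp

definition cauchy_integral :: "(real \<Rightarrow> complex) \<Rightarrow> complex \<Rightarrow> complex" where
  "cauchy_integral f z = (LINT t|lborel. f t / (of_real t - z)) / (2 * of_real pi * \<i>)"

text \<open>With z = x + i y the difference of the two kernels is 2 i y / |t - z|^2, which divided
  by 2 pi i is the Poisson kernel at x - t. Bounds for Cauchy integrals on lines thereby become
  bounds for boundary functions.\<close>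

lemma cauchy_integral_jump:
  assumes y: "0 < y" and f: "f \<in> L2"
  shows "cauchy_integral f (Complex x y) - cauchy_integral f (Complex x (- y)) = poisson_integral_fun y f x"
proof -
  have pw: "(f t / (of_real t - Complex x y) - f t / (of_real t - Complex x (- y))) / (2 * of_real pi * \<i>)
      = of_real (poisson y (x - t)) * f t" for t
  proof -
    let ?a = "complex_of_real t - Complex x y" and ?b = "complex_of_real t - Complex x (- y)"
    have nz: "?a \<noteq> 0" "?b \<noteq> 0" using y by (auto simp: complex_eq_iff)
    have ba: "?b - ?a = 2 * \<i> * of_real y" by (simp add: complex_eq_iff)
    define r where "r = (x - t)\<^sup>2 + y\<^sup>2"
    have ab: "?a * ?b = of_real r" by (simp add: r_def complex_eq_iff power2_eq_square algebra_simps)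
    have "f t / ?a - f t / ?b = f t * (?b - ?a) / (?a * ?b)" using nz by (simp add: field_simps)
    also have "\<dots> = f t * (2 * \<i> * of_real y) / of_real r" by (simp only: ba ab)
    finally show ?thesis by (simp add: poisson_def mult_ac flip: r_def)
  qed
  have "cauchy_integral f (Complex x y) - cauchy_integral f (Complex x (- y)) =
      (LINT t|lborel. (f t / (of_real t - Complex x y) - f t / (of_real t - Complex x (- y))) / (2 * of_real pi * \<i>))"
    unfolding cauchy_integral_def
    using cauchy_integrable[OF f, of "Complex x y"] cauchy_integrable[OF f, of "Complex x (- y)"] y
    by (subst integral_divide_zero, subst Bochner_Integration.integral_diff) (auto simp: diff_divide_distrib)
  also have "\<dots> = (LINT t|lborel. of_real (poisson y (x - t)) * f t)" by (simp only: pw)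
  also have "\<dots> = poisson_integral_fun y f x"
    unfolding poisson_integral_fun_def
    using lborel_integral_real_affine[of "-1" "\<lambda>s. of_real (poisson y s) * f (x - s)" x] by simp
  finally show ?thesis .
qed

text \<open>Differentiation under the integral sign with an explicit remainder: the error of the
  difference quotient is \<open>h\<close> times an integral that stays bounded, since
  \<open>z\<close> and \<open>z + h\<close> keep distances \<open>v\<close> and \<open>v / 2\<close>
  from the real line.\<close>

lemma cauchy_integral_has_derivative:
  assumes f: "f \<in> L2" and z: "Im z > 0"
  shows "(cauchy_integral f has_field_derivative
     (LINT t|lborel. f t / (of_real t - z)\<^sup>2) / (2 * of_real pi * \<i>)) (at z)"
proof -
  define v where "v = Im z"
  define K where "K t = f t / (of_real t - z)" for t :: real
  have K: "integrable lborel K" unfolding K_def using cauchy_integrable[OF f, of z] z by simp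
  have [measurable]: "f \<in> borel_measurable borel" using f by (simp add: L2_iff)
  have v: "v > 0" using z by (simp add: v_def)
  have low: "v \<le> norm (of_real t - z)" for t
    using abs_Im_le_cmod[of "of_real t - z"] z by (simp add: v_def)
  have low2: "v / 2 \<le> norm (of_real t - (z + h))" if "norm h < v / 2" for t h
    using norm_triangle_ineq2[of "of_real t - z" h] low[of t] that by (simp add: diff_diff_eq)
  have sq: "integrable lborel (\<lambda>t. f t / (of_real t - z)\<^sup>2)"
  proof (rule Bochner_Integration.integrable_bound)
    show "integrable lborel (\<lambda>t. K t / of_real v)" using K by simp
    show "AE t in lborel. norm (f t / (of_real t - z)\<^sup>2) \<le> norm (K t / of_real v)"
    proof (rule AE_I2)
      fix t
      have "norm (f t / (of_real t - z)\<^sup>2) = norm (K t) / norm (of_real t - z)"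
        by (simp add: K_def norm_divide norm_mult power2_eq_square)
      also have "\<dots> \<le> norm (K t) / v" using low[of t] v by (intro divide_left_mono mult_pos_pos) (auto intro: less_le_trans)
      finally show "norm (f t / (of_real t - z)\<^sup>2) \<le> norm (K t / of_real v)" using v by (simp add: norm_divide)
    qed
  qed measurable
  let ?J = "\<lambda>z. LINT t|lborel. f t / (of_real t - z)"
  have "(?J has_field_derivative (LINT t|lborel. f t / (of_real t - z)\<^sup>2)) (at z)"
    unfolding DERIV_def
  proof (rule LIM_zero_cancel, rule Lim_null_comparison)
    show "eventually (\<lambda>h. norm ((?J (z + h) - ?J z) / h - (LINT t|lborel. f t / (of_real t - z)\<^sup>2))
        \<le> norm h * ((2 / v\<^sup>2) * (LINT t|lborel. norm (K t)))) (at 0)"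
      unfolding eventually_at
    proof (intro exI[of _ "v / 2"] conjI ballI impI)
      fix h :: complex assume "h \<noteq> 0 \<and> dist h 0 < v / 2"
      then have h: "h \<noteq> 0" "norm h < v / 2" by auto
      have zh: "Im (z + h) > 0" using abs_Im_le_cmod[of h] h(2) v by (simp add: v_def)
      have pw: "(f t / (of_real t - (z + h)) - f t / (of_real t - z)) / h - f t / (of_real t - z)\<^sup>2
          = h * (K t * (1 / ((of_real t - z) * (of_real t - (z + h)))))" for t
      proof -
        define a b where "a = complex_of_real t - z" and "b = complex_of_real t - (z + h)"
        have nz: "a \<noteq> 0" "b \<noteq> 0" using z zh by (auto simp: a_def b_def complex_eq_iff)
        have ab: "h = a - b" by (simp add: a_def b_def)
        have "(f t / b - f t / a) / h - f t / a\<^sup>2 = h * (f t / a * (1 / (a * b)))"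
          using nz h(1) unfolding ab by (simp add: divide_simps power2_eq_square) (simp add: algebra_simps)
        then show ?thesis by (simp add: a_def b_def K_def)
      qed
      have "(?J (z + h) - ?J z) / h - (LINT t|lborel. f t / (of_real t - z)\<^sup>2)
          = (LINT t|lborel. (f t / (of_real t - (z + h)) - f t / (of_real t - z)) / h - f t / (of_real t - z)\<^sup>2)"
        using cauchy_integrable[OF f, of "z + h"] cauchy_integrable[OF f, of z] z zh sq by simp
      also have "\<dots> = (LINT t|lborel. h * (K t * (1 / ((of_real t - z) * (of_real t - (z + h))))))"
        by (simp only: pw)
      finally have eq: "(?J (z + h) - ?J z) / h - (LINT t|lborel. f t / (of_real t - z)\<^sup>2)
          = (LINT t|lborel. h * (K t * (1 / ((of_real t - z) * (of_real t - (z + h))))))" .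
      have "norm (LINT t|lborel. h * (K t * (1 / ((of_real t - z) * (of_real t - (z + h))))))
          \<le> (LINT t|lborel. norm h * ((2 / v\<^sup>2) * norm (K t)))"
      proof (rule order_trans[OF integral_norm_bound integral_mono])
        fix t
        have "norm ((of_real t - z) * (of_real t - (z + h))) \<ge> v * (v / 2)"
          unfolding norm_mult using low[of t] low2[OF h(2), of t] v by (intro mult_mono) auto
        then have "norm (1 / ((of_real t - z) * (of_real t - (z + h)))) \<le> 1 / (v * (v / 2))"
          unfolding norm_divide norm_one by (rule frac_le[rotated 3]) (use v in simp_all)
        also have "\<dots> = 2 / v\<^sup>2" by (simp add: power2_eq_square)
        finally show "norm (h * (K t * (1 / ((of_real t - z) * (of_real t - (z + h)))))) \<le> norm h * ((2 / v\<^sup>2) * norm (K t))"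
          unfolding norm_mult by (subst mult.commute[of "2 / v\<^sup>2"]) (intro mult_left_mono, auto)
      next
        show "integrable lborel (\<lambda>t. norm h * ((2 / v\<^sup>2) * norm (K t)))" using K by simp
        have "integrable lborel (\<lambda>t. (f t / (of_real t - (z + h)) - f t / (of_real t - z)) / h - f t / (of_real t - z)\<^sup>2)"
          using cauchy_integrable[OF f, of "z + h"] cauchy_integrable[OF f, of z] z zh sq by simp
        then have "integrable lborel (\<lambda>t. h * (K t * (1 / ((of_real t - z) * (of_real t - (z + h))))))"
          by (simp only: pw)
        then show "integrable lborel (\<lambda>t. norm (h * (K t * (1 / ((of_real t - z) * (of_real t - (z + h)))))))"
          by (rule integrable_norm)
      qed
      also have "\<dots> = norm h * ((2 / v\<^sup>2) * (LINT t|lborel. norm (K t)))" by simp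
      finally show "norm ((?J (z + h) - ?J z) / h - (LINT t|lborel. f t / (of_real t - z)\<^sup>2))
        \<le> norm h * ((2 / v\<^sup>2) * (LINT t|lborel. norm (K t)))" unfolding eq .
    qed (use v in auto)
    have "((\<lambda>h::complex. norm h * ((2 / v\<^sup>2) * (LINT t|lborel. norm (K t)))) \<longlongrightarrow> norm (0::complex) * ((2 / v\<^sup>2) * (LINT t|lborel. norm (K t)))) (at 0)"
      by (intro tendsto_intros)
    then show "((\<lambda>h::complex. norm h * ((2 / v\<^sup>2) * (LINT t|lborel. norm (K t)))) \<longlongrightarrow> 0) (at 0)" by simp
  qed
  from DERIV_cdivide[OF this] show ?thesis unfolding cauchy_integral_def[abs_def] .
qed

lemma cauchy_integral_holomorphic:
  "f \<in> L2 \<Longrightarrow> cauchy_integral f holomorphic_on {z. Im z > 0}"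
  using cauchy_integral_has_derivative
  by (auto simp: holomorphic_on_def field_differentiable_def intro: has_field_derivative_at_within)

text \<open>If the Cauchy integral vanishes below, the jump formula identifies it above with the
  Poisson integral of \<open>f\<close>. That has bounded norms and tends to \<open>f\<close>, so the
  Cauchy integral itself is the required Hardy function.\<close>

lemma H2_I:
  assumes f: "f \<in> L2" and zero: "\<And>w. Im w < 0 \<Longrightarrow> (LINT t|lborel. f t / (of_real t - w)) = 0"
  shows "f \<in> H2"
proof -
  have eq: "(\<lambda>x. cauchy_integral f (Complex x y)) = poisson_integral_fun y f" if "y > 0" for y
    using cauchy_integral_jump[OF that f] zero[of "Complex _ (- y)"] that
    by (auto simp: cauchy_integral_def fun_eq_iff)
  have "L2_norm_sq (\<lambda>x. cauchy_integral f (Complex x y)) \<le> ennreal ((L2_norm f)\<^sup>2)" if y: "y > 0" for y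
    unfolding eq[OF y] L2_norm_sq_eq[OF poisson_integral_fun_L2(1)[OF y f]]
    by (intro ennreal_leI power_mono poisson_integral_fun_L2 y f) simp
  then have F: "cauchy_integral f \<in> hardy_upper"
    using cauchy_integral_holomorphic[OF f] by (auto simp: hardy_upper_def)
  have ev: "eventually (\<lambda>y. (\<lambda>x. poisson_integral_fun y f x - f x) \<in> L2) (at_right 0)"
    unfolding eventually_at_filter by (intro always_eventually) (auto intro!: poisson_integral_fun_L2 f)
  have "((\<lambda>y. L2_norm_sq (\<lambda>x. poisson_integral_fun y f x - f x)) \<longlongrightarrow> 0) (at_right 0)"
    using poisson_integral_fun_tendsto[OF f] L2_norm_sq_tendsto_0_iff[OF ev] by simp
  moreover have "eventually (\<lambda>y. L2_norm_sq (\<lambda>x. poisson_integral_fun y f x - f x) =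
      L2_norm_sq (\<lambda>x. cauchy_integral f (Complex x y) - f x)) (at_right 0)"
    unfolding eventually_at_filter by (intro always_eventually) (auto simp: eq[symmetric])
  ultimately have "((\<lambda>y. L2_norm_sq (\<lambda>x. cauchy_integral f (Complex x y) - f x)) \<longlongrightarrow> 0) (at_right 0)"
    by (rule Lim_transform_eventually)
  then show ?thesis using f F by (auto simp: H2_def)
qed

section \<open>Cauchy's theorem for Hardy functions on horizontal lines\<close>

lemma hardy_upper_line:
  assumes F: "F holomorphic_on {z. Im z > 0}" and C: "0 \<le> C"
    "\<And>y. y > 0 \<Longrightarrow> L2_norm_sq (\<lambda>x. F (Complex x y)) \<le> ennreal C" and y: "y > 0"
  shows "(\<lambda>x. F (Complex x y)) \<in> L2" "L2_norm (\<lambda>x. F (Complex x y)) \<le> sqrt C"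
proof -
  have "continuous_on UNIV (\<lambda>x. F (Complex x y))"
    unfolding Complex_eq
    by (rule continuous_on_compose2[OF holomorphic_on_imp_continuous_on[OF F]])
       (use y in \<open>auto intro!: continuous_intros\<close>)
  then have m: "(\<lambda>x. F (Complex x y)) \<in> borel_measurable borel" by (rule borel_measurable_continuous_onI)
  have "L2_norm_sq (\<lambda>x. F (Complex x y)) \<le> ennreal ((sqrt C)\<^sup>2)" using C y by simp
  from L2_I_bound[OF m this] C(1)
  show "(\<lambda>x. F (Complex x y)) \<in> L2" "L2_norm (\<lambda>x. F (Complex x y)) \<le> sqrt C" by auto
qed

lemma hardy_strip_measurable:
  assumes F: "F holomorphic_on {z. Im z > 0}" and e: "0 < e"
  shows "(\<lambda>(x, y). indicator {e..Y} y *\<^sub>R F (Complex x y)) \<in> borel_measurable (borel \<Otimes>\<^sub>M borel)"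
proof -
  have "continuous_on (UNIV \<times> {e..Y}) (\<lambda>p. F (Complex (fst p) (snd p)))"
    unfolding Complex_eq
    by (rule continuous_on_compose2[OF holomorphic_on_imp_continuous_on[OF F]])
       (use e in \<open>auto intro!: continuous_intros\<close>)
  moreover have "(UNIV \<times> {e..Y} :: (real \<times> real) set) \<in> sets borel"
    by (intro borel_closed closed_Times) auto
  ultimately have "(\<lambda>p. indicator (UNIV \<times> {e..Y}) p *\<^sub>R F (Complex (fst p) (snd p))) \<in> borel_measurable borel"
    by (intro borel_measurable_continuous_on_indicator)
  moreover have "(\<lambda>p. indicator (UNIV \<times> {e..Y}) p *\<^sub>R F (Complex (fst p) (snd p)))
      = (\<lambda>(x, y). indicator {e..Y} y *\<^sub>R F (Complex x y))"
    by (auto simp: fun_eq_iff indicator_def)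
  ultimately show ?thesis by (simp add: borel_prod)
qed

text \<open>Tonelli: the mean squares over vertical segments are integrable functions of the abscissa.\<close>

lemma hardy_vertical_segments:
  assumes F: "F holomorphic_on {z. Im z > 0}" and C: "0 \<le> C"
    "\<And>y. y > 0 \<Longrightarrow> L2_norm_sq (\<lambda>x. F (Complex x y)) \<le> ennreal C" and e: "0 < e"
  obtains R where "R \<ge> N"
    "(\<integral>\<^sup>+y. ennreal ((norm (indicator {e..Y} y *\<^sub>R F (Complex R y)))\<^sup>2) \<partial>lborel) \<le> 1"
    "(\<integral>\<^sup>+y. ennreal ((norm (indicator {e..Y} y *\<^sub>R F (Complex (- R) y)))\<^sup>2) \<partial>lborel) \<le> 1"
proof -
  let ?H = "\<lambda>x y. indicator {e..Y} y *\<^sub>R F (Complex x y)"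
  note hardy_strip_measurable[OF F e, measurable]
  define u where "u x = (\<integral>\<^sup>+y. ennreal ((norm (?H x y))\<^sup>2) \<partial>lborel)" for x
  have um [measurable]: "u \<in> borel_measurable borel" unfolding u_def by measurable
  have "(\<integral>\<^sup>+x. u x \<partial>lborel) = (\<integral>\<^sup>+y. \<integral>\<^sup>+x. ennreal ((norm (?H x y))\<^sup>2) \<partial>lborel \<partial>lborel)"
    unfolding u_def by (rule lborel_pair.Fubini'[symmetric]) measurable
  also have "\<dots> \<le> (\<integral>\<^sup>+y. ennreal C * indicator {e..Y} y \<partial>lborel)"
  proof (rule nn_integral_mono)
    fix y
    show "(\<integral>\<^sup>+x. ennreal ((norm (?H x y))\<^sup>2) \<partial>lborel) \<le> ennreal C * indicator {e..Y} y"
      using C(2)[of y] e by (auto simp: indicator_def L2_norm_sq_def)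
  qed
  also have "\<dots> < \<infinity>"
    by (simp add: nn_integral_cmult_indicator emeasure_lborel_Icc_eq ennreal_mult_less_top)
  finally have fin: "(\<integral>\<^sup>+x. u x \<partial>lborel) < \<infinity>" .
  have "(\<integral>\<^sup>+x. u (- x) \<partial>lborel) = (\<integral>\<^sup>+x. u x \<partial>lborel)"
    using nn_integral_real_affine[of u "-1" 0] by simp
  \<comment> \<open>Adding the reflected function lets one \<open>R\<close> serve both vertical
    sides.\<close>
  then have fin2: "(\<integral>\<^sup>+x. u x + u (- x) \<partial>lborel) < \<infinity>"
    using fin by (subst nn_integral_add) (auto simp: less_top)
  have "\<exists>R\<ge>N. u R + u (- R) \<le> 1"
  proof (rule ccontr)
    assume "\<not> (\<exists>R\<ge>N. u R + u (- R) \<le> 1)"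
    then have "1 \<le> u x + u (- x)" if "N \<le> x" for x using that by (meson linear)
    note ge = this
    obtain K where K: "0 \<le> K" "(\<integral>\<^sup>+x. u x + u (- x) \<partial>lborel) = ennreal K"
      using fin2 by (cases "\<integral>\<^sup>+x. u x + u (- x) \<partial>lborel") auto
    \<comment> \<open>If the sum stayed at least 1 beyond \<open>N\<close>, an interval of length
      \<open>K + 1\<close> alone would contribute more than the whole integral
      \<open>K\<close>.\<close>
    have "ennreal (K + 1) = (\<integral>\<^sup>+x. indicator {N..N + (K + 1)} x \<partial>lborel)"
      using K(1) by simp
    also have "\<dots> \<le> ennreal K"
      unfolding K(2)[symmetric] using ge by (intro nn_integral_mono) (auto simp: indicator_def)
    finally show False using K(1) by simp
  qed
  then obtain R where R: "R \<ge> N" "u R + u (- R) \<le> 1" by blast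
  have "u R \<le> 1" "u (- R) \<le> 1" by (rule order_trans[OF _ R(2)], simp)+
  then show ?thesis using that[OF R(1)] unfolding u_def by blast
qed

text \<open>On rectangles with suitably chosen vertical sides these sides contribute nothing in the
  limit, so the integral does not depend on the height of the line. At great height it is small by
  Cauchy-Schwarz: the norm of \<open>F\<close> on lines stays bounded, while that of the kernel
  tends to 0.\<close>

lemma hardy_line_integral_eq_0:
  assumes F: "F \<in> hardy_upper" and e: "0 < e" and w: "Im w < 0"
  shows "(LINT x|lborel. F (Complex x e) / (of_real x - w)) = 0"
proof -
  have hol: "F holomorphic_on {z. Im z > 0}" using F by (simp add: hardy_upper_def)
  obtain C0 where C0: "\<And>y. y > 0 \<Longrightarrow> L2_norm_sq (\<lambda>x. F (Complex x y)) \<le> ennreal C0"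
    using F by (auto simp: hardy_upper_def)
  \<comment> \<open>The bound in \<open>hardy_upper\<close> may be a negative real, which
    \<open>ennreal\<close> sends to 0; its maximum with 0 can be used under a square root.\<close>
  define C where "C = max C0 0"
  have C: "0 \<le> C" "\<And>y. y > 0 \<Longrightarrow> L2_norm_sq (\<lambda>x. F (Complex x y)) \<le> ennreal C"
    by (auto simp: C_def intro!: order_trans[OF C0] ennreal_leI)
  note line = hardy_upper_line[OF hol C]
  \<comment> \<open>With this shift, z - v equals x - w on the line z = x + i e, and the pole
    \<open>v\<close> lies below that line.\<close>
  define v where "v = w + \<i> * of_real e"
  have v: "Im v < e" using w by (simp add: v_def)
  \<comment> \<open>A half plane above both the real line and the pole. It is convex, so
    \<open>G\<close> has a primitive \<open>Q\<close> there, and the contour integral reduces to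
    differences of \<open>Q\<close> at the corners.\<close>
  define S where "S = {z. Im z > max 0 (Im v)}"
  define G where "G z = F z / (z - v)" for z
  have "S = {z. Im z > 0} \<inter> {z. Im z > Im v}" by (auto simp: S_def)
  then have S: "open S" "convex S"
    by (auto intro!: open_Int convex_Int open_halfspace_Im_gt convex_halfspace_Im_gt)
  have G: "G holomorphic_on S"
    unfolding G_def by (intro holomorphic_intros holomorphic_on_subset[OF hol]) (auto simp: S_def)
  obtain Q where Q: "\<And>z. z \<in> S \<Longrightarrow> (Q has_field_derivative G z) (at z)"
    using holomorphic_convex_primitive'[OF S(2,1) G] S(1) by (metis at_within_open)
  define I where "I y = (LINT x|lborel. G (Complex x y))" for y
  have Gline: "G (Complex x y) = F (Complex x y) * (1 / (of_real x - (v - \<i> * of_real y)))" for x y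
    by (simp add: G_def Complex_eq algebra_simps)
  have Gint: "integrable lborel (\<lambda>x. G (Complex x y))" if "e \<le> y" for y
    unfolding Gline using e v that by (intro L2_integrable_mult line cauchy_kernel_L2) auto
  have Ibound: "norm (I y) \<le> sqrt C * sqrt (pi / (y - Im v))" if "e \<le> y" for y
  proof -
    have "norm (I y) \<le> L2_norm (\<lambda>x. F (Complex x y)) * L2_norm (\<lambda>x. 1 / (of_real x - (v - \<i> * of_real y)))"
      unfolding I_def Gline using e v that by (intro L2_Cauchy_Schwarz line cauchy_kernel_L2) auto
    also have "L2_norm (\<lambda>x. 1 / (of_real x - (v - \<i> * of_real y))) = sqrt (pi / (y - Im v))"
      using v that by (subst cauchy_kernel_L2_norm) auto
    also have "L2_norm (\<lambda>x. F (Complex x y)) * sqrt (pi / (y - Im v)) \<le> sqrt C * sqrt (pi / (y - Im v))"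
      using e v that by (intro mult_right_mono line) auto
    finally show ?thesis .
  qed
  have horizontal: "(LINT x|lborel. indicator {- R..R} x *\<^sub>R G (Complex x y)) = Q (Complex R y) - Q (Complex (- R) y)"
    if y: "e \<le> y" and R: "0 \<le> R" for R y
  proof (rule integral_FTC_atLeastAtMost)
    fix x
    have mem: "Complex x y \<in> S" for x using y e v by (simp add: S_def)
    have "((\<lambda>x. Complex x y) has_vector_derivative 1) (at x within {- R..R})"
      unfolding Complex_eq by (auto intro!: derivative_eq_intros)
    from field_vector_diff_chain_within[OF this DERIV_subset[OF Q[OF mem]]]
    show "((\<lambda>x. Q (Complex x y)) has_vector_derivative G (Complex x y)) (at x within {- R..R})"
      by (simp add: o_def)
  next
    show "continuous_on {- R..R} (\<lambda>x. G (Complex x y))" unfolding Complex_eq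
      by (rule continuous_on_compose2[OF holomorphic_on_imp_continuous_on[OF G]])
         (use y e v in \<open>auto intro!: continuous_intros simp: S_def\<close>)
  qed (use R in simp)
  \<comment> \<open>The square integral of \<open>F\<close> on the segment is at most 1, and
    \<open>|F| \<le> |F|^2 + 1\<close> turns this into a bound for the integral of
    \<open>|F|\<close>; the denominator is at least \<open>|R| - |Re v|\<close>.\<close>
  have vertical: "norm (Q (Complex R Y) - Q (Complex R e)) \<le> (1 + (Y - e)) / (\<bar>R\<bar> - \<bar>Re v\<bar>)"
    if Y: "e \<le> Y" and R: "\<bar>Re v\<bar> < \<bar>R\<bar>"
      "(\<integral>\<^sup>+y. ennreal ((norm (indicator {e..Y} y *\<^sub>R F (Complex R y)))\<^sup>2) \<partial>lborel) \<le> 1" for R Y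
  proof -
    have mem: "Complex R y \<in> S" if "e \<le> y" for y using that e v by (simp add: S_def)
    have Fc: "continuous_on {e..Y} (\<lambda>y. F (Complex R y))" unfolding Complex_eq
      by (rule continuous_on_compose2[OF holomorphic_on_imp_continuous_on[OF hol]])
         (use e in \<open>auto intro!: continuous_intros\<close>)
    have Gc: "continuous_on {e..Y} (\<lambda>y. \<i> * G (Complex R y))" unfolding Complex_eq
      by (intro continuous_on_mult continuous_on_const continuous_on_compose2[OF holomorphic_on_imp_continuous_on[OF G]])
         (use e v in \<open>auto intro!: continuous_intros simp: S_def\<close>)
    let ?H = "\<lambda>y. indicator {e..Y} y *\<^sub>R F (Complex R y)"
    have Hm [measurable]: "?H \<in> borel_measurable borel"
      by (rule borel_measurable_continuous_on_indicator[OF _ Fc]) simp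
    have Hi: "integrable lborel (\<lambda>y. (norm (?H y))\<^sup>2)"
    proof (rule integrableI_bounded)
      show "(\<lambda>y. (norm (?H y))\<^sup>2) \<in> borel_measurable lborel"
        unfolding measurable_lborel2 by (rule borel_measurable_power[OF measurable_compose[OF Hm borel_measurable_norm]])
      show "(\<integral>\<^sup>+y. ennreal (norm ((norm (?H y))\<^sup>2)) \<partial>lborel) < \<infinity>"
        unfolding real_norm_def abs_power2 by (rule le_less_trans[OF R(2)]) simp
    qed
    have H1: "(LINT y|lborel. (norm (?H y))\<^sup>2) \<le> 1"
      using R(2) nn_integral_eq_integral[OF Hi] by simp
    have "(LINT y|lborel. indicator {e..Y} y *\<^sub>R (\<i> * G (Complex R y))) = Q (Complex R Y) - Q (Complex R e)"
    proof (rule integral_FTC_atLeastAtMost[OF Y _ Gc])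
      fix y assume y: "e \<le> y"
      have "((\<lambda>y. Complex R y) has_vector_derivative \<i>) (at y within {e..Y})"
        unfolding Complex_eq by (auto intro!: derivative_eq_intros)
      from field_vector_diff_chain_within[OF this DERIV_subset[OF Q[OF mem[OF y]]]]
      show "((\<lambda>y. Q (Complex R y)) has_vector_derivative \<i> * G (Complex R y)) (at y within {e..Y})"
        by (simp add: o_def)
    qed
    then have "norm (Q (Complex R Y) - Q (Complex R e)) = norm (LINT y|lborel. indicator {e..Y} y *\<^sub>R (\<i> * G (Complex R y)))"
      by simp
    also have "\<dots> \<le> (LINT y|lborel. ((norm (?H y))\<^sup>2 + indicator {e..Y} y) / (\<bar>R\<bar> - \<bar>Re v\<bar>))"
    proof (rule order_trans[OF integral_norm_bound integral_mono])
      show "integrable lborel (\<lambda>y. norm (indicator {e..Y} y *\<^sub>R (\<i> * G (Complex R y))))"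
        using borel_integrable_atLeastAtMost'[OF Gc] by (intro integrable_norm) (simp add: set_integrable_def)
      show "integrable lborel (\<lambda>y. ((norm (?H y))\<^sup>2 + indicator {e..Y} y) / (\<bar>R\<bar> - \<bar>Re v\<bar>))"
        using Hi by (intro integrable_divide Bochner_Integration.integrable_add) (auto simp: emeasure_lborel_Icc_eq)
      fix y
      have "\<bar>R\<bar> - \<bar>Re v\<bar> \<le> \<bar>R - Re v\<bar>" by linarith
      also have "\<dots> \<le> norm (Complex R y - v)" using abs_Re_le_cmod[of "Complex R y - v"] by simp
      finally have den: "\<bar>R\<bar> - \<bar>Re v\<bar> \<le> norm (Complex R y - v)" .
      have "norm (F (Complex R y)) \<le> (norm (F (Complex R y)))\<^sup>2 + 1"
        using zero_le_power2[of "norm (F (Complex R y)) - 1/2"] by (simp add: power2_eq_square algebra_simps)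
      then have "norm (F (Complex R y)) / norm (Complex R y - v) \<le> ((norm (F (Complex R y)))\<^sup>2 + 1) / (\<bar>R\<bar> - \<bar>Re v\<bar>)"
        using den R(1) by (intro frac_le) auto
      then show "norm (indicator {e..Y} y *\<^sub>R (\<i> * G (Complex R y))) \<le> ((norm (?H y))\<^sup>2 + indicator {e..Y} y) / (\<bar>R\<bar> - \<bar>Re v\<bar>)"
        by (auto simp: indicator_def G_def norm_mult norm_divide)
    qed
    also have "\<dots> = ((LINT y|lborel. (norm (?H y))\<^sup>2) + (Y - e)) / (\<bar>R\<bar> - \<bar>Re v\<bar>)"
      using Hi Y by (simp add: emeasure_lborel_Icc_eq)
    also have "\<dots> \<le> (1 + (Y - e)) / (\<bar>R\<bar> - \<bar>Re v\<bar>)"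
      using H1 R(1) by (intro divide_right_mono) auto
    finally show ?thesis .
  qed
  have eq: "I e = I Y" if Y: "e \<le> Y" for Y
  proof -
    let ?seg = "\<lambda>R. (\<integral>\<^sup>+y. ennreal ((norm (indicator {e..Y} y *\<^sub>R F (Complex R y)))\<^sup>2) \<partial>lborel) \<le> 1"
    \<comment> \<open>The offset \<open>|Re v| + 1\<close> makes the denominator of the bound for
      the vertical sides at least \<open>n\<close>.\<close>
    have "\<forall>n. \<exists>R. R \<ge> real n + \<bar>Re v\<bar> + 1 \<and> ?seg R \<and> ?seg (- R)"
    proof
      fix n
      obtain R where "R \<ge> real n + \<bar>Re v\<bar> + 1" "?seg R" "?seg (- R)"
        by (rule hardy_vertical_segments[OF hol C e, of "real n + \<bar>Re v\<bar> + 1" Y])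
      then show "\<exists>R. R \<ge> real n + \<bar>Re v\<bar> + 1 \<and> ?seg R \<and> ?seg (- R)" by blast
    qed
    from choice[OF this] obtain R where R': "\<forall>n. R n \<ge> real n + \<bar>Re v\<bar> + 1 \<and> ?seg (R n) \<and> ?seg (- R n)"
      by blast
    have R: "R n \<ge> real n + \<bar>Re v\<bar> + 1" "?seg (R n)" "?seg (- R n)" for n
      using R'[THEN spec, of n] by blast+
    have R0: "R n \<ge> 0" "\<bar>R n\<bar> = R n" "\<bar>Re v\<bar> < R n" "real n \<le> R n - \<bar>Re v\<bar>" "real n \<le> R n" for n
      using R(1)[of n] by (auto simp: add_increasing)
    have trunc: "(\<lambda>n. LINT x|lborel. indicator {- R n..R n} x *\<^sub>R G (Complex x y)) \<longlonglongrightarrow> I y" if y: "e \<le> y" for y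
      unfolding I_def
    proof (rule integral_dominated_convergence[where w="\<lambda>x. norm (G (Complex x y))"])
      show "AE x in lborel. (\<lambda>n. indicator {- R n..R n} x *\<^sub>R G (Complex x y)) \<longlonglongrightarrow> G (Complex x y)"
      proof (intro AE_I2 tendsto_eventually)
        fix x
        obtain N where "\<bar>x\<bar> \<le> real N" using real_arch_simple by blast
        then show "eventually (\<lambda>n. indicator {- R n..R n} x *\<^sub>R G (Complex x y) = G (Complex x y)) sequentially"
          using R0(5) by (intro eventually_sequentiallyI[of N]) (smt (verit) atLeastAtMost_iff indicator_simps(1) of_nat_mono scaleR_one)
      qed
    qed (use Gint[OF y] in \<open>auto simp: indicator_def\<close>)
    have "(\<lambda>n. (LINT x|lborel. indicator {- R n..R n} x *\<^sub>R G (Complex x Y)) - (LINT x|lborel. indicator {- R n..R n} x *\<^sub>R G (Complex x e))) \<longlonglongrightarrow> 0"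
    proof (rule Lim_null_comparison)
      show "eventually (\<lambda>n. norm ((LINT x|lborel. indicator {- R n..R n} x *\<^sub>R G (Complex x Y)) -
          (LINT x|lborel. indicator {- R n..R n} x *\<^sub>R G (Complex x e))) \<le> 2 * (1 + (Y - e)) / real n) sequentially"
      proof (intro eventually_sequentiallyI[of 1])
        fix n :: nat assume n: "1 \<le> n"
        have le: "(1 + (Y - e)) / (R n - \<bar>Re v\<bar>) \<le> (1 + (Y - e)) / real n"
          using R0[of n] n Y by (intro divide_left_mono mult_pos_pos) auto
        have "norm (Q (Complex (R n) Y) - Q (Complex (R n) e)) \<le> (1 + (Y - e)) / real n"
          using vertical[OF Y _ R(2)[of n]] R0[of n] le by simp
        moreover have "norm (Q (Complex (- R n) Y) - Q (Complex (- R n) e)) \<le> (1 + (Y - e)) / real n"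
          using vertical[OF Y _ R(3)[of n]] R0[of n] le by simp
        ultimately have "norm ((Q (Complex (R n) Y) - Q (Complex (R n) e)) - (Q (Complex (- R n) Y) - Q (Complex (- R n) e)))
          \<le> (1 + (Y - e)) / real n + (1 + (Y - e)) / real n"
          using norm_triangle_ineq4[of "Q (Complex (R n) Y) - Q (Complex (R n) e)" "Q (Complex (- R n) Y) - Q (Complex (- R n) e)"]
          by linarith
        also have "\<dots> = 2 * (1 + (Y - e)) / real n" by simp
        \<comment> \<open>The four corner values are regrouped: vertical differences are small,
          horizontal ones are the truncated integrals.\<close>
        also have "(Q (Complex (R n) Y) - Q (Complex (R n) e)) - (Q (Complex (- R n) Y) - Q (Complex (- R n) e))
          = (Q (Complex (R n) Y) - Q (Complex (- R n) Y)) - (Q (Complex (R n) e) - Q (Complex (- R n) e))" by simp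
        finally show "norm ((LINT x|lborel. indicator {- R n..R n} x *\<^sub>R G (Complex x Y)) -
          (LINT x|lborel. indicator {- R n..R n} x *\<^sub>R G (Complex x e))) \<le> 2 * (1 + (Y - e)) / real n"
          unfolding horizontal[OF Y R0(1)[of n]] horizontal[OF order_refl R0(1)[of n]] .
      qed
      show "(\<lambda>n. 2 * (1 + (Y - e)) / real n) \<longlonglongrightarrow> 0" by (rule lim_const_over_n)
    qed
    moreover have "(\<lambda>n. (LINT x|lborel. indicator {- R n..R n} x *\<^sub>R G (Complex x Y)) - (LINT x|lborel. indicator {- R n..R n} x *\<^sub>R G (Complex x e))) \<longlonglongrightarrow> I Y - I e"
      by (intro tendsto_diff trunc Y order_refl)
    ultimately show ?thesis using LIMSEQ_unique by fastforce
  qed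
  have "((\<lambda>Y. sqrt C * sqrt (pi / (Y - Im v))) \<longlongrightarrow> sqrt C * sqrt 0) at_top"
    by (intro tendsto_intros tendsto_divide_0[OF tendsto_const] filterlim_at_top_imp_at_infinity
          filterlim_tendsto_add_at_top[OF tendsto_const filterlim_ident, of "- Im v", simplified])
  then have "((\<lambda>Y. sqrt C * sqrt (pi / (Y - Im v))) \<longlongrightarrow> 0) at_top" by simp
  moreover have "eventually (\<lambda>Y. norm (I e) \<le> sqrt C * sqrt (pi / (Y - Im v))) at_top"
    using eventually_ge_at_top[of e] by eventually_elim (use eq Ibound in auto)
  ultimately have "norm (I e) \<le> 0" by (intro tendsto_lowerbound) auto
  moreover have "I e = (LINT x|lborel. F (Complex x e) / (of_real x - w))"
    unfolding I_def G_def v_def by (simp add: Complex_eq algebra_simps)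
  ultimately show ?thesis by simp
qed

lemma H2_L2: "f \<in> H2 \<Longrightarrow> f \<in> L2"
  by (simp add: H2_def)

text \<open>The identity holds on the lines at height \<open>1 / (n + 1)\<close> by Cauchy's
  theorem, and it survives the limit because the traces converge in norm while the kernel is a fixed
  element of \<open>L2\<close>.\<close>

lemma H2_D:
  assumes f: "f \<in> H2" and w: "Im w < 0"
  shows "(LINT t|lborel. f t / (of_real t - w)) = 0"
proof -
  obtain F where F: "F \<in> hardy_upper"
    and lim: "((\<lambda>y. L2_norm_sq (\<lambda>x. F (Complex x y) - f x)) \<longlongrightarrow> 0) (at_right 0)"
    using f by (auto simp: H2_def)
  have hol: "F holomorphic_on {z. Im z > 0}" using F by (simp add: hardy_upper_def)
  obtain C0 where C0: "\<And>y. y > 0 \<Longrightarrow> L2_norm_sq (\<lambda>x. F (Complex x y)) \<le> ennreal C0"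
    using F by (auto simp: hardy_upper_def)
  have L: "(\<lambda>x. F (Complex x y)) \<in> L2" if "y > 0" for y
    using hardy_upper_line[OF hol, of "max C0 0"] C0 that
    by (meson ennreal_leI max.cobounded1 max.cobounded2 order_trans)
  have fL: "f \<in> L2" by (rule H2_L2[OF f])
  let ?y = "\<lambda>n. inverse (real (Suc n))"
  have "filterlim ?y (at_right 0) sequentially"
    by (auto simp: filterlim_at LIMSEQ_inverse_real_of_nat simp del: of_nat_Suc)
  from filterlim_compose[OF lim this]
  have "(\<lambda>n. L2_norm_sq (\<lambda>x. F (Complex x (?y n)) - f x)) \<longlonglongrightarrow> 0" .
  then have "(\<lambda>n. L2_norm (\<lambda>x. F (Complex x (?y n)) - f x)) \<longlonglongrightarrow> 0"
    by (subst (asm) L2_norm_sq_tendsto_0_iff) (auto intro!: always_eventually L2_diff L fL)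
  from L2_integral_mult_tendsto[OF L fL cauchy_kernel_L2 this, of w]
  have "(\<lambda>n. LINT x|lborel. F (Complex x (?y n)) * (1 / (of_real x - w))) \<longlonglongrightarrow> (LINT x|lborel. f x * (1 / (of_real x - w)))"
    using w by simp
  then have "(\<lambda>n. 0::complex) \<longlonglongrightarrow> (LINT x|lborel. f x / (of_real x - w))"
    using hardy_line_integral_eq_0[OF F _ w] by simp
  then show ?thesis by (simp add: LIMSEQ_const_iff)
qed

text \<open>This form replaces the existence of a Hardy extension by linear conditions, each
  continuous in \<open>f\<close>; that \<open>H2\<close> is a closed subspace can then be read
  off.\<close>

lemma H2_iff: "f \<in> H2 \<longleftrightarrow> f \<in> L2 \<and> (\<forall>w. Im w < 0 \<longrightarrow> (LINT t|lborel. f t / (of_real t - w)) = 0)"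
  using H2_I H2_D H2_L2 by blast

lemma H2_subspace: "L2_subspace H2"
  unfolding L2_subspace_def
proof (intro conjI ballI allI subsetI)
  fix f g assume "f \<in> H2" "g \<in> H2"
  then show "(\<lambda>x. f x + g x) \<in> H2"
    unfolding H2_iff using cauchy_integrable[of f] cauchy_integrable[of g]
    by (auto simp: add_divide_distrib)
next
  fix c f assume "f \<in> H2"
  then show "(\<lambda>x. c * f x) \<in> H2"
    unfolding H2_iff by (auto simp flip: times_divide_eq_right)
qed (auto simp: H2_iff)

lemma H2_closed: "L2_closed H2"
  unfolding L2_closed_def
proof (intro allI impI)
  fix s f assume s: "\<forall>n. s n \<in> H2" and f: "f \<in> L2" and lim: "(\<lambda>n. L2_norm (\<lambda>x. s n x - f x)) \<longlonglongrightarrow> 0"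
  show "f \<in> H2"
  proof (rule H2_I[OF f])
    fix w assume w: "Im w < 0"
    have "(\<lambda>n. LINT x|lborel. s n x * (1 / (of_real x - w))) \<longlonglongrightarrow> (LINT x|lborel. f x * (1 / (of_real x - w)))"
      using s w by (intro L2_integral_mult_tendsto f lim cauchy_kernel_L2) (auto simp: H2_L2)
    then have "(\<lambda>n. 0::complex) \<longlonglongrightarrow> (LINT x|lborel. f x / (of_real x - w))"
      using H2_D s w by simp
    then show "(LINT x|lborel. f x / (of_real x - w)) = 0" by (simp add: LIMSEQ_const_iff)
  qed
qed

text \<open>The pole lies below, so the kernel extends holomorphically to the upper half plane.
  These kernels serve as test functions: orthogonality to them says that a Cauchy integral vanishes
  in the upper half plane.\<close>

lemma cauchy_kernel_H2:
  assumes w: "Im w < 0" shows "(\<lambda>x. 1 / (of_real x - w)) \<in> H2"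
proof (rule H2_I)
  show "(\<lambda>x. 1 / (of_real x - w)) \<in> L2" using w by (intro cauchy_kernel_L2) auto
  \<comment> \<open>The integral lemma needs a line at positive height. Raising the pole by half its
    depth keeps it below the real line, and the trace at height \<open>e\<close> is the given
    kernel.\<close>
  define e where "e = - Im w / 2"
  define v where "v = w + \<i> * of_real e"
  define F where "F z = 1 / (z - v)" for z
  have e: "e > 0" and v: "Im v < 0" using w by (auto simp: e_def v_def)
  have "F holomorphic_on {z. Im z > 0}"
    unfolding F_def using v by (intro holomorphic_intros) auto
  moreover have "L2_norm_sq (\<lambda>x. F (Complex x y)) \<le> ennreal (pi / - Im v)" if y: "y > 0" for y
  proof -
    have eq: "(\<lambda>x. F (Complex x y)) = (\<lambda>x. 1 / (of_real x - (v - \<i> * of_real y)))"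
      by (simp add: F_def Complex_eq algebra_simps)
    have nz: "Im (v - \<i> * of_real y) \<noteq> 0" using y v by simp
    have "L2_norm_sq (\<lambda>x. F (Complex x y)) = ennreal (pi / (y - Im v))"
      unfolding eq L2_norm_sq_eq[OF cauchy_kernel_L2[OF nz]] cauchy_kernel_L2_norm[OF nz] using y v by simp
    also have "\<dots> \<le> ennreal (pi / - Im v)"
      using y v by (intro ennreal_leI divide_left_mono mult_pos_pos) auto
    finally show ?thesis .
  qed
  ultimately have F: "F \<in> hardy_upper" by (auto simp: hardy_upper_def)
  fix u assume u: "Im u < 0"
  have "F (Complex x e) = 1 / (of_real x - w)" for x by (simp add: F_def v_def Complex_eq)
  then show "(LINT t|lborel. 1 / (of_real t - w) / (of_real t - u)) = 0"
    using hardy_line_integral_eq_0[OF F e u] by simp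
qed

section \<open>The Plancherel inequality\<close>

lemma
  assumes c: "Re c > 0"
  shows integrable_exp_halfline: "integrable lborel (\<lambda>x. indicator {0..} x *\<^sub>R exp (- (c * of_real x)))"
    and integral_exp_halfline: "(LINT x|lborel. indicator {0..} x *\<^sub>R exp (- (c * of_real x))) = 1 / c"
proof -
  have norm: "norm (indicator {0..} x *\<^sub>R exp (- (c * of_real x))) = exp (- (Re c * x)) * indicator {0..} x" for x
    by (simp add: indicator_def)
  have "(\<integral>\<^sup>+x. ennreal (exp (- (Re c * x))) * indicator {0..} x \<partial>lborel) = ennreal (0 - (- exp (- (Re c * 0)) / Re c))"
  proof (rule nn_integral_FTC_atLeast)
    show "((\<lambda>x. - exp (- (Re c * x)) / Re c) \<longlongrightarrow> 0) at_top"
      using c by real_asymp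
  qed (use c in \<open>auto intro!: derivative_eq_intros\<close>)
  then have fin: "(\<integral>\<^sup>+x. ennreal (exp (- (Re c * x))) * indicator {0..} x \<partial>lborel) < \<infinity>" by simp
  have [measurable]: "(\<lambda>x. exp (- (c * complex_of_real x))) \<in> borel_measurable borel"
    by (intro borel_measurable_continuous_onI continuous_intros)
  show int: "integrable lborel (\<lambda>x. indicator {0..} x *\<^sub>R exp (- (c * of_real x)))"
    using fin unfolding integrable_iff_bounded norm by (auto simp: ennreal_mult ennreal_indicator)
  have lim: "(\<lambda>n. LINT x|lborel. indicator {0..real n} x *\<^sub>R exp (- (c * of_real x)))
      \<longlonglongrightarrow> (LINT x|lborel. indicator {0..} x *\<^sub>R exp (- (c * of_real x)))"
  proof (rule integral_dominated_convergence[where w="\<lambda>x. norm (indicator {0..} x *\<^sub>R exp (- (c * of_real x)))"])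
    show "AE x in lborel. (\<lambda>n. indicator {0..real n} x *\<^sub>R exp (- (c * of_real x))) \<longlonglongrightarrow> indicator {0..} x *\<^sub>R exp (- (c * of_real x))"
    proof (intro AE_I2 tendsto_eventually)
      fix x :: real
      obtain N where "x \<le> real N" using real_arch_simple by blast
      then show "eventually (\<lambda>n. indicator {0..real n} x *\<^sub>R exp (- (c * of_real x)) = indicator {0..} x *\<^sub>R exp (- (c * of_real x))) sequentially"
        by (intro eventually_sequentiallyI[of N]) (auto simp: indicator_def)
    qed
  qed (use int in \<open>auto simp: indicator_def intro: integrable_norm simp del: norm_scaleR\<close>)
  have eq: "(LINT x|lborel. indicator {0..real n} x *\<^sub>R exp (- (c * of_real x))) = (1 - exp (- (c * of_real (real n)))) / c" for n
  proof -
    have "(LINT x|lborel. indicator {0..real n} x *\<^sub>R exp (- (c * of_real x)))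
        = - exp (- (c * of_real (real n))) / c - (- exp (- (c * of_real 0)) / c)"
    proof (rule integral_FTC_atLeastAtMost)
      fix x
      have "((\<lambda>z. - exp (- (c * z)) / c) has_field_derivative exp (- (c * of_real x))) (at (of_real x))"
        using c by (auto intro!: derivative_eq_intros)
      from has_vector_derivative_real_field[OF this]
      show "((\<lambda>x. - exp (- (c * of_real x)) / c) has_vector_derivative exp (- (c * of_real x))) (at x within {0..real n})" .
    qed (auto intro!: continuous_intros)
    then show ?thesis by (simp add: diff_divide_distrib)
  qed
  have "(\<lambda>n. (1 - exp (- (c * of_real (real n)))) / c) \<longlonglongrightarrow> (1 - 0) / c"
  proof (intro tendsto_intros)
    show "(\<lambda>n. exp (- (c * of_real (real n)))) \<longlonglongrightarrow> 0"
    proof (rule tendsto_norm_zero_cancel)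
      have "(\<lambda>n. exp (- (Re c * real n))) \<longlonglongrightarrow> 0" using c by real_asymp
      then show "(\<lambda>n. norm (exp (- (c * of_real (real n))))) \<longlonglongrightarrow> 0" by simp
    qed
  qed (use c in auto)
  from LIMSEQ_unique[OF lim[unfolded eq] this]
  show "(LINT x|lborel. indicator {0..} x *\<^sub>R exp (- (c * of_real x))) = 1 / c" by simp
qed

text \<open>Splitting at 0 gives two half-line integrals with exponents c = e - i u and its
  conjugate, whose values add up to 2 e / (u^2 + e^2). The Poisson kernel thereby enters the Fourier
  estimate.\<close>

lemma
  assumes e: "e > 0"
  shows laplace_integrable: "integrable lborel (\<lambda>x. exp (\<i> * of_real (u * x)) * of_real (exp (- (e * \<bar>x\<bar>))))"
    and laplace_fourier: "(LINT x|lborel. exp (\<i> * of_real (u * x)) * of_real (exp (- (e * \<bar>x\<bar>)))) = of_real (2 * pi * poisson e u)"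
proof -
  let ?h = "\<lambda>c x. indicator {0..} x *\<^sub>R exp (- (c * complex_of_real x))"
  let ?f = "\<lambda>x. exp (\<i> * of_real (u * x)) * of_real (exp (- (e * \<bar>x\<bar>)))"
  define c where "c = Complex e (- u)"
  have c: "Re c > 0" "Re (cnj c) > 0" using e by (auto simp: c_def)
  have [measurable]: "?f \<in> borel_measurable borel"
    by (intro borel_measurable_continuous_onI continuous_intros)
  \<comment> \<open>At 0 both half-line terms equal 1, so that point must be excluded.\<close>
  have eq: "?f x = ?h c x + ?h (cnj c) (- x)" if "x \<noteq> 0" for x
    using that by (cases "x > 0") (auto simp: indicator_def c_def Complex_eq exp_of_real[symmetric] algebra_simps simp flip: exp_add)
  have AE: "AE x in lborel. ?f x = ?h c x + ?h (cnj c) (- x)"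
    using AE_lborel_singleton[of 0] by eventually_elim (rule eq)
  have i1: "integrable lborel (?h c)" by (rule integrable_exp_halfline[OF c(1)])
  have i2: "integrable lborel (\<lambda>x. ?h (cnj c) (- x))"
    using lborel_integrable_real_affine[OF integrable_exp_halfline[OF c(2)], of "-1" 0] by simp
  have m: "(\<lambda>x. ?h c x + ?h (cnj c) (- x)) \<in> borel_measurable lborel"
    using borel_measurable_integrable[OF Bochner_Integration.integrable_add[OF i1 i2]] .
  show "integrable lborel ?f"
    using Bochner_Integration.integrable_add[OF i1 i2] integrable_cong_AE[OF _ m AE] by simp
  have "(LINT x|lborel. ?f x) = (LINT x|lborel. ?h c x + ?h (cnj c) (- x))"
    by (rule integral_cong_AE[OF _ m AE]) simp
  also have "\<dots> = (LINT x|lborel. ?h c x) + (LINT x|lborel. ?h (cnj c) (- x))"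
    by (rule Bochner_Integration.integral_add[OF i1 i2])
  also have "(LINT x|lborel. ?h (cnj c) (- x)) = (LINT x|lborel. ?h (cnj c) x)"
    using lborel_integral_real_affine[of "-1" "?h (cnj c)" 0] by simp
  also have "(LINT x|lborel. ?h c x) + \<dots> = 1 / c + 1 / cnj c"
    by (simp only: integral_exp_halfline c)
  also have "\<dots> = (c + cnj c) / (c * cnj c)"
  proof -
    have "c \<noteq> 0" "cnj c \<noteq> 0" using c by auto
    then show ?thesis by (simp add: divide_simps add.commute)
  qed
  also have "c * cnj c = of_real (u\<^sup>2 + e\<^sup>2)" by (simp add: c_def complex_eq_iff power2_eq_square)
  also have "c + cnj c = of_real (2 * e)" by (simp add: c_def complex_eq_iff)
  also have "of_real (2 * e) / of_real (u\<^sup>2 + e\<^sup>2) = complex_of_real (2 * pi * poisson e u)"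
    unfolding of_real_divide[symmetric] by (simp add: poisson_def)
  finally show "(LINT x|lborel. ?f x) = of_real (2 * pi * poisson e u)" .
qed

lemma lborel_pair_integrable_bound:
  fixes f :: "real \<Rightarrow> real \<Rightarrow> complex" and g h :: "real \<Rightarrow> real"
  assumes f [measurable]: "case_prod f \<in> borel_measurable (lborel \<Otimes>\<^sub>M lborel)"
    and g: "integrable lborel g" and h: "integrable lborel h"
    and le: "\<And>x y. norm (f x y) \<le> g x * h y"
  shows "integrable (lborel \<Otimes>\<^sub>M lborel) (case_prod f)"
proof (rule Bochner_Integration.integrable_bound)
  have [measurable]: "g \<in> borel_measurable borel" "h \<in> borel_measurable borel"
    using g h by auto
  show "integrable (lborel \<Otimes>\<^sub>M lborel) (\<lambda>(x, y). g x * h y)"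
    by (rule lborel_pair.Fubini_integrable) (use g h in \<open>auto simp: abs_mult\<close>)
  show "AE p in lborel \<Otimes>\<^sub>M lborel. norm (case p of (x, y) \<Rightarrow> f x y) \<le> norm (case p of (x, y) \<Rightarrow> g x * h y)"
    using le by (auto intro: order_trans[OF le abs_ge_self])
qed (rule f)

text \<open>With the weight \<open>exp (- e \<bar>x\<bar>)\<close> the square integral of \<open>A\<close> becomes the pairing of \<open>a\<close> with
  \<open>2 \<pi>\<close> times its Poisson integral at height \<open>e\<close>; then \<open>e\<close> tends to 0.\<close>

lemma fourier_L2_bound:
  assumes a: "integrable lborel a" "a \<in> L2"
  defines "A \<equiv> \<lambda>x. LINT k|lborel. a k * exp (\<i> * of_real (k * x))"
  shows "A \<in> L2" "L2_norm A \<le> sqrt (2 * pi) * L2_norm a"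
proof -
  have [measurable]: "a \<in> borel_measurable borel" using a(2) by (simp add: L2_iff)
  have em [measurable]: "(\<lambda>(x, k). exp (\<i> * complex_of_real (k * x))) \<in> borel_measurable (borel \<Otimes>\<^sub>M borel)"
    unfolding borel_prod split_beta' by (intro borel_measurable_continuous_onI continuous_intros)
  have Am [measurable]: "A \<in> borel_measurable borel"
    unfolding A_def by measurable
  define B where "B = (LINT k|lborel. norm (a k))"
  have AB: "norm (A x) \<le> B" for x
    unfolding A_def B_def using a(1) integral_norm_bound[of lborel "\<lambda>k. a k * exp (\<i> * of_real (k * x))"]
    by (simp add: norm_mult)
  \<comment> \<open>Half the weight goes into the function, since the norm squares it. The bound
    \<open>B\<close> for \<open>A\<close> makes the weighted integrals absolutely
    convergent.\<close>
  have key: "(\<lambda>x. of_real (exp (- (e * \<bar>x\<bar>) / 2)) * A x) \<in> L2 \<and>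
      L2_norm (\<lambda>x. of_real (exp (- (e * \<bar>x\<bar>) / 2)) * A x) \<le> sqrt (2 * pi) * L2_norm a" if e: "e > 0" for e
  proof -
    let ?w = "\<lambda>x. exp (- (e * \<bar>x\<bar>))"
    let ?s = "\<lambda>x. complex_of_real (exp (- (e * \<bar>x\<bar>) / 2)) * A x"
    have w: "integrable lborel ?w"
      using integrable_norm[OF laplace_integrable[OF e, of 0]] by simp
    have sq: "(norm (?s x))\<^sup>2 = ?w x * (norm (A x))\<^sup>2" for x
      by (simp add: norm_mult power_mult_distrib exp_double[symmetric])
    have si: "integrable lborel (\<lambda>x. ?w x * (norm (A x))\<^sup>2)"
    proof (rule Bochner_Integration.integrable_bound)
      show "integrable lborel (\<lambda>x. ?w x * B\<^sup>2)" using w by simp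
    qed (use AB in \<open>auto intro!: AE_I2 mult_left_mono power_mono\<close>)
    have sL: "?s \<in> L2" unfolding L2_iff sq using si by simp
    have "complex_of_real ((L2_norm ?s)\<^sup>2) = (LINT x|lborel. of_real (?w x * (norm (A x))\<^sup>2))"
      unfolding L2_norm_power2 sq by (rule integral_complex_of_real[symmetric])
    also have "\<dots> = (LINT x|lborel. LINT k|lborel. a k * exp (\<i> * of_real (k * x)) * (cnj (A x) * of_real (?w x)))"
    proof (rule Bochner_Integration.integral_cong[OF refl])
      fix x
      have "of_real (?w x * (norm (A x))\<^sup>2) = A x * (cnj (A x) * of_real (?w x))"
        by (simp only: of_real_mult complex_norm_square mult_ac)
      also have "\<dots> = (LINT k|lborel. a k * exp (\<i> * of_real (k * x)) * (cnj (A x) * of_real (?w x)))"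
        unfolding A_def by (rule integral_mult_left_zero[symmetric])
      finally show "of_real (?w x * (norm (A x))\<^sup>2) = \<dots>" .
    qed
    also have "\<dots> = (LINT k|lborel. LINT x|lborel. a k * exp (\<i> * of_real (k * x)) * (cnj (A x) * of_real (?w x)))"
    proof (rule lborel_pair.Fubini_integral[symmetric], rule lborel_pair_integrable_bound[where g="\<lambda>x. B * ?w x" and h="\<lambda>k. norm (a k)"])
      show "norm (a k * exp (\<i> * of_real (k * x)) * (cnj (A x) * of_real (?w x))) \<le> B * ?w x * norm (a k)" for x k
        using mult_right_mono[OF AB[of x], of "?w x * norm (a k)"] by (simp add: norm_mult mult_ac)
    qed (use w a(1) in auto)
    \<comment> \<open>Once \<open>cnj (A x)\<close> is expanded, the integral over \<open>x\<close>
      is the Fourier transform of the weight at \<open>k - l\<close>, so a convolution with the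
      Poisson kernel remains.\<close>
    also have "\<dots> = (LINT k|lborel. a k * (of_real (2 * pi) * poisson_integral_fun e (\<lambda>l. cnj (a l)) k))"
    proof (rule Bochner_Integration.integral_cong[OF refl])
      fix k
      have cA: "cnj (A x) = (LINT l|lborel. cnj (a l) * exp (- (\<i> * of_real (l * x))))" for x
        unfolding A_def by (simp add: Bochner_Integration.integral_cnj[symmetric] exp_cnj del: Bochner_Integration.integral_cnj)
      have "(LINT x|lborel. a k * exp (\<i> * of_real (k * x)) * (cnj (A x) * of_real (?w x)))
          = a k * (LINT x|lborel. exp (\<i> * of_real (k * x)) * (cnj (A x) * of_real (?w x)))"
        by (simp only: mult.assoc integral_mult_right_zero)
      also have "(LINT x|lborel. exp (\<i> * of_real (k * x)) * (cnj (A x) * of_real (?w x)))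
          = (LINT x|lborel. LINT l|lborel. cnj (a l) * (exp (\<i> * of_real ((k - l) * x)) * of_real (?w x)))"
      proof (rule Bochner_Integration.integral_cong[OF refl])
        fix x
        have "exp (\<i> * of_real (k * x)) * (cnj (A x) * of_real (?w x))
            = (LINT l|lborel. cnj (a l) * exp (- (\<i> * of_real (l * x)))) * (exp (\<i> * of_real (k * x)) * of_real (?w x))"
          by (simp add: cA)
        also have "\<dots> = (LINT l|lborel. cnj (a l) * exp (- (\<i> * of_real (l * x))) * (exp (\<i> * of_real (k * x)) * of_real (?w x)))"
          by (rule integral_mult_left_zero[symmetric])
        also have "\<dots> = (LINT l|lborel. cnj (a l) * (exp (\<i> * of_real ((k - l) * x)) * of_real (?w x)))"
        proof (rule Bochner_Integration.integral_cong[OF refl])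
          fix l
          have "exp (\<i> * of_real ((k - l) * x)) = exp (- (\<i> * of_real (l * x))) * exp (\<i> * of_real (k * x))"
            by (simp add: algebra_simps flip: exp_add)
          then show "cnj (a l) * exp (- (\<i> * of_real (l * x))) * (exp (\<i> * of_real (k * x)) * of_real (?w x))
              = cnj (a l) * (exp (\<i> * of_real ((k - l) * x)) * of_real (?w x))" by (simp only: mult.assoc)
        qed
        finally show "exp (\<i> * of_real (k * x)) * (cnj (A x) * of_real (?w x)) = \<dots>" .
      qed
      also have "\<dots> = (LINT l|lborel. LINT x|lborel. cnj (a l) * (exp (\<i> * of_real ((k - l) * x)) * of_real (?w x)))"
      proof (rule lborel_pair.Fubini_integral[symmetric], rule lborel_pair_integrable_bound[where g="?w" and h="\<lambda>k. norm (a k)"])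
        have "(\<lambda>(x, l). exp (\<i> * complex_of_real ((k - l) * x)) * of_real (?w x)) \<in> borel_measurable (borel \<Otimes>\<^sub>M borel)"
          unfolding borel_prod split_beta' by (intro borel_measurable_continuous_onI continuous_intros)
        note this [measurable]
        show "(\<lambda>(x, l). cnj (a l) * (exp (\<i> * of_real ((k - l) * x)) * of_real (?w x))) \<in> borel_measurable (lborel \<Otimes>\<^sub>M lborel)"
          by measurable
      qed (use w a(1) in \<open>auto simp: norm_mult\<close>)
      also have "\<dots> = (LINT l|lborel. cnj (a l) * of_real (2 * pi * poisson e (k - l)))"
        by (simp only: integral_mult_right_zero laplace_fourier[OF e])
      also have "\<dots> = of_real (2 * pi) * (LINT l|lborel. of_real (poisson e (k - l)) * cnj (a l))"
        by (subst integral_mult_right_zero[symmetric]) (simp add: mult_ac)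
      also have "(LINT l|lborel. of_real (poisson e (k - l)) * cnj (a l)) = poisson_integral_fun e (\<lambda>l. cnj (a l)) k"
        unfolding poisson_integral_fun_def
        using lborel_integral_real_affine[of "-1" "\<lambda>s. of_real (poisson e s) * cnj (a (k - s))" k] by simp
      finally show "(LINT x|lborel. a k * exp (\<i> * of_real (k * x)) * (cnj (A x) * of_real (?w x)))
        = a k * (of_real (2 * pi) * poisson_integral_fun e (\<lambda>l. cnj (a l)) k)" .
    qed
    finally have "norm (complex_of_real ((L2_norm ?s)\<^sup>2)) = norm (LINT k|lborel. a k * (of_real (2 * pi) * poisson_integral_fun e (\<lambda>l. cnj (a l)) k))"
      by (simp only:)
    \<comment> \<open>Cauchy-Schwarz and the contractivity of Poisson integrals give the bound 2 pi
      ||a||^2, independent of \<open>e\<close>.\<close>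
    also have "\<dots> \<le> L2_norm a * L2_norm (\<lambda>k. of_real (2 * pi) * poisson_integral_fun e (\<lambda>l. cnj (a l)) k)"
      by (intro L2_Cauchy_Schwarz a L2_cmult poisson_integral_fun_L2 e L2_cnj)
    also have "L2_norm (\<lambda>k. of_real (2 * pi) * poisson_integral_fun e (\<lambda>l. cnj (a l)) k) = 2 * pi * L2_norm (poisson_integral_fun e (\<lambda>l. cnj (a l)))"
      by (simp only: L2_norm_cmult norm_of_real) simp
    also have "L2_norm (poisson_integral_fun e (\<lambda>l. cnj (a l))) \<le> L2_norm (\<lambda>l. cnj (a l))"
      by (intro poisson_integral_fun_L2 e L2_cnj a)
    also have "L2_norm (\<lambda>l. cnj (a l)) = L2_norm a" by (rule L2_norm_cong) simp
    finally have "norm (complex_of_real ((L2_norm ?s)\<^sup>2)) \<le> L2_norm a * (2 * pi * L2_norm a)"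
      by (simp add: mult_left_mono)
    then have "(L2_norm ?s)\<^sup>2 \<le> L2_norm a * (2 * pi * L2_norm a)"
      unfolding norm_of_real abs_power2 .
    also have "\<dots> = (sqrt (2 * pi) * L2_norm a)\<^sup>2"
      unfolding power_mult_distrib by (simp add: power2_eq_square)
    finally have "L2_norm ?s \<le> sqrt (2 * pi) * L2_norm a"
      by (rule power2_le_imp_le) simp
    then show ?thesis using sL by simp
  qed
  let ?e = "\<lambda>n. inverse (real (Suc n))"
  have lim: "AE x in lborel. (\<lambda>n. of_real (exp (- (?e n * \<bar>x\<bar>) / 2)) * A x) \<longlonglongrightarrow> A x"
  proof (rule AE_I2)
    fix x
    have "(\<lambda>n. of_real (exp (- (?e n * \<bar>x\<bar>) / 2)) * A x) \<longlonglongrightarrow> of_real (exp (- (0 * \<bar>x\<bar>) / 2)) * A x"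
      by (intro tendsto_intros LIMSEQ_inverse_real_of_nat) simp
    then show "(\<lambda>n. of_real (exp (- (?e n * \<bar>x\<bar>) / 2)) * A x) \<longlonglongrightarrow> A x" by simp
  qed
  have L: "(\<lambda>x. of_real (exp (- (?e n * \<bar>x\<bar>) / 2)) * A x) \<in> L2"
    "L2_norm (\<lambda>x. of_real (exp (- (?e n * \<bar>x\<bar>) / 2)) * A x) \<le> sqrt (2 * pi) * L2_norm a" for n
    using key[of "?e n"] by auto
  from L2_fatou[OF L(1) Am lim always_eventually[OF allI[OF L(2)]]]
  show "A \<in> L2" "L2_norm A \<le> sqrt (2 * pi) * L2_norm a" by auto
qed

section \<open>Non-stationary phase\<close>

lemma
  assumes K: "(0::real) < K"
  shows integrable_inverse_square_halfline: "integrable lborel (\<lambda>k. indicator {0..} k / (K + k)\<^sup>2)"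
    and integral_inverse_square_halfline: "(LINT k|lborel. indicator {0..} k / (K + k)\<^sup>2) = 1 / K"
proof -
  have "(\<integral>\<^sup>+k. ennreal (1 / (K + k)\<^sup>2) * indicator {0..} k \<partial>lborel) = ennreal (0 - (- 1 / (K + 0)))"
  proof (rule nn_integral_FTC_atLeast)
    show "((\<lambda>k. - 1 / (K + k)) \<longlongrightarrow> 0) at_top" by real_asymp
    fix k :: real assume "0 \<le> k"
    then show "((\<lambda>k. - 1 / (K + k)) has_real_derivative 1 / (K + k)\<^sup>2) (at k)"
      using K by (auto intro!: derivative_eq_intros simp: power2_eq_square)
  qed auto
  then have eq: "(\<integral>\<^sup>+k. ennreal (indicator {0..} k / (K + k)\<^sup>2) \<partial>lborel) = ennreal (1 / K)"
    by (subst (asm) nn_integral_cong[where v="\<lambda>k. ennreal (indicator {0..} k / (K + k)\<^sup>2)"]) (auto simp: indicator_def)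
  show "integrable lborel (\<lambda>k. indicator {0..} k / (K + k)\<^sup>2)"
    by (rule integrableI_nonneg) (use eq in auto)
  show "(LINT k|lborel. indicator {0..} k / (K + k)\<^sup>2) = 1 / K"
    by (rule integral_eq_nn_integral[THEN trans]) (use eq K in auto)
qed

text \<open>Expanding the kernel in frequencies \<open>k \<ge> 0\<close> exhibits the Cauchy
  integral on a line as an inverse Fourier integral of the damped transform of \<open>g\<close>. The
  constant is sqrt(2 pi) from the Fourier bound times C / (2 pi), times 1 / sqrt K from the square
  integral of 1 / (K + k).\<close>

lemma cauchy_integral_L2_bound:
  assumes g: "integrable lborel g" "g \<in> L2" and K: "0 < K" and C: "0 \<le> C" and y: "0 < y"
    and bound: "\<And>k. 0 \<le> k \<Longrightarrow> norm (LINT t|lborel. g t * exp (- (\<i> * of_real (k * t)))) \<le> C / (K + k)"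
  shows "(\<lambda>x. cauchy_integral g (Complex x y)) \<in> L2"
    "L2_norm (\<lambda>x. cauchy_integral g (Complex x y)) \<le> C / sqrt (2 * pi * K)"
proof -
  have [measurable]: "g \<in> borel_measurable borel" using g(2) by (simp add: L2_iff)
  have em: "(\<lambda>(k, t). exp (- (\<i> * complex_of_real (k * t)))) \<in> borel_measurable (borel \<Otimes>\<^sub>M borel)"
    unfolding borel_prod split_beta' by (intro borel_measurable_continuous_onI continuous_intros)
  note em [measurable]
  define gh where "gh k = (LINT t|lborel. g t * exp (- (\<i> * of_real (k * t))))" for k
  have [measurable]: "gh \<in> borel_measurable borel" unfolding gh_def by measurable
  define a where "a k = (indicator {0..} k * exp (- (of_real y * of_real k))) * gh k / (2 * of_real pi)" for k :: real
  have am [measurable]: "a \<in> borel_measurable borel"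
  proof -
    have [measurable]: "(\<lambda>k. exp (- (of_real y * of_real k)) :: complex) \<in> borel_measurable borel"
      by (intro borel_measurable_continuous_onI continuous_intros)
    show ?thesis unfolding a_def by measurable
  qed
  define B where "B = (LINT t|lborel. norm (g t))"
  have ghB: "norm (gh k) \<le> B" for k
    unfolding gh_def B_def using integral_norm_bound[of lborel "\<lambda>t. g t * exp (- (\<i> * of_real (k * t)))"]
    by (simp add: norm_mult)
  have yr: "Re (complex_of_real y) > 0" using y by simp
  \<comment> \<open>For fixed \<open>y\<close> the damping makes \<open>a\<close> integrable; the
    bound used here depends on \<open>y\<close>, but it does not enter the final estimate.\<close>
  have ai: "integrable lborel a"
  proof (rule Bochner_Integration.integrable_bound)
    show "integrable lborel (\<lambda>k. of_real B * (indicator {0..} k *\<^sub>R exp (- (of_real y * complex_of_real k))))"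
      by (intro integrable_mult_right integrable_exp_halfline yr)
    have "norm (gh k) / (2 * pi) \<le> B" for k
    proof -
      have "norm (gh k) / (2 * pi) \<le> norm (gh k)"
        using pi_gt3 by (simp add: divide_le_eq mult_le_cancel_left1)
      then show ?thesis using ghB[of k] by linarith
    qed
    note gB = this
    show "AE k in lborel. norm (a k) \<le> norm (of_real B * (indicator {0..} k *\<^sub>R exp (- (of_real y * complex_of_real k))))"
    proof (rule AE_I2)
      fix k
      have "exp (- (y * k)) * (norm (gh k) / (2 * pi)) \<le> exp (- (y * k)) * \<bar>B\<bar>"
        using order_trans[OF gB abs_ge_self] by (intro mult_left_mono) auto
      then show "norm (a k) \<le> norm (of_real B * (indicator {0..} k *\<^sub>R exp (- (of_real y * complex_of_real k))))"
        by (auto simp: a_def indicator_def norm_mult norm_divide mult.commute)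
    qed
  qed simp
  \<comment> \<open>The damping factor is at most 1 and is dropped, which keeps the norm bound
    independent of \<open>y\<close>.\<close>
  have asq: "(norm (a k))\<^sup>2 \<le> (C / (2 * pi))\<^sup>2 * (indicator {0..} k / (K + k)\<^sup>2)" for k
  proof (cases "0 \<le> k")
    case True
    have "norm (exp (- (of_real y * of_real k)) * gh k) \<le> 1 * (C / (K + k))"
      unfolding norm_mult using True y bound[OF True] by (intro mult_mono) (auto simp: gh_def)
    then have "norm (exp (- (of_real y * of_real k)) * gh k) / (2 * pi) \<le> 1 * (C / (K + k)) / (2 * pi)"
      by (rule divide_right_mono) simp
    also have "norm (exp (- (of_real y * of_real k)) * gh k) / (2 * pi) = norm (a k)"
      using True by (simp add: a_def norm_divide norm_mult)
    also have "1 * (C / (K + k)) / (2 * pi) = C / (2 * pi) / (K + k)" by simp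
    finally have "norm (a k) \<le> C / (2 * pi) / (K + k)" .
    then have "(norm (a k))\<^sup>2 \<le> (C / (2 * pi) / (K + k))\<^sup>2" by (intro power_mono) auto
    also have "(C / (2 * pi) / (K + k))\<^sup>2 = (C / (2 * pi))\<^sup>2 * (indicator {0..} k / (K + k)\<^sup>2)"
      using True by (simp add: power_divide power_mult_distrib)
    finally show ?thesis .
  qed (simp add: a_def)
  have aL: "a \<in> L2"
    unfolding L2_iff
  proof (rule conjI[OF am], rule Bochner_Integration.integrable_bound[OF _ _ AE_I2])
    show "integrable lborel (\<lambda>k. (C / (2 * pi))\<^sup>2 * (indicator {0..} k / (K + k)\<^sup>2))"
      by (intro integrable_mult_right integrable_inverse_square_halfline K)
    show "norm ((norm (a k))\<^sup>2) \<le> norm ((C / (2 * pi))\<^sup>2 * (indicator {0..} k / (K + k)\<^sup>2))" for k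
      using order_trans[OF asq abs_ge_self] by simp
  qed simp
  have an: "(L2_norm a)\<^sup>2 \<le> (C / (2 * pi))\<^sup>2 * (1 / K)"
    unfolding L2_norm_power2 integral_inverse_square_halfline[OF K, symmetric] integral_mult_right_zero[symmetric]
    by (rule integral_mono[OF L2_integrable_sq[OF aL] _ asq])
       (intro integrable_mult_right integrable_inverse_square_halfline K)
  have rep: "cauchy_integral g (Complex x y) = (LINT k|lborel. a k * exp (\<i> * of_real (k * x)))" for x
  proof -
    define z where "z = Complex x y"
    define c where "c t = \<i> * (complex_of_real t - z)" for t
    have c: "Re (c t) = y" "c t \<noteq> 0" for t using y by (auto simp: c_def z_def complex_eq_iff)
    have kernel: "1 / (of_real t - z) = \<i> * (LINT k|lborel. indicator {0..} k *\<^sub>R exp (- (c t * of_real k)))" for t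
      using integral_exp_halfline[of "c t"] c[of t] y by (simp add: c_def)
    have ez: "exp (- (c t * of_real k)) = exp (- (\<i> * of_real (k * t))) * (exp (- (of_real y * of_real k)) * exp (\<i> * of_real (k * x)))" for t k
      by (simp add: c_def z_def Complex_eq algebra_simps flip: exp_add)
    have "(LINT t|lborel. g t / (of_real t - z))
        = (LINT t|lborel. LINT k|lborel. \<i> * (g t * (indicator {0..} k *\<^sub>R exp (- (c t * of_real k)))))"
    proof (rule Bochner_Integration.integral_cong[OF refl])
      fix t
      have "g t / (of_real t - z) = \<i> * (g t * (LINT k|lborel. indicator {0..} k *\<^sub>R exp (- (c t * of_real k))))"
        using kernel[of t] by (simp add: divide_inverse mult.left_commute)
      then show "g t / (of_real t - z) = (LINT k|lborel. \<i> * (g t * (indicator {0..} k *\<^sub>R exp (- (c t * of_real k)))))"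
        by (simp only: integral_mult_right_zero)
    qed
    also have "\<dots> = (LINT k|lborel. LINT t|lborel. \<i> * (g t * (indicator {0..} k *\<^sub>R exp (- (c t * of_real k)))))"
    proof (rule lborel_pair.Fubini_integral[symmetric], rule lborel_pair_integrable_bound)
      have "(\<lambda>(t, k). exp (- (c t * complex_of_real k))) \<in> borel_measurable (borel \<Otimes>\<^sub>M borel)"
        unfolding borel_prod split_beta' c_def by (intro borel_measurable_continuous_onI continuous_intros)
      note this [measurable]
      show "(\<lambda>(t, k). \<i> * (g t * (indicator {0..} k *\<^sub>R exp (- (c t * of_real k))))) \<in> borel_measurable (lborel \<Otimes>\<^sub>M lborel)"
        by measurable
      show "integrable lborel (\<lambda>t. norm (g t))" using g(1) by simp
      show "integrable lborel (\<lambda>k. norm (indicator {0..} k *\<^sub>R exp (- (of_real y * complex_of_real k))))"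
        using integrable_exp_halfline[OF yr] by (rule integrable_norm)
      show "norm (\<i> * (g t * (indicator {0..} k *\<^sub>R exp (- (c t * of_real k)))))
          \<le> norm (g t) * norm (indicator {0..} k *\<^sub>R exp (- (of_real y * complex_of_real k)))" for t k
        by (simp add: norm_mult c)
    qed
    also have "\<dots> = (LINT k|lborel. (2 * of_real pi * \<i>) * (a k * exp (\<i> * of_real (k * x))))"
    proof (rule Bochner_Integration.integral_cong[OF refl])
      fix k
      have "(LINT t|lborel. \<i> * (g t * (indicator {0..} k *\<^sub>R exp (- (c t * of_real k)))))
          = (LINT t|lborel. g t * exp (- (\<i> * of_real (k * t))) *
             (\<i> * indicator {0..} k * (exp (- (of_real y * of_real k)) * exp (\<i> * of_real (k * x)))))"
        unfolding ez by (intro Bochner_Integration.integral_cong) (auto simp: indicator_def)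
      also have "\<dots> = gh k * (\<i> * indicator {0..} k * (exp (- (of_real y * of_real k)) * exp (\<i> * of_real (k * x))))"
        unfolding gh_def by (rule integral_mult_left_zero)
      also have "\<dots> = (2 * of_real pi * \<i>) * (a k * exp (\<i> * of_real (k * x)))"
        by (simp add: a_def)
      finally show "(LINT t|lborel. \<i> * (g t * (indicator {0..} k *\<^sub>R exp (- (c t * of_real k)))))
        = (2 * of_real pi * \<i>) * (a k * exp (\<i> * of_real (k * x)))" .
    qed
    finally show ?thesis unfolding cauchy_integral_def z_def[symmetric] integral_mult_right_zero by simp
  qed
  show "(\<lambda>x. cauchy_integral g (Complex x y)) \<in> L2" unfolding rep by (rule fourier_L2_bound[OF ai aL])
  have "L2_norm (\<lambda>x. cauchy_integral g (Complex x y)) \<le> sqrt (2 * pi) * L2_norm a"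
    unfolding rep by (rule fourier_L2_bound[OF ai aL])
  also have "\<dots> \<le> sqrt (2 * pi) * sqrt ((C / (2 * pi))\<^sup>2 * (1 / K))"
    using an by (intro mult_left_mono real_le_rsqrt) auto
  also have "\<dots> = sqrt (C\<^sup>2 / (2 * pi * K))"
    unfolding real_sqrt_mult[symmetric] by (simp add: power2_eq_square)
  also have "\<dots> = C / sqrt (2 * pi * K)" using C by (simp add: real_sqrt_divide)
  finally show "L2_norm (\<lambda>x. cauchy_integral g (Complex x y)) \<le> C / sqrt (2 * pi * K)" .
qed

text \<open>Integration by parts against \<open>e\<^sup>i\<^sup>\<theta> / (i \<theta>')\<close>, where \<open>\<theta> x = k \<phi> x - l x\<close>.\<close>

lemma nonstationary_phase:
  fixes \<phi> \<phi>' \<phi>'' :: "real \<Rightarrow> real"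
  assumes ab: "a \<le> b" and k: "0 < k" and l: "0 \<le> l" and c: "0 < c"
    and d1: "\<And>x. x \<in> {a..b} \<Longrightarrow> (\<phi> has_real_derivative \<phi>' x) (at x)"
    and d2: "\<And>x. x \<in> {a..b} \<Longrightarrow> (\<phi>' has_real_derivative \<phi>'' x) (at x)"
    and cont: "continuous_on {a..b} \<phi>''"
    and neg: "\<And>x. x \<in> {a..b} \<Longrightarrow> \<phi>' x \<le> - c"
    and M: "\<And>x. x \<in> {a..b} \<Longrightarrow> \<bar>\<phi>'' x\<bar> \<le> M"
  shows "norm (LINT x|lborel. indicator {a..b} x * exp (\<i> * of_real (k * \<phi> x)) * exp (- (\<i> * of_real (l * x))))
    \<le> (2 + (b - a) * M / c) / (k * c + l)"
proof -
  define \<theta> where "\<theta> x = k * \<phi> x - l * x" for x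
  define \<theta>' where "\<theta>' x = k * \<phi>' x - l" for x
  \<comment> \<open>A lower bound for \<open>|\<theta>'|\<close>: both \<open>k \<phi>'\<close> and
    \<open>- l\<close> are nonpositive, so their absolute values add.\<close>
  define L where "L = k * c + l"
  have L: "0 < L" "k * c \<le> L" using k c l by (auto simp: L_def add_pos_nonneg)
  have M0: "0 \<le> M" using M[of a] ab by fastforce
  have \<theta>neg: "\<theta>' x \<le> - L" if "x \<in> {a..b}" for x
    using mult_left_mono[OF neg[OF that], of k] k by (simp add: \<theta>'_def L_def)
  have \<theta>abs: "L \<le> \<bar>\<theta>' x\<bar>" "\<theta>' x \<noteq> 0" if "x \<in> {a..b}" for x
    using \<theta>neg[OF that] L by auto
  have D1: "(\<theta> has_vector_derivative \<theta>' x) (at x within {a..b})" if "x \<in> {a..b}" for x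
    unfolding has_real_derivative_iff_has_vector_derivative[symmetric] \<theta>_def \<theta>'_def
    by (auto intro!: derivative_eq_intros has_field_derivative_at_within[OF d1[OF that]])
  have D2: "(\<theta>' has_vector_derivative k * \<phi>'' x) (at x within {a..b})" if "x \<in> {a..b}" for x
    unfolding has_real_derivative_iff_has_vector_derivative[symmetric] \<theta>'_def
    by (auto intro!: derivative_eq_intros has_field_derivative_at_within[OF d2[OF that]])
  have c1: "continuous_on {a..b} \<theta>" using D1 by (meson continuous_on_eq_continuous_within has_vector_derivative_continuous)
  have c2: "continuous_on {a..b} \<theta>'" using D2 by (meson continuous_on_eq_continuous_within has_vector_derivative_continuous)
  let ?E = "\<lambda>x. exp (\<i> * complex_of_real (\<theta> x))"
  let ?V = "\<lambda>x. ?E x / (\<i> * of_real (\<theta>' x))"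
  \<comment> \<open>The derivative of \<open>?V\<close> is \<open>?E + ?r\<close>; the second term
    comes from differentiating the factor 1 / \<theta>'.\<close>
  let ?r = "\<lambda>x. \<i> * ?E x * of_real (k * \<phi>'' x) / (of_real (\<theta>' x))\<^sup>2"
  have DV: "(?V has_vector_derivative ?E x + ?r x) (at x within {a..b})" if x: "x \<in> {a..b}" for x
  proof -
    have o1: "((\<lambda>x. complex_of_real (\<theta> x)) has_vector_derivative of_real (\<theta>' x)) (at x within {a..b})"
      by (rule has_vector_derivative_of_real[OF D1[OF x, folded has_real_derivative_iff_has_vector_derivative]])
    have o2: "((\<lambda>x. complex_of_real (\<theta>' x)) has_vector_derivative of_real (k * \<phi>'' x)) (at x within {a..b})"
      by (rule has_vector_derivative_of_real[OF D2[OF x, folded has_real_derivative_iff_has_vector_derivative]])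
    have e: "(?E has_vector_derivative of_real (\<theta>' x) * (\<i> * ?E x)) (at x within {a..b})"
    proof -
      have "((\<lambda>z. exp (\<i> * z)) has_field_derivative \<i> * ?E x) (at (of_real (\<theta> x)) within (\<lambda>x. of_real (\<theta> x)) ` {a..b})"
        by (auto intro!: derivative_eq_intros)
      from field_vector_diff_chain_within[OF o1 this] show ?thesis by (simp add: o_def)
    qed
    have i: "((\<lambda>x. 1 / (\<i> * of_real (\<theta>' x))) has_vector_derivative of_real (k * \<phi>'' x) * (- \<i> / (\<i> * of_real (\<theta>' x))\<^sup>2)) (at x within {a..b})"
    proof -
      have "((\<lambda>z. 1 / (\<i> * z)) has_field_derivative - \<i> / (\<i> * of_real (\<theta>' x))\<^sup>2) (at (of_real (\<theta>' x)) within (\<lambda>x. of_real (\<theta>' x)) ` {a..b})"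
        using \<theta>abs(2)[OF x] by (auto intro!: derivative_eq_intros simp: power2_eq_square)
      from field_vector_diff_chain_within[OF o2 this] show ?thesis by (simp add: o_def)
    qed
    have "((\<lambda>x. ?E x * (1 / (\<i> * of_real (\<theta>' x)))) has_vector_derivative
        ?E x * (of_real (k * \<phi>'' x) * (- \<i> / (\<i> * of_real (\<theta>' x))\<^sup>2)) + of_real (\<theta>' x) * (\<i> * ?E x) * (1 / (\<i> * of_real (\<theta>' x)))) (at x within {a..b})"
      by (rule has_vector_derivative_mult[OF e i])
    moreover have "?E x * (of_real (k * \<phi>'' x) * (- \<i> / (\<i> * of_real (\<theta>' x))\<^sup>2)) + of_real (\<theta>' x) * (\<i> * ?E x) * (1 / (\<i> * of_real (\<theta>' x))) = ?E x + ?r x"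
      using \<theta>abs(2)[OF x] by (simp add: power_mult_distrib)
    ultimately show ?thesis by simp
  qed
  have cE: "continuous_on {a..b} ?E" by (intro continuous_intros c1)
  have cr: "continuous_on {a..b} ?r"
    by (intro continuous_intros c1 c2 cont) (use \<theta>abs(2) in auto)
  have FTC: "(LINT x|lborel. indicator {a..b} x *\<^sub>R (?E x + ?r x)) = ?V b - ?V a"
  proof (rule integral_FTC_atLeastAtMost[OF ab])
    show "continuous_on {a..b} (\<lambda>x. ?E x + ?r x)" by (rule continuous_on_add[OF cE cr])
  qed (rule DV, simp)
  have Ei: "integrable lborel (\<lambda>x. indicator {a..b} x *\<^sub>R ?E x)"
    and ri: "integrable lborel (\<lambda>x. indicator {a..b} x *\<^sub>R ?r x)"
    using borel_integrable_atLeastAtMost'[OF cE] borel_integrable_atLeastAtMost'[OF cr]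
    unfolding set_integrable_def .
  have eq: "(LINT x|lborel. indicator {a..b} x *\<^sub>R ?E x) = (?V b - ?V a) - (LINT x|lborel. indicator {a..b} x *\<^sub>R ?r x)"
    unfolding FTC[symmetric] scaleR_right_distrib Bochner_Integration.integral_add[OF Ei ri] by simp
  have nV: "norm (?V x) \<le> 1 / L" if "x \<in> {a..b}" for x
    using frac_le[of 1 1 L "\<bar>\<theta>' x\<bar>"] \<theta>abs(1)[OF that] L by (simp add: norm_divide norm_mult)
  have "norm (LINT x|lborel. indicator {a..b} x *\<^sub>R ?r x) \<le> (LINT x|lborel. indicator {a..b} x * (k * M / L\<^sup>2))"
  proof (rule order_trans[OF integral_norm_bound integral_mono])
    show "integrable lborel (\<lambda>x. norm (indicator {a..b} x *\<^sub>R ?r x))" using ri by (rule integrable_norm)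
    show "integrable lborel (\<lambda>x. indicator {a..b} x * (k * M / L\<^sup>2))" by (simp add: emeasure_lborel_Icc_eq)
    fix x
    show "norm (indicator {a..b} x *\<^sub>R ?r x) \<le> indicator {a..b} x * (k * M / L\<^sup>2)"
    proof (cases "x \<in> {a..b}")
      case True
      have "norm (?r x) = k * \<bar>\<phi>'' x\<bar> / \<bar>\<theta>' x\<bar>\<^sup>2"
        using k by (simp add: norm_divide norm_mult norm_power abs_mult)
      also have "\<dots> \<le> k * M / L\<^sup>2"
        using True k L \<theta>abs(1)[OF True] M[OF True] by (intro frac_le mult_left_mono power_mono) auto
      finally show ?thesis using True by simp
    qed simp
  qed
  also have "\<dots> = (b - a) * (k * M / L\<^sup>2)" using ab by simp
  \<comment> \<open>One factor \<open>1 / L\<close> absorbs \<open>k\<close>, because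
    \<open>k / L \<le> 1 / c\<close>; the other is kept, so the remainder has the same order as the
    boundary terms.\<close>
  also have "\<dots> \<le> (b - a) * M / c / L"
  proof -
    have "k * M / L\<^sup>2 = (k / L) * (M / L)" by (simp add: power2_eq_square)
    also have "\<dots> \<le> (1 / c) * (M / L)"
      using L c M0 by (intro mult_right_mono) (auto simp: field_simps)
    finally have "(b - a) * (k * M / L\<^sup>2) \<le> (b - a) * ((1 / c) * (M / L))"
      using ab by (intro mult_left_mono) auto
    then show ?thesis by simp
  qed
  finally have "norm (LINT x|lborel. indicator {a..b} x *\<^sub>R ?E x) \<le> 1 / L + 1 / L + (b - a) * M / c / L"
    unfolding eq
    using norm_triangle_ineq4[of "?V b - ?V a" "LINT x|lborel. indicator {a..b} x *\<^sub>R ?r x"]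
      norm_triangle_ineq4[of "?V b" "?V a"] nV[of a] nV[of b] ab by auto
  also have "\<dots> = (2 + (b - a) * M / c) / L" by (simp add: add_divide_distrib)
  also have "(LINT x|lborel. indicator {a..b} x *\<^sub>R ?E x) =
      (LINT x|lborel. indicator {a..b} x * exp (\<i> * of_real (k * \<phi> x)) * exp (- (\<i> * of_real (l * x))))"
  proof (rule Bochner_Integration.integral_cong[OF refl])
    fix x
    have "?E x = exp (\<i> * of_real (k * \<phi> x)) * exp (- (\<i> * of_real (l * x)))"
      by (simp add: \<theta>_def algebra_simps flip: exp_add)
    then show "indicator {a..b} x *\<^sub>R ?E x = indicator {a..b} x * exp (\<i> * of_real (k * \<phi> x)) * exp (- (\<i> * of_real (l * x)))"
      by (simp add: indicator_def)
  qed
  finally show ?thesis by (simp add: L_def)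
qed

section \<open>Projections onto the modulated Hardy spaces\<close>

text \<open>The height tends to 0 in the approximate identity. This is where bounds uniform in the
  height become bounds on the real line.\<close>

lemma L2_norm_le_if_poisson_le:
  assumes f: "f \<in> L2" and le: "\<And>y. 0 < y \<Longrightarrow> L2_norm (poisson_integral_fun y f) \<le> B"
  shows "L2_norm f \<le> B"
proof -
  have lim: "((\<lambda>y. B + L2_norm (\<lambda>x. poisson_integral_fun y f x - f x)) \<longlongrightarrow> B + 0) (at_right 0)"
    by (intro tendsto_intros poisson_integral_fun_tendsto f)
  have ev: "eventually (\<lambda>y. L2_norm f \<le> B + L2_norm (\<lambda>x. poisson_integral_fun y f x - f x)) (at_right 0)"
    unfolding eventually_at_filter
  proof (intro always_eventually allI impI)
    fix y :: real assume "y \<in> {0<..}"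
    then have y: "0 < y" by simp
    note P = poisson_integral_fun_L2(1)[OF y f]
    have "L2_norm (\<lambda>x. f x - 0) \<le> L2_norm (\<lambda>x. f x - poisson_integral_fun y f x) + L2_norm (\<lambda>x. poisson_integral_fun y f x - 0)"
      by (rule L2_norm_triangle_diff[OF f P L2_zero])
    then show "L2_norm f \<le> B + L2_norm (\<lambda>x. poisson_integral_fun y f x - f x)"
      using le[OF y] L2_norm_minus_commute[of f "poisson_integral_fun y f"] by simp
  qed
  have "L2_norm f \<le> B + 0" by (rule tendsto_lowerbound[OF lim ev]) simp
  then show ?thesis by simp
qed

lemma cauchy_integral_add:
  "f \<in> L2 \<Longrightarrow> g \<in> L2 \<Longrightarrow> Im z \<noteq> 0 \<Longrightarrow>
    cauchy_integral (\<lambda>x. f x + g x) z = cauchy_integral f z + cauchy_integral g z"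
  unfolding cauchy_integral_def add_divide_distrib[of "f _"]
  by (subst Bochner_Integration.integral_add[OF cauchy_integrable cauchy_integrable]) (auto simp: add_divide_distrib)

text \<open>As \<open>t\<close> is real, conjugation reflects the pole; the sign comes from the
  factor 2 pi i. Values from below thus reduce to values from above, where the frequency expansion
  is available.\<close>

lemma cauchy_integral_cnj: "cauchy_integral (\<lambda>x. cnj (f x)) (cnj z) = - cnj (cauchy_integral f z)"
proof -
  have "(LINT t|lborel. cnj (f t) / (of_real t - cnj z)) = cnj (LINT t|lborel. f t / (of_real t - z))"
    unfolding Bochner_Integration.integral_cnj[symmetric] by simp
  then show ?thesis by (simp add: cauchy_integral_def)
qed

text \<open>The projection \<open>p\<close> is the boundary value of the Cauchy integral of \<open>g\<close> from above, and
  \<open>p - g\<close> the one from below.\<close>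

lemma H2_proj_cauchy_integral:
  assumes g: "g \<in> L2" and p: "is_orth_proj H2 g p" and z: "Im z > 0"
  shows "cauchy_integral p z = cauchy_integral g z" "cauchy_integral p (cnj z) = 0"
proof -
  have pH: "p \<in> H2" using p by (simp add: is_orth_proj_def)
  have pL: "p \<in> L2" by (rule H2_L2[OF pH])
  show "cauchy_integral p (cnj z) = 0" using H2_D[OF pH, of "cnj z"] z by (simp add: cauchy_integral_def)
  \<comment> \<open>The inner product conjugates its second argument, so testing with the pole at
    \<open>cnj z\<close> gives the Cauchy kernel at \<open>z\<close>.\<close>
  have "L2_inner (\<lambda>x. g x - p x) (\<lambda>x. 1 / (of_real x - cnj z)) = 0"
    using p cauchy_kernel_H2[of "cnj z"] z by (simp add: is_orth_proj_def)
  then have r: "cauchy_integral (\<lambda>x. g x - p x) z = 0"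
    by (simp add: L2_inner_def cauchy_integral_def)
  have "cauchy_integral (\<lambda>x. p x + (g x - p x)) z = cauchy_integral p z + cauchy_integral (\<lambda>x. g x - p x) z"
    using z by (intro cauchy_integral_add pL L2_diff g) auto
  then show "cauchy_integral p z = cauchy_integral g z" using r by simp
qed

text \<open>The Cauchy integral of \<open>p\<close> vanishes below and agrees with that of
  \<open>g\<close> above, so the jump formula turns the latter into the Poisson integral of
  \<open>p\<close>.\<close>

lemma H2_proj_norm_le:
  assumes g: "g \<in> L2" and p: "is_orth_proj H2 g p"
    and le: "\<And>y. 0 < y \<Longrightarrow> L2_norm (\<lambda>x. cauchy_integral g (Complex x y)) \<le> B"
  shows "L2_norm p \<le> B"
proof (rule L2_norm_le_if_poisson_le)
  show pL: "p \<in> L2" by (rule is_orth_proj_L2[OF H2_subspace p])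
  fix y :: real assume y: "0 < y"
  have "poisson_integral_fun y p = (\<lambda>x. cauchy_integral g (Complex x y))"
  proof
    fix x
    show "poisson_integral_fun y p x = cauchy_integral g (Complex x y)"
      using cauchy_integral_jump[OF y pL, of x] H2_proj_cauchy_integral[OF g p, of "Complex x y"] y
      by (simp add: complex_cnj)
  qed
  then show "L2_norm (poisson_integral_fun y p) \<le> B" using le[OF y] by simp
qed

text \<open>For the residual the roles are exchanged: its Cauchy integral vanishes above and agrees
  with that of \<open>g\<close> below, and the conjugate of \<open>g\<close> moves the estimate back
  to the upper half plane.\<close>

lemma H2_proj_residual_norm_le:
  assumes g: "g \<in> L2" and p: "is_orth_proj H2 g p"
    and le: "\<And>y. 0 < y \<Longrightarrow> L2_norm (\<lambda>x. cauchy_integral (\<lambda>t. cnj (g t)) (Complex x y)) \<le> B"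
  shows "L2_norm (\<lambda>x. g x - p x) \<le> B"
proof (rule L2_norm_le_if_poisson_le)
  have pL: "p \<in> L2" by (rule is_orth_proj_L2[OF H2_subspace p])
  show rL: "(\<lambda>x. g x - p x) \<in> L2" by (intro L2_diff g pL)
  fix y :: real assume y: "0 < y"
  have "norm (poisson_integral_fun y (\<lambda>x. g x - p x) x) = norm (cauchy_integral (\<lambda>t. cnj (g t)) (Complex x y))" for x
  proof -
    let ?z = "Complex x y"
    have z: "Im ?z > 0" "Im ?z \<noteq> 0" "Im (cnj ?z) \<noteq> 0" using y by auto
    have eq: "cauchy_integral g w = cauchy_integral p w + cauchy_integral (\<lambda>x. g x - p x) w" if "Im w \<noteq> 0" for w
      using cauchy_integral_add[OF pL rL that] by simp
    have "poisson_integral_fun y (\<lambda>x. g x - p x) x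
        = cauchy_integral (\<lambda>x. g x - p x) ?z - cauchy_integral (\<lambda>x. g x - p x) (cnj ?z)"
      using cauchy_integral_jump[OF y rL, of x] by (simp add: complex_cnj)
    also have "\<dots> = - cauchy_integral g (cnj ?z)"
      using eq[OF z(2)] eq[OF z(3)] H2_proj_cauchy_integral[OF g p z(1)] by simp
    also have "\<dots> = cnj (cauchy_integral (\<lambda>t. cnj (g t)) ?z)"
      using cauchy_integral_cnj[of "\<lambda>t. cnj (g t)" ?z] by simp
    finally show ?thesis by (simp only: complex_mod_cnj)
  qed
  then have "L2_norm (poisson_integral_fun y (\<lambda>x. g x - p x)) = L2_norm (\<lambda>x. cauchy_integral (\<lambda>t. cnj (g t)) (Complex x y))"
    by (rule L2_norm_cong)
  then show "L2_norm (poisson_integral_fun y (\<lambda>x. g x - p x)) \<le> B" using le[OF y] by simp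
qed

text \<open>The constant depends on the interval and the phase but on neither \<open>k\<close> nor
  \<open>y\<close>: compactness bounds \<phi>'', and the frequency estimate is applied with
  \<open>K = k c\<close>.\<close>

lemma cauchy_integral_phase_bound:
  fixes \<phi> \<phi>' \<phi>'' :: "real \<Rightarrow> real"
  assumes ab: "a \<le> b" and c: "0 < c"
    and d1: "\<And>x. x \<in> {a..b} \<Longrightarrow> (\<phi> has_real_derivative \<phi>' x) (at x)"
    and d2: "\<And>x. x \<in> {a..b} \<Longrightarrow> (\<phi>' has_real_derivative \<phi>'' x) (at x)"
    and cont: "continuous_on {a..b} \<phi>''"
    and neg: "\<And>x. x \<in> {a..b} \<Longrightarrow> \<phi>' x \<le> - c"
  obtains C where "\<And>k y. 0 < k \<Longrightarrow> 0 < y \<Longrightarrow>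
    L2_norm (\<lambda>x. cauchy_integral (\<lambda>x. indicator {a..b} x * exp (\<i> * of_real (k * \<phi> x))) (Complex x y)) \<le> C / sqrt k"
proof -
  obtain M where M: "\<And>x. x \<in> {a..b} \<Longrightarrow> \<bar>\<phi>'' x\<bar> \<le> M"
  proof -
    have "compact (\<phi>'' ` {a..b})" by (rule compact_continuous_image[OF cont]) simp
    then obtain M where "\<forall>y\<in>\<phi>'' ` {a..b}. norm y \<le> M" using compact_imp_bounded bounded_iff by metis
    then show ?thesis by (intro that[of M]) simp
  qed
  have M0: "0 \<le> M" using M[of a] ab by fastforce
  define A where "A = 2 + (b - a) * M / c"
  have A: "0 \<le> A" using ab M0 c by (simp add: A_def)
  have \<phi>c: "continuous_on {a..b} \<phi>" using d1
    by (meson DERIV_isCont continuous_at_imp_continuous_on)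
  show ?thesis
  proof (rule that[of "A / sqrt (2 * pi * c)"])
    fix k y :: real assume k: "0 < k" and y: "0 < y"
    let ?g = "\<lambda>x. indicator {a..b} x * exp (\<i> * of_real (k * \<phi> x))"
    have "continuous_on {a..b} (\<lambda>x. exp (\<i> * complex_of_real (k * \<phi> x)))"
      by (intro continuous_intros \<phi>c)
    from borel_integrable_atLeastAtMost'[OF this]
    have "integrable lborel (\<lambda>x. indicator {a..b} x *\<^sub>R exp (\<i> * complex_of_real (k * \<phi> x)))"
      by (simp add: set_integrable_def)
    also have "(\<lambda>x. indicator {a..b} x *\<^sub>R exp (\<i> * complex_of_real (k * \<phi> x))) = ?g"
      by (auto simp: fun_eq_iff indicator_def)
    finally have gi: "integrable lborel ?g" .
    have "integrable lborel (\<lambda>x. (norm (?g x))\<^sup>2)"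
    proof -
      have "(\<lambda>x. (norm (?g x))\<^sup>2) = (\<lambda>x. norm (?g x))" by (auto simp: fun_eq_iff indicator_def)
      then show ?thesis using integrable_norm[OF gi] by simp
    qed
    then have gL: "?g \<in> L2" using borel_measurable_integrable[OF gi] by (simp add: L2_iff)
    have "L2_norm (\<lambda>x. cauchy_integral ?g (Complex x y)) \<le> A / sqrt (2 * pi * (k * c))"
    proof (rule cauchy_integral_L2_bound[OF gi gL _ A y])
      fix l :: real assume "0 \<le> l"
      then show "norm (LINT t|lborel. ?g t * exp (- (\<i> * of_real (l * t)))) \<le> A / (k * c + l)"
        unfolding A_def by (rule nonstationary_phase[OF ab k _ c d1 d2 cont neg M])
    qed (use k c in simp)
    also have "\<dots> = A / sqrt (2 * pi * c) / sqrt k" by (simp add: real_sqrt_mult)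
    finally show "L2_norm (\<lambda>x. cauchy_integral ?g (Complex x y)) \<le> A / sqrt (2 * pi * c) / sqrt k" .
  qed
qed

section \<open>Projections after modulation, projections onto functions supported on a set, and
  their differences\<close>

lemma modulated_H2_proj:
  assumes u: "u = (\<lambda>x. exp (\<i> * of_real (k * \<psi> x)))" and p: "is_orth_proj H2 (\<lambda>x. cnj (u x) * f x) p"
  shows "is_orth_proj (modulated_H2 k \<psi>) f (\<lambda>x. u x * p x)"
  unfolding is_orth_proj_def
proof (intro conjI ballI)
  show "(\<lambda>x. u x * p x) \<in> modulated_H2 k \<psi>"
    using p by (auto simp: modulated_H2_def u is_orth_proj_def)
  fix h assume "h \<in> modulated_H2 k \<psi>"
  then obtain h0 where h: "h0 \<in> H2" "h = (\<lambda>x. u x * h0 x)" by (auto simp: modulated_H2_def u)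
  have uu: "u x * cnj (u x) = 1" for x
    unfolding u complex_norm_square[symmetric] by simp
  have "(f x - u x * p x) * cnj (u x * h0 x) = (cnj (u x) * f x - p x) * cnj (h0 x)" for x
  proof -
    have "(f x - u x * p x) * cnj (u x * h0 x) = (cnj (u x) * f x - (u x * cnj (u x)) * p x) * cnj (h0 x)"
      by (simp add: algebra_simps)
    then show ?thesis by (simp add: uu)
  qed
  then have "L2_inner (\<lambda>x. f x - u x * p x) h = L2_inner (\<lambda>x. cnj (u x) * f x - p x) h0"
    unfolding L2_inner_def h(2) by (simp only:)
  then show "L2_inner (\<lambda>x. f x - u x * p x) h = 0" using p h(1) by (simp add: is_orth_proj_def)
qed

lemma modulated_H2_subspace:
  assumes [measurable]: "\<psi> \<in> borel_measurable borel"
  shows "L2_subspace (modulated_H2 k \<psi>)"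
  unfolding L2_subspace_def
proof (intro conjI ballI allI subsetI)
  let ?u = "\<lambda>x. exp (\<i> * complex_of_real (k * \<psi> x))"
  have [measurable]: "?u \<in> borel_measurable borel"
    by (rule borel_measurable_continuous_on[of "\<lambda>r. exp (\<i> * complex_of_real (k * r))"]) (auto intro!: continuous_intros)
  show "f \<in> L2" if f: "f \<in> modulated_H2 k \<psi>" for f
  proof -
    obtain f0 where f0: "f0 \<in> H2" "f = (\<lambda>x. ?u x * f0 x)" using f unfolding modulated_H2_def by blast
    show ?thesis unfolding f0(2) by (rule L2_bounded_mult[OF H2_L2[OF f0(1)], where B=1]) auto
  qed
  show "(\<lambda>x. 0) \<in> modulated_H2 k \<psi>"
    using L2_subspaceD(2)[OF H2_subspace] by (auto simp: modulated_H2_def intro!: exI[of _ "\<lambda>x. 0"])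
  show "(\<lambda>x. f x + g x) \<in> modulated_H2 k \<psi>" if fg: "f \<in> modulated_H2 k \<psi>" "g \<in> modulated_H2 k \<psi>" for f g
  proof -
    obtain f0 g0 where "f0 \<in> H2" "g0 \<in> H2" "f = (\<lambda>x. ?u x * f0 x)" "g = (\<lambda>x. ?u x * g0 x)"
      using fg unfolding modulated_H2_def by blast
    then show ?thesis using L2_subspaceD(3)[OF H2_subspace, of f0 g0]
      by (auto simp: modulated_H2_def distrib_left intro!: exI[of _ "\<lambda>x. f0 x + g0 x"])
  qed
  show "(\<lambda>x. c * f x) \<in> modulated_H2 k \<psi>" if f: "f \<in> modulated_H2 k \<psi>" for f c
  proof -
    obtain f0 where "f0 \<in> H2" "f = (\<lambda>x. ?u x * f0 x)" using f unfolding modulated_H2_def by blast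
    then show ?thesis using L2_subspaceD(4)[OF H2_subspace, of f0 c]
      by (auto simp: modulated_H2_def mult.left_commute intro!: exI[of _ "\<lambda>x. c * f0 x"])
  qed
qed

lemma L2_on_subspace: "L2_subspace (L2_on E)"
  unfolding L2_subspace_def
proof (intro conjI ballI allI subsetI)
  show "(\<lambda>x. f x + g x) \<in> L2_on E" if fg: "f \<in> L2_on E" "g \<in> L2_on E" for f g
  proof -
    have "AE x in lborel. x \<notin> E \<longrightarrow> f x = 0" "AE x in lborel. x \<notin> E \<longrightarrow> g x = 0" using fg by (auto simp: L2_on_def)
    then have "AE x in lborel. x \<notin> E \<longrightarrow> f x + g x = 0" by eventually_elim auto
    then show ?thesis using fg by (auto simp: L2_on_def)
  qed
qed (auto simp: L2_on_def)

text \<open>Only the Borel set \<open>U\<close> enters the formula; it is a model of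
  \<open>E\<close> up to a null set. This allows the preimage of the negative numbers under \<psi>'
  to be replaced by an open set.\<close>

lemma L2_on_proj:
  assumes U: "U \<in> sets borel" and EU: "AE x in lborel. x \<in> E \<longleftrightarrow> x \<in> U" and f: "f \<in> L2"
  shows "is_orth_proj (L2_on E) f (\<lambda>x. indicator U x * f x)"
  unfolding is_orth_proj_def
proof (intro conjI ballI)
  have L: "(\<lambda>x. indicator U x * f x) \<in> L2"
    by (rule L2_bounded_mult[OF f, where B=1]) (use U in \<open>auto simp: indicator_def\<close>)
  have "AE x in lborel. x \<notin> E \<longrightarrow> indicator U x * f x = 0"
    using EU by eventually_elim auto
  then show "(\<lambda>x. indicator U x * f x) \<in> L2_on E" using L by (simp add: L2_on_def)
  fix h assume "h \<in> L2_on E"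
  then have h: "h \<in> L2" "AE x in lborel. x \<notin> E \<longrightarrow> h x = 0" by (auto simp: L2_on_def)
  have "L2_inner (\<lambda>x. f x - indicator U x * f x) h = (LINT x::real|lborel. 0)"
    unfolding L2_inner_def
  proof (rule integral_cong_AE)
    show "(\<lambda>x. (f x - indicator U x * f x) * cnj (h x)) \<in> borel_measurable lborel"
      using L2_integrable_mult[OF L2_diff[OF f L] L2_cnj[OF h(1)]] by (rule borel_measurable_integrable)
    show "AE x in lborel. (f x - indicator U x * f x) * cnj (h x) = 0"
      using h(2) EU by eventually_elim auto
  qed simp
  then show "L2_inner (\<lambda>x. f x - indicator U x * f x) h = 0" by simp
qed

text \<open>By uniqueness almost everywhere, any explicit projections may stand in for the chosen
  ones.\<close>

lemma orth_proj_diff_norm: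
  assumes K: "L2_subspace K" "L2_subspace K'" and f: "f \<in> L2"
    and p: "is_orth_proj K f p" "is_orth_proj K' f p'"
  shows "L2_norm (\<lambda>x. orth_proj K f x - orth_proj K' f x) = L2_norm (\<lambda>x. p x - p' x)"
proof (rule L2_norm_cong_AE)
  have L: "p \<in> L2" "p' \<in> L2" "orth_proj K f \<in> L2" "orth_proj K' f \<in> L2"
    using is_orth_proj_L2 K p is_orth_proj_orth_proj by metis+
  show "(\<lambda>x. orth_proj K f x - orth_proj K' f x) \<in> borel_measurable borel" "(\<lambda>x. p x - p' x) \<in> borel_measurable borel"
    using L2_measurable[OF L2_diff[OF L(3,4)]] L2_measurable[OF L2_diff[OF L(1,2)]] .
  have "AE x in lborel. orth_proj K f x = p x" "AE x in lborel. orth_proj K' f x = p' x"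
    using is_orth_proj_unique[OF K(1) f is_orth_proj_orth_proj[OF p(1)] p(1)]
      is_orth_proj_unique[OF K(2) f is_orth_proj_orth_proj[OF p(2)] p(2)] .
  then show "AE x in lborel. orth_proj K f x - orth_proj K' f x = p x - p' x" by eventually_elim simp
qed

lemma orth_proj_diff_norm_add:
  assumes K: "L2_subspace K" "L2_subspace K'" and f: "f \<in> L2" "g \<in> L2"
    and ex: "\<And>f. f \<in> L2 \<Longrightarrow> \<exists>p. is_orth_proj K f p" "\<And>f. f \<in> L2 \<Longrightarrow> \<exists>p. is_orth_proj K' f p"
  shows "L2_norm (\<lambda>x. orth_proj K (\<lambda>x. f x + g x) x - orth_proj K' (\<lambda>x. f x + g x) x)
    \<le> L2_norm (\<lambda>x. orth_proj K f x - orth_proj K' f x) + L2_norm (\<lambda>x. orth_proj K g x - orth_proj K' g x)"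
proof -
  obtain p p' q q' where p: "is_orth_proj K f p" "is_orth_proj K' f p'" "is_orth_proj K g q" "is_orth_proj K' g q'"
    using ex f by metis
  have L: "p \<in> L2" "p' \<in> L2" "q \<in> L2" "q' \<in> L2" using is_orth_proj_L2 K p by metis+
  have "L2_norm (\<lambda>x. (p x + q x) - (p' x + q' x)) = L2_norm (\<lambda>x. (p x - p' x) + (q x - q' x))"
    by (rule L2_norm_cong) (simp add: algebra_simps)
  also have "\<dots> \<le> L2_norm (\<lambda>x. p x - p' x) + L2_norm (\<lambda>x. q x - q' x)"
    by (intro L2_norm_triangle L2_diff L)
  finally show ?thesis
    unfolding orth_proj_diff_norm[OF K f(1) p(1,2)] orth_proj_diff_norm[OF K f(2) p(3,4)]
      orth_proj_diff_norm[OF K L2_add[OF f] is_orth_proj_add[OF K(1) f p(1,3)] is_orth_proj_add[OF K(2) f p(2,4)]] .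
qed

lemma orth_proj_diff_norm_cmult:
  assumes K: "L2_subspace K" "L2_subspace K'" and f: "f \<in> L2"
    and p: "is_orth_proj K f p" "is_orth_proj K' f p'"
  shows "L2_norm (\<lambda>x. orth_proj K (\<lambda>x. c * f x) x - orth_proj K' (\<lambda>x. c * f x) x)
    = norm c * L2_norm (\<lambda>x. orth_proj K f x - orth_proj K' f x)"
  unfolding orth_proj_diff_norm[OF K f p]
    orth_proj_diff_norm[OF K L2_cmult[OF f] is_orth_proj_cmult[OF K(1) p(1)] is_orth_proj_cmult[OF K(2) p(2)]]
  by (simp only: right_diff_distrib[symmetric] L2_norm_cmult)

text \<open>The bound is the same for all pairs of subspaces, which lets the convergence pass to
  limits in norm.\<close>

lemma orth_proj_diff_norm_le:
  assumes K: "L2_subspace K" "L2_subspace K'" and f: "f \<in> L2"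
    and p: "is_orth_proj K f p" "is_orth_proj K' f p'"
  shows "L2_norm (\<lambda>x. orth_proj K f x - orth_proj K' f x) \<le> 2 * L2_norm f"
proof -
  have L: "p \<in> L2" "p' \<in> L2" using is_orth_proj_L2 K p by metis+
  have "L2_norm (\<lambda>x. p x - p' x) \<le> L2_norm p + L2_norm (\<lambda>x. -1 * p' x)"
    using L2_norm_triangle[OF L(1) L2_cmult[OF L(2), of "-1"]] by simp
  also have "L2_norm (\<lambda>x. -1 * p' x) = L2_norm p'" by (simp only: L2_norm_cmult) simp
  finally show ?thesis unfolding orth_proj_diff_norm[OF K f p]
    using is_orth_proj_norm_le(1)[OF K(1) f p(1)] is_orth_proj_norm_le(1)[OF K(2) f p(2)] by linarith
qed

section \<open>Strong convergence\<close>

lemma no_accumulation_points_closed: "no_accumulation_points S \<Longrightarrow> closed S"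
  by (auto simp: no_accumulation_points_def closed_limpt)

lemma no_accumulation_points_countable: "no_accumulation_points S \<Longrightarrow> countable S"
  unfolding no_accumulation_points_def by (intro no_limpt_imp_countable) auto

lemma not_Gamma_setD:
  assumes "x \<notin> Gamma_set \<psi>"
  shows "(\<psi> has_real_derivative deriv \<psi> x) (at x)"
    "(deriv \<psi> has_real_derivative deriv (deriv \<psi>) x) (at x)"
    "isCont (deriv (deriv \<psi>)) x"
proof -
  obtain U where U: "open U" "x \<in> U" "twice_differentiable_on \<psi> U" "continuous_on U (deriv (deriv \<psi>))"
    using assms by (auto simp: Gamma_set_def)
  then show "(\<psi> has_real_derivative deriv \<psi> x) (at x)"
    "(deriv \<psi> has_real_derivative deriv (deriv \<psi>) x) (at x)"
    by (auto simp: twice_differentiable_on_def DERIV_deriv_iff_real_differentiable)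
  show "isCont (deriv (deriv \<psi>)) x" using U by (simp add: continuous_on_eq_continuous_at)
qed

text \<open>Off the closed set \<psi> is continuous; on the countable set its values are arbitrary,
  which cannot spoil Borel measurability.\<close>

lemma measurable_if_countable_Gamma_set:
  assumes "closed (Gamma_set \<psi>)" "countable (Gamma_set \<psi>)"
  shows "\<psi> \<in> borel_measurable borel"
proof (rule measurable_discrete_difference)
  have "continuous_on (- Gamma_set \<psi>) \<psi>"
    using not_Gamma_setD(1) by (intro continuous_at_imp_continuous_on ballI DERIV_isCont) auto
  then show "(\<lambda>x. indicator (- Gamma_set \<psi>) x *\<^sub>R \<psi> x) \<in> borel_measurable borel"
    using assms(1) by (intro borel_measurable_continuous_on_indicator) auto
qed (use assms in auto)

theorem theorem3p4:
  fixes k :: "nat \<Rightarrow> real" and \<psi> :: "real \<Rightarrow> real"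
  assumes "\<And>n. k n > 0"
    and "filterlim k at_top sequentially"
    and "admissible \<psi>"
  shows "sot_tendsto (\<lambda>n. orth_proj (modulated_H2 (k n) \<psi>))
           (orth_proj (L2_on (deriv_preimage \<psi> {..<0})))"
proof -
  note k = assms(1)
  define \<Gamma> where "\<Gamma> = Gamma_set \<psi>"
  define Z where "Z = deriv_preimage \<psi> {0}"
  define B where "B = deriv_preimage \<psi> {..<0}"
  have \<Gamma>: "closed \<Gamma>" "countable \<Gamma>" and Z: "countable Z"
    using assms(3) unfolding admissible_def \<Gamma>_def Z_def
    by (auto intro: no_accumulation_points_closed no_accumulation_points_countable)
  note reg = not_Gamma_setD[of _ \<psi>, folded \<Gamma>_def]
  have \<psi>m [measurable]: "\<psi> \<in> borel_measurable borel"
    using \<Gamma> unfolding \<Gamma>_def by (rule measurable_if_countable_Gamma_set)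
  \<comment> \<open>Open models of the regions with \<psi>' < 0 and \<psi>' > 0. Compared with
    \<open>N\<close>, the set \<open>B\<close> may also contain points of \<Gamma> where \<psi> is
    differentiable; these form a null set.\<close>
  define N where "N = - \<Gamma> \<inter> deriv \<psi> -` {..<0}"
  define P where "P = - \<Gamma> \<inter> deriv \<psi> -` {0<..}"
  have cont: "continuous_on (- \<Gamma>) (deriv \<psi>)"
    using reg(2) by (intro continuous_at_imp_continuous_on ballI DERIV_isCont) auto
  have open_NP: "open N" "open P"
    unfolding N_def P_def using \<Gamma>(1) by (auto intro!: continuous_open_preimage[OF cont])
  have AE\<Gamma>: "AE x in lborel. x \<notin> \<Gamma>" and AEZ: "AE x in lborel. x \<notin> Z"
    using AE_not_in[OF countable_imp_null_set_lborel] \<Gamma>(2) Z by auto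
  have AE_B: "AE x in lborel. x \<in> B \<longleftrightarrow> x \<in> N"
    using AE\<Gamma> by eventually_elim
      (use reg(1) in \<open>auto simp: B_def N_def deriv_preimage_def real_differentiable_def\<close>)
  have AE_NP: "AE x in lborel. x \<in> N \<or> x \<in> P"
    using AE\<Gamma> AEZ
  proof eventually_elim
    case (elim x)
    then have "deriv \<psi> x \<noteq> 0"
      using reg(1)[of x] by (auto simp: Z_def deriv_preimage_def real_differentiable_def)
    then show ?case using elim by (auto simp: N_def P_def)
  qed
  define u where "u n x = exp (\<i> * complex_of_real (k n * \<psi> x))" for n x
  have um [measurable]: "u n \<in> borel_measurable borel" for n
    unfolding u_def
    by (rule borel_measurable_continuous_on[of "\<lambda>r. exp (\<i> * complex_of_real (k n * r))"]) (auto intro!: continuous_intros)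
  have nu: "norm (u n x) = 1" for n x by (simp add: u_def)
  have cu: "cnj (u n x) = exp (\<i> * complex_of_real (k n * - \<psi> x))" for n x
    by (simp add: u_def exp_cnj)
  have uf: "(\<lambda>x. cnj (u n x) * f x) \<in> L2" if "f \<in> L2" for f n
    by (rule L2_bounded_mult[OF that, where B=1]) (auto simp: nu)
  let ?K = "\<lambda>n. modulated_H2 (k n) \<psi>"
  note sub = modulated_H2_subspace[OF \<psi>m] L2_on_subspace[of B]
  have exH: "\<exists>p. is_orth_proj H2 f p" if "f \<in> L2" for f
    using is_orth_proj_exists[OF H2_subspace H2_closed that] by blast
  have projK: "is_orth_proj (?K n) f (\<lambda>x. u n x * p x)" if "is_orth_proj H2 (\<lambda>x. cnj (u n x) * f x) p" for n f p
    by (rule modulated_H2_proj[OF _ that]) (simp add: u_def[abs_def])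
  have exK: "\<exists>p. is_orth_proj (?K n) f p" if "f \<in> L2" for n f
    using exH[OF uf[OF that]] projK by blast
  have N: "N \<in> sets borel" using open_NP by simp
  note projB = L2_on_proj[OF N AE_B]
  have exB: "\<exists>p. is_orth_proj (L2_on B) f p" if "f \<in> L2" for f
    using projB[OF that] by blast
  define D where "D f n = L2_norm (\<lambda>x. orth_proj (?K n) f x - orth_proj (L2_on B) f x)" for f n
  have D_add: "D (\<lambda>x. f x + g x) n \<le> D f n + D g n" if "f \<in> L2" "g \<in> L2" for f g n
    unfolding D_def by (rule orth_proj_diff_norm_add[OF sub that exK exB])
  have D_cmult: "D (\<lambda>x. c * f x) n = norm c * D f n" if "f \<in> L2" for f n c
    unfolding D_def using exK[OF that, of n] exB[OF that] orth_proj_diff_norm_cmult[OF sub that] by blast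
  have D_le: "D f n \<le> 2 * L2_norm f" if "f \<in> L2" for f n
    unfolding D_def using exK[OF that, of n] exB[OF that] orth_proj_diff_norm_le[OF sub that] by blast
  have D_nonneg: "0 \<le> D f n" for f n by (simp add: D_def)
  have sum_lim: "D (\<lambda>x. f x + g x) \<longlonglongrightarrow> 0" if "f \<in> L2" "D f \<longlonglongrightarrow> 0" "g \<in> L2" "D g \<longlonglongrightarrow> 0" for f g
  proof (rule Lim_null_comparison)
    show "eventually (\<lambda>n. norm (D (\<lambda>x. f x + g x) n) \<le> D f n + D g n) sequentially"
      using D_add[OF that(1,3)] D_nonneg by simp
    show "(\<lambda>n. D f n + D g n) \<longlonglongrightarrow> 0" using tendsto_add[OF that(2,4)] by simp
  qed
  \<comment> \<open>The error \<open>D\<close> is subadditive, homogeneous and at most twice the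
    norm uniformly in \<open>n\<close>, so convergence to 0 needs to be checked only on
    intervals.\<close>
  have dense: "D f \<longlonglongrightarrow> 0"
    if U: "open U" and f: "f \<in> L2" "AE x in lborel. x \<notin> U \<longrightarrow> f x = 0"
      and base: "\<And>a b. a \<le> b \<Longrightarrow> {a..b} \<subseteq> U \<Longrightarrow> D (indicator {a..b}) \<longlonglongrightarrow> 0" for U f
    using U f
  proof (induction f rule: L2_on_induct)
    case (interval a b)
    show ?case
    proof (cases "a \<le> b")
      case False
      then have "indicator {a..b} = (\<lambda>x::real. 0 * (0::complex))" by auto
      then show ?thesis using D_cmult[OF L2_zero, of 0] by simp
    qed (use interval base in blast)
  next
    case (add f g)
    then show ?case by (intro sum_lim)
  next
    case (cmult f c)
    then show ?case using tendsto_mult_left[OF cmult.IH, of "norm c"] D_cmult[OF cmult.hyps] by simp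
  next
    case (lim s f)
    note L = lim.hyps(1,2)
    have le: "D f n \<le> 2 * L2_norm (\<lambda>x. s m x - f x) + D (s m) n" for n m
      using D_add[OF L2_diff[OF L(2) L(1)[of m]] L(1)[of m], of n] D_le[OF L2_diff[OF L(2) L(1)[of m]], of n]
        L2_norm_minus_commute[of f "s m"] by simp
    show ?case
    proof (rule LIMSEQ_I)
      fix e :: real assume e: "0 < e"
      obtain m where m: "L2_norm (\<lambda>x. s m x - f x) < e / 4"
        using LIMSEQ_D[OF lim.hyps(3), of "e / 4"] e by auto
      obtain n0 where n0: "\<And>n. n \<ge> n0 \<Longrightarrow> norm (D (s m) n - 0) < e / 2"
        using LIMSEQ_D[OF lim.IH[of m], of "e / 2"] e by auto
      have "norm (D f n - 0) < e" if "n \<ge> n0" for n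
        using n0[OF that] le[of n m] m D_nonneg[of f n] D_nonneg[of "s m" n] by simp
      then show "\<exists>n0. \<forall>n\<ge>n0. norm (D f n - 0) < e" by blast
    qed
  qed
  have conv: "D f \<longlonglongrightarrow> 0" if C: "\<And>n. D f n \<le> C / sqrt (k n)" for f C
  proof (rule Lim_null_comparison)
    show "eventually (\<lambda>n. norm (D f n) \<le> C / sqrt (k n)) sequentially" using C D_nonneg by simp
    have "filterlim (\<lambda>n. sqrt (k n)) at_infinity sequentially"
      by (intro filterlim_at_top_imp_at_infinity filterlim_compose[OF sqrt_at_top assms(2)])
    then show "(\<lambda>n. C / sqrt (k n)) \<longlonglongrightarrow> 0" by (rule tendsto_divide_0[OF tendsto_const])
  qed
  have ind_L2: "(indicator {a..b} :: real \<Rightarrow> complex) \<in> L2" for a b :: real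
  proof -
    have "(\<lambda>x. (norm (indicator {a..b} x :: complex))\<^sup>2) = (indicator {a..b} :: real \<Rightarrow> real)"
      by (auto simp: indicator_def fun_eq_iff)
    then show ?thesis by (simp add: L2_iff emeasure_lborel_Icc_eq)
  qed
  \<comment> \<open>A continuous negative function on a compact interval attains its maximum, which
    is still negative.\<close>
  have gap: "\<exists>c>0. \<forall>x\<in>{a..b}. h x \<le> - c"
    if h: "continuous_on {a..b} h" "\<And>x. x \<in> {a..b} \<Longrightarrow> h x < 0" "a \<le> b" for h :: "real \<Rightarrow> real" and a b
  proof -
    obtain x where x: "x \<in> {a..b}" "\<And>y. y \<in> {a..b} \<Longrightarrow> h y \<le> h x"
      using continuous_attains_sup[OF _ _ h(1)] h(3) by auto
    then show ?thesis using h(2)[OF x(1)] by (intro exI[of _ "- h x"]) auto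
  qed
  have cont2: "continuous_on {a..b} (deriv (deriv \<psi>))" if "{a..b} \<subseteq> - \<Gamma>" for a b
    using reg(3) that by (intro continuous_at_imp_continuous_on) auto
  \<comment> \<open>Here \<open>g\<close> has phase \<open>-\<psi>\<close>, whose derivative is
    negative, so the bound applies to \<open>g\<close> itself and makes its projection
    small.\<close>
  have baseP: "D (indicator {a..b}) \<longlonglongrightarrow> 0" if ab: "a \<le> b" "{a..b} \<subseteq> P" for a b
  proof -
    have sub\<Gamma>: "{a..b} \<subseteq> - \<Gamma>" and pos: "\<And>x. x \<in> {a..b} \<Longrightarrow> deriv \<psi> x > 0"
      using ab(2) by (auto simp: P_def)
    obtain c where c: "c > 0" "\<And>x. x \<in> {a..b} \<Longrightarrow> - deriv \<psi> x \<le> - c"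
      using gap[OF continuous_on_minus[OF continuous_on_subset[OF cont sub\<Gamma>]]] pos ab(1) by auto
    have nx: "x \<notin> \<Gamma>" if "x \<in> {a..b}" for x using sub\<Gamma> that by blast
    have d1: "((\<lambda>x. - \<psi> x) has_real_derivative - deriv \<psi> x) (at x)"
      and d2: "((\<lambda>x. - deriv \<psi> x) has_real_derivative - deriv (deriv \<psi>) x) (at x)" if "x \<in> {a..b}" for x
      using DERIV_minus[OF reg(1)[OF nx[OF that]]] DERIV_minus[OF reg(2)[OF nx[OF that]]] .
    obtain C where C: "\<And>k y. 0 < k \<Longrightarrow> 0 < y \<Longrightarrow>
        L2_norm (\<lambda>x. cauchy_integral (\<lambda>x. indicator {a..b} x * exp (\<i> * of_real (k * - \<psi> x))) (Complex x y)) \<le> C / sqrt k"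
      using cauchy_integral_phase_bound[OF ab(1) c(1) d1 d2 continuous_on_minus[OF cont2[OF sub\<Gamma>]] c(2)] by blast
    show ?thesis
    proof (rule conv)
      fix n
      let ?g = "\<lambda>x. cnj (u n x) * indicator {a..b} x"
      obtain p where p: "is_orth_proj H2 ?g p" using exH[OF uf[OF ind_L2]] by blast
      have "L2_norm p \<le> C / sqrt (k n)"
      proof (rule H2_proj_norm_le[OF uf[OF ind_L2] p])
        fix y :: real assume "0 < y"
        from C[OF k this] show "L2_norm (\<lambda>x. cauchy_integral ?g (Complex x y)) \<le> C / sqrt (k n)"
          by (simp only: cu mult.commute[of "indicator _ _"])
      qed
      moreover have "D (indicator {a..b}) n = L2_norm (\<lambda>x. u n x * p x - indicator N x * indicator {a..b} x)"
        unfolding D_def by (rule orth_proj_diff_norm[OF sub ind_L2 projK[OF p] projB[OF ind_L2]])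
      \<comment> \<open>The interval lies in \<open>P\<close> and hence misses \<open>N\<close>, so
        the limit projection sends its indicator to 0.\<close>
      moreover have "\<dots> = L2_norm p"
        using ab(2) by (intro L2_norm_cong) (auto simp: indicator_def N_def P_def norm_mult nu)
      ultimately show "D (indicator {a..b}) n \<le> C / sqrt (k n)" by simp
    qed
  qed
  \<comment> \<open>Now the conjugate of \<open>g\<close>, with phase \<psi>, meets the sign
    condition; the small quantity is the residual, and the limit projection fixes the
    indicator.\<close>
  have baseN: "D (indicator {a..b}) \<longlonglongrightarrow> 0" if ab: "a \<le> b" "{a..b} \<subseteq> N" for a b
  proof -
    have sub\<Gamma>: "{a..b} \<subseteq> - \<Gamma>" and neg: "\<And>x. x \<in> {a..b} \<Longrightarrow> deriv \<psi> x < 0"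
      using ab(2) by (auto simp: N_def)
    obtain c where c: "c > 0" "\<And>x. x \<in> {a..b} \<Longrightarrow> deriv \<psi> x \<le> - c"
      using gap[of a b "deriv \<psi>"] continuous_on_subset[OF cont sub\<Gamma>] neg ab(1) by auto
    have nx: "x \<notin> \<Gamma>" if "x \<in> {a..b}" for x using sub\<Gamma> that by blast
    have d1: "(\<psi> has_real_derivative deriv \<psi> x) (at x)"
      and d2: "(deriv \<psi> has_real_derivative deriv (deriv \<psi>) x) (at x)" if "x \<in> {a..b}" for x
      using reg(1,2)[OF nx[OF that]] .
    obtain C where C: "\<And>k y. 0 < k \<Longrightarrow> 0 < y \<Longrightarrow>
        L2_norm (\<lambda>x. cauchy_integral (\<lambda>x. indicator {a..b} x * exp (\<i> * of_real (k * \<psi> x))) (Complex x y)) \<le> C / sqrt k"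
      using cauchy_integral_phase_bound[OF ab(1) c(1) d1 d2 cont2[OF sub\<Gamma>] c(2)] by blast
    show ?thesis
    proof (rule conv)
      fix n
      let ?g = "\<lambda>x. cnj (u n x) * indicator {a..b} x"
      obtain p where p: "is_orth_proj H2 ?g p" using exH[OF uf[OF ind_L2]] by blast
      have cg: "(\<lambda>x. cnj (?g x)) = (\<lambda>x. indicator {a..b} x * exp (\<i> * complex_of_real (k n * \<psi> x)))"
        by (auto simp: indicator_def u_def fun_eq_iff)
      have "L2_norm (\<lambda>x. ?g x - p x) \<le> C / sqrt (k n)"
      proof (rule H2_proj_residual_norm_le[OF uf[OF ind_L2] p])
        fix y :: real assume "0 < y"
        from C[OF k this] show "L2_norm (\<lambda>x. cauchy_integral (\<lambda>t. cnj (?g t)) (Complex x y)) \<le> C / sqrt (k n)"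
          unfolding cg .
      qed
      moreover have "D (indicator {a..b}) n = L2_norm (\<lambda>x. u n x * p x - indicator N x * indicator {a..b} x)"
        unfolding D_def by (rule orth_proj_diff_norm[OF sub ind_L2 projK[OF p] projB[OF ind_L2]])
      moreover have "\<dots> = L2_norm (\<lambda>x. ?g x - p x)"
      proof (rule L2_norm_cong)
        fix x
        have uu: "u n x * cnj (u n x) = 1" unfolding complex_norm_square[symmetric] by (simp add: nu)
        have "indicator N x * indicator {a..b} x = (indicator {a..b} x :: complex)"
          using ab(2) by (auto simp: indicator_def)
        then have "u n x * p x - indicator N x * indicator {a..b} x = u n x * p x - (u n x * cnj (u n x)) * indicator {a..b} x"
          by (simp add: uu)
        also have "\<dots> = - (u n x * (?g x - p x))" by (simp add: algebra_simps)
        finally show "norm (u n x * p x - indicator N x * indicator {a..b} x) = norm (?g x - p x)"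
          by (simp add: norm_mult nu)
      qed
      ultimately show "D (indicator {a..b}) n \<le> C / sqrt (k n)" by simp
    qed
  qed
  show ?thesis
    unfolding sot_tendsto_def B_def[symmetric]
  proof
    fix f assume f: "f \<in> L2"
    have ind: "(\<lambda>x. indicator A x * f x) \<in> L2" if "open A" for A
    proof (rule L2_bounded_mult[OF f borel_measurable_indicator, where B=1])
      show "A \<in> sets borel" using that by (rule borel_open)
    qed (simp add: indicator_def)
    have 1: "D (\<lambda>x. indicator N x * f x) \<longlonglongrightarrow> 0"
      by (rule dense[OF open_NP(1) ind[OF open_NP(1)] _ baseN]) auto
    have 2: "D (\<lambda>x. indicator P x * f x) \<longlonglongrightarrow> 0"
      by (rule dense[OF open_NP(2) ind[OF open_NP(2)] _ baseP]) auto
    let ?fNP = "\<lambda>x. indicator N x * f x + indicator P x * f x"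
    have LNP: "?fNP \<in> L2" by (intro L2_add ind open_NP)
    \<comment> \<open>The remainder vanishes almost everywhere but need not be the zero function, so
      its error is controlled through its norm.\<close>
    have rest: "D (\<lambda>x. f x - ?fNP x) \<longlonglongrightarrow> 0"
    proof -
      have L: "(\<lambda>x. f x - ?fNP x) \<in> L2" by (intro L2_diff f LNP)
      have "AE x in lborel. f x - ?fNP x = 0"
        using AE_NP by eventually_elim (auto simp: N_def P_def indicator_def)
      then have "L2_norm (\<lambda>x. f x - ?fNP x) = 0" using L2_norm_eq_0[OF L] by simp
      then have "D (\<lambda>x. f x - ?fNP x) n = 0" for n using D_le[OF L, of n] D_nonneg by (simp add: order_antisym)
      then have "D (\<lambda>x. f x - ?fNP x) = (\<lambda>n. 0)" by (rule ext)
      then show ?thesis by (simp only: tendsto_const)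
    qed
    have "D (\<lambda>x. (f x - ?fNP x) + ?fNP x) \<longlonglongrightarrow> 0"
      by (intro sum_lim rest 1 2 L2_diff f LNP ind open_NP)
    then have "(\<lambda>n. D f n) \<longlonglongrightarrow> 0" by simp
    then have "(\<lambda>n. L2_norm (\<lambda>x. orth_proj (?K n) f x - orth_proj (L2_on B) f x)) \<longlonglongrightarrow> 0"
      unfolding D_def .
    \<comment> \<open>Membership excludes the case where \<open>L2_norm\<close> is 0 only by default
      and permits the return to \<open>L2_norm_sq\<close>.\<close>
    moreover have "eventually (\<lambda>n. (\<lambda>x. orth_proj (?K n) f x - orth_proj (L2_on B) f x) \<in> L2) sequentially"
    proof (intro always_eventually allI L2_diff)
      show "orth_proj (?K n) f \<in> L2" for n
        using exK[OF f, of n] is_orth_proj_orth_proj is_orth_proj_L2[OF sub(1)] by blast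
      show "orth_proj (L2_on B) f \<in> L2"
        using exB[OF f] is_orth_proj_orth_proj is_orth_proj_L2[OF sub(2)] by blast
    qed
    ultimately show "(\<lambda>n. L2_norm_sq (\<lambda>x. orth_proj (?K n) f x - orth_proj (L2_on B) f x)) \<longlonglongrightarrow> 0"
      by (simp only: L2_norm_sq_tendsto_0_iff)
  qed
qed

end
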